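(* Let $n\in\mathbb{N}$, let $\Omega\subset\mathbb{R}^n$ be an open bounded $C^{1,1}$ domain, let $M\in\mathbb{R}^{n\times n}$, and let $K=K(\theta)\subset\mathbb{R}^{n\times n}$, for some fixed $\theta\in\mathbb{R}_+$, be the set of energy wells defined in the context. For $\epsilon>0$ let $$E_{\epsilon,1}=\min_{\nabla u=M \text{ a.e. in } \mathbb{R}^n\setminus\overline{\Omega}}\left\{\int_{\Omega}\operatorname{dist}^2(\nabla u,K)\,dx+\epsilon\,|\nabla^2u|(\Omega)\right\},$$ where $|\nabla^2u|(\Omega)$ denotes the total variation on $\Omega$ of the distributional derivative of $\nabla u$. Assume that there exist constants $C>1$, $\epsilon_0>0$ and $\mu\in(0,\tfrac12)$ such that for all $\epsilon\in(0,\epsilon_0)$ $$\epsilon^{2\mu}\le C\,E_{\epsilon,1}.$$ Suppose that $u:\mathbb{R}^n\to\mathbb{R}^n$ is a solution to $$\nabla u\in K \ \text{ a.e. in } \Omega,\qquad \nabla u=M\ \text{ a.e. in } \mathbb{R}^n\setminus\overline{\Omega}.$$ If, for some $b\in\mathbb{R}^n$ and $s\in\mathbb{R}$, the function $v(x)=u(x)-Mx-b$ satisfies $v\in B^{1+s}_{1,1}(\mathbb{R}^n)$, $\operatorname{supp}(v)\subset\overline{\Omega}$ and $\nabla v\in L^{\infty}(\mathbb{R}^n)$, then $s\le2\mu$.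
   Context: Energy wells: for $\theta\in\mathbb{R}_+$ and a fixed critical temperature $\theta_c\in\mathbb{R}_+$, $$K(\theta)=\begin{cases}\alpha(\theta)\,SO(n) & \text{if }\theta>\theta_c,\\ \bigcup_{j=1}^{m}SO(n)\,U_j(\theta) & \text{if }\theta\le\theta_c,\end{cases}$$ where $\alpha:\mathbb{R}_+\to\mathbb{R}_+$ is a given function, $m\in\mathbb{N}$, and $U_j(\theta)=U_j(\theta)^t\in\mathbb{R}^{n\times n}$, $j=1,\dots,m$, are given symmetric matrices. $\operatorname{dist}(\cdot,K)$ is the Euclidean (Frobenius) distance to $K$ in $\mathbb{R}^{n\times n}$. The minimum (read as an infimum) defining the energy is over maps $u:\mathbb{R}^n\to\mathbb{R}^n$ in $H^1_{loc}(\mathbb{R}^n;\mathbb{R}^n)$ with $\nabla u=M$ a.e. in $\mathbb{R}^n\setminus\overline{\Omega}$ and $\nabla u\in BV(\Omega)$. Besov spaces: let $\varphi$ be a non-negative, radially symmetric smooth bump function supported in $\{k\in\mathbb{R}^n:|k|\le2\}$ and equal to one on $\{k\in\mathbb{R}^n:|k|\le1\}$. For $N\in2^{\mathbb{Z}}=\{2^j:j\in\mathbb{Z}\}$ define the Littlewood-Paley projector $P_N$ by $\mathcal{F}(P_Nf)(k)=(\varphi(k/N)-\varphi(2k/N))\mathcal{F}f(k)$, where $\mathcal{F}$ is the Fourier transform. For $\sigma\in\mathbb{R}$ and $p\in[1,\infty)$, $B^{\sigma}_{p,p}(\mathbb{R}^n)$ is the space of distributions $f$ with $\|f\|_{B^{\sigma}_{p,p}(\mathbb{R}^n)}=\big(\sum_{N\in2^{\mathbb{Z}}}N^{\sigma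 p}\|P_Nf\|_{L^p(\mathbb{R}^n)}^p\big)^{1/p}<\infty$; vector-valued functions are treated componentwise. *)

theory Defs
  imports "HOL-Analysis.Analysis"
begin

text \<open>
  Measurability and integrals refer to the completed measure \<^term>\<open>lebesgue\<close>, so arbitrary
  Lebesgue measurable representatives are allowed.  Matrices have type \<open>real^'n^'n\<close>, whose
  norm is the Frobenius norm, and entry \<open>(i, j)\<close> of a gradient is \<open>\<partial>\<^sub>j u\<^sub>i\<close>.
\<close>

section \<open>Smooth functions\<close>

primrec iter_deriv :: "'a::euclidean_space list \<Rightarrow> ('a \<Rightarrow> 'b::real_normed_vector) \<Rightarrow> 'a \<Rightarrow> 'b" where
  "iter_deriv [] f = f"
| "iter_deriv (e # es) f = (\<lambda>x. frechet_derivative (iter_deriv es f) (at x) e)"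

definition smooth :: "('a::euclidean_space \<Rightarrow> 'b::real_normed_vector) \<Rightarrow> bool" where
  "smooth f \<longleftrightarrow> (\<forall>es. set es \<subseteq> Basis \<longrightarrow> (\<forall>x. iter_deriv es f differentiable (at x)))"

definition test_function :: "'a::euclidean_space set \<Rightarrow> ('a \<Rightarrow> 'b::real_normed_vector) \<Rightarrow> bool" where
  "test_function \<Omega> f \<longleftrightarrow>
     smooth f \<and> compact (closure {x. f x \<noteq> 0}) \<and> closure {x. f x \<noteq> 0} \<subseteq> \<Omega>"

section \<open>Bounded \<open>C\<^sup>1\<^sup>,\<^sup>1\<close> domains\<close>

definition C11_function :: "('a::euclidean_space \<Rightarrow> real) \<Rightarrow> bool" where
  "C11_function g \<longleftrightarrow>
     (\<exists>D L. (\<forall>x. (g has_derivative (\<lambda>h. D x \<bullet> h)) (at x)) \<and> L-lipschitz_on UNIV D)"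

text \<open>
  Near every boundary point, \<open>\<Omega>\<close> is the region above a graph.  The unit vector \<open>e\<close> is the vertical
  direction and \<open>x - (x \<bullet> e) e\<close> are the horizontal coordinates; only the values of \<open>g\<close> on the
  hyperplane orthogonal to \<open>e\<close> matter, and every \<open>C\<^sup>1\<^sup>,\<^sup>1\<close> function on this hyperplane extends
  to the whole space (constantly in the direction \<open>e\<close>).
\<close>

definition C11_boundary :: "'a::euclidean_space set \<Rightarrow> bool" where
  "C11_boundary \<Omega> \<longleftrightarrow>
     (\<forall>x0\<in>frontier \<Omega>. \<exists>r>0. \<exists>e g. norm e = 1 \<and> C11_function g \<and>
        \<Omega> \<inter> ball x0 r = {x \<in> ball x0 r. x \<bullet> e > g (x - (x \<bullet> e) *\<^sub>R e)})"

definition bounded_C11_domain :: "'a::euclidean_space set \<Rightarrow> bool" where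
  "bounded_C11_domain \<Omega> \<longleftrightarrow> open \<Omega> \<and> connected \<Omega> \<and> \<Omega> \<noteq> {} \<and> bounded \<Omega> \<and> C11_boundary \<Omega>"

section \<open>Energy wells\<close>

definition energy_wells ::
    "real \<Rightarrow> (real \<Rightarrow> real) \<Rightarrow> nat \<Rightarrow> (nat \<Rightarrow> real \<Rightarrow> real^'n^'n) \<Rightarrow> real \<Rightarrow> (real^'n^'n) set" where
  "energy_wells \<theta>c \<alpha> m U \<theta> =
     (if \<theta> > \<theta>c then {\<alpha> \<theta> *\<^sub>R R | R. rotation_matrix R}
      else (\<Union>j\<in>{1..m}. {R ** U j \<theta> | R. rotation_matrix R}))"

section \<open>Weak gradients and the singularly perturbed energy\<close>

definition locally_integrable :: "('a::euclidean_space \<Rightarrow> 'b::euclidean_space) \<Rightarrow> bool" where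
  "locally_integrable f \<longleftrightarrow> (\<forall>S. compact S \<longrightarrow> f absolutely_integrable_on S)"

definition locally_L2 :: "('a::euclidean_space \<Rightarrow> 'b::euclidean_space) \<Rightarrow> bool" where
  "locally_L2 f \<longleftrightarrow> f \<in> borel_measurable lebesgue \<and>
     (\<forall>S. compact S \<longrightarrow> (\<lambda>x. (norm (f x))\<^sup>2) absolutely_integrable_on S)"

definition has_weak_gradient :: "(real^'n \<Rightarrow> real^'n) \<Rightarrow> (real^'n \<Rightarrow> real^'n^'n) \<Rightarrow> bool" where
  "has_weak_gradient u G \<longleftrightarrow> locally_integrable u \<and> locally_integrable G \<and>
     (\<forall>\<zeta> :: real^'n \<Rightarrow> real. test_function UNIV \<zeta> \<longrightarrow>
        (\<forall>i j. (LINT x|lebesgue. u x $ i * frechet_derivative \<zeta> (at x) (axis j 1))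
             = - (LINT x|lebesgue. G x $ i $ j * \<zeta> x)))"

text \<open>
  \<open>|\<nabla>G|(\<Omega>)\<close>, the supremum of the pairings of \<open>G\<close> with the divergence of test fields with values in
  the Euclidean unit ball of third-order tensors.  The integral is nonnegative for \<open>\<Phi>\<close> or for
  \<open>-\<Phi>\<close>, so truncation by \<^term>\<open>ennreal\<close> does not affect the supremum.
\<close>

definition total_variation :: "(real^'n) set \<Rightarrow> (real^'n \<Rightarrow> real^'n^'n) \<Rightarrow> ennreal" where
  "total_variation \<Omega> G =
     (SUP \<Phi> \<in> {\<Phi> :: real^'n \<Rightarrow> real^'n^'n^'n. test_function \<Omega> \<Phi> \<and> (\<forall>x. norm (\<Phi> x) \<le> 1)}.
        ennreal (LINT x:\<Omega>|lebesgue. (\<Sum>i\<in>UNIV. \<Sum>j\<in>UNIV. G x $ i $ j *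
          (\<Sum>k\<in>UNIV. frechet_derivative \<Phi> (at x) (axis k 1) $ i $ j $ k))))"

definition BV_on :: "(real^'n) set \<Rightarrow> (real^'n \<Rightarrow> real^'n^'n) \<Rightarrow> bool" where
  "BV_on \<Omega> G \<longleftrightarrow> G absolutely_integrable_on \<Omega> \<and> total_variation \<Omega> G < \<infinity>"

text \<open>Admissible maps \<open>u\<close> are paired with (a representative \<open>G\<close> of) their weak gradient.\<close>

definition admissible ::
    "(real^'n) set \<Rightarrow> real^'n^'n \<Rightarrow> ((real^'n \<Rightarrow> real^'n) \<times> (real^'n \<Rightarrow> real^'n^'n)) set" where
  "admissible \<Omega> M = {(u, G). locally_L2 u \<and> locally_L2 G \<and> has_weak_gradient u G \<and>
     (AE x in lebesgue. x \<notin> closure \<Omega> \<longrightarrow> G x = M) \<and> BV_on \<Omega> G}"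

definition min_energy ::
    "(real^'n) set \<Rightarrow> real^'n^'n \<Rightarrow> (real^'n^'n) set \<Rightarrow> real \<Rightarrow> ennreal" where
  "min_energy \<Omega> M K \<epsilon> =
     (INF (u, G) \<in> admissible \<Omega> M.
        (\<integral>\<^sup>+x\<in>\<Omega>. ennreal ((infdist (G x) K)\<^sup>2) \<partial>lebesgue) + ennreal \<epsilon> * total_variation \<Omega> G)"

definition solves_inclusion ::
    "(real^'n) set \<Rightarrow> real^'n^'n \<Rightarrow> (real^'n^'n) set \<Rightarrow> (real^'n \<Rightarrow> real^'n) \<Rightarrow> bool" where
  "solves_inclusion \<Omega> M K u \<longleftrightarrow>
     (\<exists>G. has_weak_gradient u G \<and> (AE x in lebesgue. x \<in> \<Omega> \<longrightarrow> G x \<in> K) \<and>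
          (AE x in lebesgue. x \<notin> closure \<Omega> \<longrightarrow> G x = M))"

definition weak_gradient_Linfty :: "(real^'n \<Rightarrow> real^'n) \<Rightarrow> bool" where
  "weak_gradient_Linfty v \<longleftrightarrow>
     (\<exists>G B. has_weak_gradient v G \<and> (AE x in lebesgue. norm (G x) \<le> B))"

text \<open>The support of an almost-everywhere class, i.e. the support of the associated distribution.\<close>

definition ess_support :: "('a::euclidean_space \<Rightarrow> 'b::real_normed_vector) \<Rightarrow> 'a set" where
  "ess_support f = - \<Union>{W. open W \<and> (AE x in lebesgue. x \<in> W \<longrightarrow> f x = 0)}"

section \<open>Tempered distributions\<close>

definition schwartz :: "('a::euclidean_space \<Rightarrow> complex) \<Rightarrow> bool" where
  "schwartz f \<longleftrightarrow> smooth f \<and>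
     (\<forall>k es. set es \<subseteq> Basis \<longrightarrow> bounded (range (\<lambda>x. (1 + norm x) ^ k *\<^sub>R iter_deriv es f x)))"

type_synonym 'a distribution = "('a \<Rightarrow> complex) \<Rightarrow> complex"

text \<open>
  Only the values of a distribution on Schwartz functions are relevant.  Continuity is expressed as
  boundedness by finitely many of the Schwartz seminorms.
\<close>

definition tempered_distribution :: "'a::euclidean_space distribution \<Rightarrow> bool" where
  "tempered_distribution T \<longleftrightarrow>
     (\<forall>f g a b. schwartz f \<longrightarrow> schwartz g \<longrightarrow>
        T (\<lambda>x. a * f x + b * g x) = a * T f + b * T g) \<and>
     (\<exists>C k l. \<forall>f. schwartz f \<longrightarrow>
        norm (T f) \<le> C * (\<Sum>es | set es \<subseteq> Basis \<and> length es \<le> l.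
                            SUP x. (1 + norm x) ^ k * norm (iter_deriv es f x)))"

definition represents :: "('a::euclidean_space \<Rightarrow> complex) \<Rightarrow> 'a distribution \<Rightarrow> bool" where
  "represents f T \<longleftrightarrow> f \<in> borel_measurable lebesgue \<and>
     (\<forall>\<psi>. schwartz \<psi> \<longrightarrow> integrable lebesgue (\<lambda>x. f x * \<psi> x) \<and> T \<psi> = (LINT x|lebesgue. f x * \<psi> x))"

definition fourier :: "('a::euclidean_space \<Rightarrow> complex) \<Rightarrow> 'a \<Rightarrow> complex" where
  "fourier f k = (LINT x|lebesgue. cis (- (k \<bullet> x)) * f x)"

definition inv_fourier :: "('a::euclidean_space \<Rightarrow> complex) \<Rightarrow> 'a \<Rightarrow> complex" where
  "inv_fourier f x = (LINT k|lebesgue. cis (k \<bullet> x) * f k) / of_real ((2 * pi) ^ DIM('a))"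

definition dist_fourier :: "'a::euclidean_space distribution \<Rightarrow> 'a distribution" where
  "dist_fourier T = (\<lambda>\<psi>. T (fourier \<psi>))"

definition dist_inv_fourier :: "'a::euclidean_space distribution \<Rightarrow> 'a distribution" where
  "dist_inv_fourier T = (\<lambda>\<psi>. T (inv_fourier \<psi>))"

definition dist_mult :: "('a::euclidean_space \<Rightarrow> complex) \<Rightarrow> 'a distribution \<Rightarrow> 'a distribution" where
  "dist_mult w T = (\<lambda>\<psi>. T (\<lambda>x. w x * \<psi> x))"

section \<open>Besov spaces\<close>

definition LP_bump :: "('a::euclidean_space \<Rightarrow> real) \<Rightarrow> bool" where
  "LP_bump \<phi> \<longleftrightarrow> smooth \<phi> \<and> (\<forall>k. \<phi> k \<ge> 0) \<and> (\<forall>k l. norm k = norm l \<longrightarrow> \<phi> k = \<phi> l) \<and>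
     closure {k. \<phi> k \<noteq> 0} \<subseteq> cball 0 2 \<and> (\<forall>k. norm k \<le> 1 \<longrightarrow> \<phi> k = 1)"

definition LP_projector ::
    "('a::euclidean_space \<Rightarrow> real) \<Rightarrow> real \<Rightarrow> 'a distribution \<Rightarrow> 'a distribution" where
  "LP_projector \<phi> N T =
     dist_inv_fourier
       (dist_mult (\<lambda>k. of_real (\<phi> (k /\<^sub>R N) - \<phi> ((2 / N) *\<^sub>R k))) (dist_fourier T))"

definition epowr :: "ennreal \<Rightarrow> real \<Rightarrow> ennreal" where
  "epowr x a = (if x = \<infinity> then \<infinity> else ennreal (enn2real x powr a))"

definition Lp_norm :: "real \<Rightarrow> ('a::euclidean_space \<Rightarrow> complex) \<Rightarrow> ennreal" where
  "Lp_norm p f = epowr (\<integral>\<^sup>+x. ennreal (norm (f x) powr p) \<partial>lebesgue) (1 / p)"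

text \<open>
  The representing function is unique almost everywhere; the infimum is \<open>\<infinity>\<close> if there is none.
\<close>

definition dist_Lp_norm :: "real \<Rightarrow> 'a::euclidean_space distribution \<Rightarrow> ennreal" where
  "dist_Lp_norm p T = (INF f \<in> {f. represents f T}. Lp_norm p f)"

definition besov_norm ::
    "('a::euclidean_space \<Rightarrow> real) \<Rightarrow> real \<Rightarrow> real \<Rightarrow> 'a distribution \<Rightarrow> ennreal" where
  "besov_norm \<phi> \<sigma> p T =
     epowr (\<Sum>\<^sub>\<infinity>N \<in> range (\<lambda>j::int. (2::real) powi j).
              ennreal (N powr (\<sigma> * p)) * epowr (dist_Lp_norm p (LP_projector \<phi> N T)) p)
           (1 / p)"

definition besov_space ::
    "('a::euclidean_space \<Rightarrow> real) \<Rightarrow> real \<Rightarrow> real \<Rightarrow> 'a distribution set" where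
  "besov_space \<phi> \<sigma> p = {T. tempered_distribution T \<and> besov_norm \<phi> \<sigma> p T < \<infinity>}"

definition in_besov ::
    "(real^'n \<Rightarrow> real) \<Rightarrow> real \<Rightarrow> real \<Rightarrow> (real^'n \<Rightarrow> real^'n) \<Rightarrow> bool" where
  "in_besov \<phi> \<sigma> p v \<longleftrightarrow>
     (\<forall>i. \<exists>T \<in> besov_space \<phi> \<sigma> p. represents (\<lambda>x. of_real (v x $ i)) T)"

end

theory Submission
  imports Defs
begin

text \<open>
  If \<open>s > 2 \<mu>\<close>, lower \<open>s\<close> so that \<open>2 \<mu> < s < 1\<close>.  Let \<open>v\<^sub>N\<close> be the low-frequency part of \<open>v\<close> at
  frequencies up to \<open>N = 2\<^sup>l\<close>.  Bernstein's inequality turns the decay of the dyadic blocks into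
  \<open>\<parallel>\<nabla>v - \<nabla>v\<^sub>N\<parallel> \<le> C N\<^bsup>-s\<^esup>\<close> and \<open>\<parallel>\<nabla>\<^sup>2v\<^sub>N\<parallel> \<le> C N\<^bsup>1-s\<^esup>\<close> in \<open>L\<^sup>1\<close>.  To restore the boundary condition, \<open>v\<^sub>N\<close> is
  multiplied by a cutoff that lives at distance of order \<open>1/N\<close> from the boundary.  The layer where the
  cutoff acts has volume of order \<open>1/N\<close>, and \<open>v\<^sub>N\<close> is of order \<open>1/N\<close> there because \<open>v\<close> is Lipschitz and
  vanishes outside \<open>\<Omega>\<close>; as \<open>s < 1\<close>, its contribution is of lower order.  Since the gradients are bounded,
  the squared distance to \<open>K\<close> is controlled by the \<open>L\<^sup>1\<close> error, so with \<open>\<epsilon> = 1/N\<close> the competitor has energy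
  at most \<open>C \<epsilon>\<^sup>s\<close>, which contradicts the lower bound \<open>\<epsilon>\<^bsup>2\<mu>\<^esup>\<close>.

  The normalisation of the Fourier inversion formula never enters: only the existence of a nonzero
  constant is used, which avoids computing the transform of a Gaussian.
\<close>

section \<open>Smooth functions and test functions\<close>

text \<open>The Besov hypothesis enters in one form only: for every l >= 0 there is an L1 function
  of norm at most A (q / 2)^l, where q = 2^(-\<sigma>) and \<sigma> is the lowered exponent, whose
  integrals against transforms of test functions are, up to a fixed constant, those of a
  frequency-localised component of \<open>v\<close>. All else is correlation with explicit
  integrable kernels. A derivative of the low-frequency part has two representations: with the
  derivative on the kernel the block bounds apply and give L1 rates; with the derivative on
  \<open>v\<close> the bounded gradient gives uniform bounds. Gradient blocks decay like q^l and are
  summed from l upwards; second derivatives grow like (2 q)^l and are summed from 0 to l, where the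
  last term dominates because 2 q > 1. That the blocks sum to the gradient is not read off from a
  decomposition of the distribution: their L1 sum is identified by its integrals against test
  functions. The construction is scalar; the components are assembled only at the end.\<close>

abbreviation pd :: "'a::euclidean_space \<Rightarrow> ('a \<Rightarrow> 'b::real_normed_vector) \<Rightarrow> 'a \<Rightarrow> 'b" where
  "pd e f \<equiv> \<lambda>x. frechet_derivative f (at x) e"

lemma pd_eq: "(f has_derivative D) (at x) \<Longrightarrow> pd e f x = D e"
  using frechet_derivative_at by metis

text \<open>Differentiability of all iterated derivatives follows by induction on the list from a
  predicate that implies differentiability and is closed under \<open>pd\<close>. Smoothness proofs
  below exhibit such a family of functions.\<close>

lemma smooth_coinduct:
  assumes "P f"
    and "\<And>f x. P f \<Longrightarrow> f differentiable (at x)"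
    and "\<And>f e. P f \<Longrightarrow> e \<in> Basis \<Longrightarrow> P (pd e f)"
  shows "smooth f"
proof -
  have "P (iter_deriv es f)" if "set es \<subseteq> Basis" for es
    using that by (induction es) (auto simp: assms)
  then show ?thesis
    unfolding smooth_def using assms(2) by blast
qed

lemma smooth_differentiable: "smooth f \<Longrightarrow> f differentiable (at x)"
  unfolding smooth_def by (metis empty_subsetI iter_deriv.simps(1) list.set(1))

lemma smooth_has_derivative: "smooth f \<Longrightarrow> (f has_derivative (\<lambda>h. pd h f x)) (at x)"
  using smooth_differentiable frechet_derivative_works by blast

lemma iter_deriv_append: "iter_deriv (es @ es') f = iter_deriv es (iter_deriv es' f)"
  by (induction es) auto

lemma smooth_pd:
  assumes "smooth f" "e \<in> Basis"
  shows "smooth (pd e f)"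
  unfolding smooth_def
proof (intro allI impI)
  fix es :: "'a list" and x
  assume "set es \<subseteq> Basis"
  \<comment> \<open>\<open>iter_deriv\<close> applies the head of its list last, so the derivative
    taken first stands at the end.\<close>
  with assms have "iter_deriv (es @ [e]) f differentiable (at x)"
    unfolding smooth_def by (metis Un_subset_iff empty_subsetI insert_subset list.simps(15) set_append list.set(1))
  then show "iter_deriv es (pd e f) differentiable (at x)"
    by (simp add: iter_deriv_append)
qed

lemma smooth_const: "smooth (\<lambda>x. c)"
  by (rule smooth_coinduct[where P = "\<lambda>f. \<exists>c. f = (\<lambda>x. c)"]) (auto simp: pd_eq[OF has_derivative_const])

text \<open>The Leibniz rule turns one product into a sum of two, so single products are not closed
  under \<open>pd\<close>; their finite sums are.\<close>

inductive bilinear_span ::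
  "('b::real_normed_vector \<Rightarrow> 'c::real_normed_vector \<Rightarrow> 'd::real_normed_vector) \<Rightarrow> ('a::euclidean_space \<Rightarrow> 'd) \<Rightarrow> bool"
  for B where
  prod: "smooth f \<Longrightarrow> smooth g \<Longrightarrow> bilinear_span B (\<lambda>x. B (f x) (g x))"
| add: "bilinear_span B f \<Longrightarrow> bilinear_span B g \<Longrightarrow> bilinear_span B (\<lambda>x. f x + g x)"

lemma smooth_bilinear_span:
  assumes B: "bounded_bilinear B" and h: "bilinear_span B h"
  shows "smooth h"
proof (rule smooth_coinduct[of "bilinear_span B", OF h])
  show diff: "f differentiable (at x)" if "bilinear_span B f" for f x
    using that
  proof induction
    case (prod f g)
    show ?case
      using bounded_bilinear.FDERIV[OF B smooth_has_derivative smooth_has_derivative, OF prod]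
      by (auto simp: differentiable_def)
  qed (auto intro: differentiable_add)
  show "bilinear_span B (pd e f)" if "bilinear_span B f" "e \<in> Basis" for f e
    using that
  proof induction
    case (prod f g)
    have "pd e (\<lambda>x. B (f x) (g x)) = (\<lambda>x. B (f x) (pd e g x) + B (pd e f x) (g x))"
      by (rule ext, rule pd_eq[OF bounded_bilinear.FDERIV[OF B smooth_has_derivative smooth_has_derivative]]) fact+
    then show ?case
      by (simp only:) (intro bilinear_span.intros smooth_pd prod)
  next
    case (add f g)
    have "pd e (\<lambda>x. f x + g x) = (\<lambda>x. pd e f x + pd e g x)"
      using pd_eq[OF has_derivative_add[OF diff[THEN frechet_derivative_works[THEN iffD1]] diff[THEN frechet_derivative_works[THEN iffD1]]], OF add(1,2)]
      by (rule ext)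
    then show ?case
      by (simp only:) (intro bilinear_span.add add)
  qed
qed

lemma smooth_bilinear:
  assumes "bounded_bilinear B" "smooth f" "smooth g"
  shows "smooth (\<lambda>x. B (f x) (g x))"
  by (rule smooth_bilinear_span[OF assms(1) bilinear_span.prod[OF assms(2,3)]])

lemmas smooth_mult = smooth_bilinear[OF bounded_bilinear_mult]

lemma smooth_linear_affine:
  assumes "smooth f" "bounded_linear L"
  shows "smooth (\<lambda>x. L (f (a *\<^sub>R x + t)))"
\<comment> \<open>The scalar \<open>c\<close> collects the factor \<open>a\<close> that the chain
  rule produces with each derivative.\<close>
proof (rule smooth_coinduct[where P = "\<lambda>h. \<exists>f c. smooth f \<and> h = (\<lambda>x. c *\<^sub>R L (f (a *\<^sub>R x + t)))"])
  show "\<exists>f' c. smooth f' \<and> (\<lambda>x. L (f (a *\<^sub>R x + t))) = (\<lambda>x. c *\<^sub>R L (f' (a *\<^sub>R x + t)))"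
    by (intro exI[of _ f] exI[of _ 1]) (auto simp: assms)
  have der: "((\<lambda>x. c *\<^sub>R L (f (a *\<^sub>R x + t))) has_derivative
      (\<lambda>h. c *\<^sub>R L (pd (a *\<^sub>R h) f (a *\<^sub>R x + t)))) (at x)" if "smooth f" for f c x
    by (intro has_derivative_scaleR_right bounded_linear.has_derivative[OF assms(2)]
        has_derivative_compose[of "\<lambda>x. a *\<^sub>R x + t" "\<lambda>h. a *\<^sub>R h" x UNIV f, simplified]
        smooth_has_derivative that) (auto intro!: derivative_eq_intros)
  show "h differentiable (at x)" if "\<exists>f c. smooth f \<and> h = (\<lambda>x. c *\<^sub>R L (f (a *\<^sub>R x + t)))" for h x
    using that der unfolding differentiable_def by blast
  show "\<exists>f c. smooth f \<and> pd e h = (\<lambda>x. c *\<^sub>R L (f (a *\<^sub>R x + t)))"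
    if h: "\<exists>f c. smooth f \<and> h = (\<lambda>x. c *\<^sub>R L (f (a *\<^sub>R x + t)))" and e: "e \<in> Basis" for h e
  proof -
    obtain f c where f: "smooth f" "h = (\<lambda>x. c *\<^sub>R L (f (a *\<^sub>R x + t)))"
      using h by blast
    have "pd (a *\<^sub>R e) f y = a *\<^sub>R pd e f y" for y
      using has_derivative_bounded_linear[OF smooth_has_derivative[OF f(1)]]
      by (simp add: linear_simps)
    then have "pd e h = (\<lambda>x. (c * a) *\<^sub>R L (pd e f (a *\<^sub>R x + t)))"
      using pd_eq[OF der[OF f(1)]] assms(2) by (auto simp: f(2) linear_simps)
    with smooth_pd[OF f(1) e] show ?thesis by blast
  qed
qed

lemma smooth_linear: "smooth f \<Longrightarrow> bounded_linear L \<Longrightarrow> smooth (\<lambda>x. L (f x))"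
  using smooth_linear_affine[of f L 1 0] by simp

lemma smooth_affine: "smooth f \<Longrightarrow> smooth (\<lambda>x. f (a *\<^sub>R x + t))"
  using smooth_linear_affine[OF _ bounded_linear_ident] by blast

lemma smooth_bounded_linear:
  assumes "bounded_linear L"
  shows "smooth L"
proof (rule smooth_coinduct[where P = "\<lambda>h. bounded_linear h \<or> (\<exists>c. h = (\<lambda>x. c))"])
  show "f differentiable (at x)" if "bounded_linear f \<or> (\<exists>c. f = (\<lambda>x. c))" for f :: "'a \<Rightarrow> 'b" and x
    using that by (auto intro: bounded_linear_imp_differentiable)
  show "bounded_linear (pd e f) \<or> (\<exists>c. pd e f = (\<lambda>x. c))"
    if "bounded_linear f \<or> (\<exists>c. f = (\<lambda>x. c))" for f :: "'a \<Rightarrow> 'b" and e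
    using that
  proof
    assume "bounded_linear f"
    then have "pd e f = (\<lambda>x. f e)"
      by (intro ext pd_eq[where D = f] bounded_linear_imp_has_derivative)
    then show ?thesis by blast
  next
    assume "\<exists>c. f = (\<lambda>x. c)"
    then have "pd e f = (\<lambda>x. 0)"
      by (auto simp: pd_eq[OF has_derivative_const])
    then show ?thesis by blast
  qed
  show "bounded_linear L \<or> (\<exists>c. L = (\<lambda>x. c))" using assms by simp
qed

lemma smooth_cis_inner: "smooth (\<lambda>k. cis (k \<bullet> x))"
proof (rule smooth_coinduct[where P = "\<lambda>h. \<exists>c. h = (\<lambda>k. c * cis (k \<bullet> x))"])
  have der: "((\<lambda>k. c * cis (k \<bullet> x)) has_derivative (\<lambda>h. c * ((h \<bullet> x) *\<^sub>R (\<i> * cis (k \<bullet> x))))) (at k)" for c k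
  proof -
    have "((\<lambda>k. k \<bullet> x) has_derivative (\<lambda>h. h \<bullet> x)) (at k)"
      by (intro bounded_linear_imp_has_derivative bounded_linear_inner_left)
    from has_derivative_cis[OF this] show ?thesis
      by (rule has_derivative_mult_right)
  qed
  show "h differentiable (at k)" if "\<exists>c. h = (\<lambda>k. c * cis (k \<bullet> x))" for h k
    using that der unfolding differentiable_def by blast
  show "\<exists>c. pd e h = (\<lambda>k. c * cis (k \<bullet> x))" if h: "\<exists>c. h = (\<lambda>k. c * cis (k \<bullet> x))" for e h
  proof -
    obtain c where "h = (\<lambda>k. c * cis (k \<bullet> x))" using h by blast
    then have "pd e h = (\<lambda>k. (c * (e \<bullet> x) *\<^sub>R \<i>) * cis (k \<bullet> x))"
      using pd_eq[OF der] by auto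
    then show ?thesis by blast
  qed
  show "\<exists>c. (\<lambda>k. cis (k \<bullet> x)) = (\<lambda>k. c * cis (k \<bullet> x))" by (rule exI[of _ 1]) auto
qed

lemma smooth_continuous: "smooth f \<Longrightarrow> continuous_on S f"
  by (meson continuous_at_imp_continuous_on differentiable_imp_continuous_within smooth_differentiable)

section \<open>Smooth functions of compact support\<close>

lemma test_functionI:
  assumes "smooth f" "compact S" "S \<subseteq> \<Omega>" "\<And>x. x \<notin> S \<Longrightarrow> f x = 0"
  shows "test_function \<Omega> f"
proof -
  have "closure {x. f x \<noteq> 0} \<subseteq> S"
    using assms by (intro closure_minimal) (auto intro: compact_imp_closed)
  moreover from this have "compact (closure {x. f x \<noteq> 0})"
    using assms(2) by (metis closed_closure compact_Int_closed inf.absorb_iff2)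
  ultimately show ?thesis
    using assms(1,3) unfolding test_function_def by auto
qed

lemma test_functionD:
  assumes "test_function \<Omega> f"
  obtains S where "smooth f" "compact S" "S \<subseteq> \<Omega>" "\<And>x. x \<notin> S \<Longrightarrow> f x = 0"
    "\<And>x e. x \<notin> S \<Longrightarrow> pd e f x = 0"
proof -
  define S where "S = closure {x. f x \<noteq> 0}"
  have S: "smooth f" "compact S" "S \<subseteq> \<Omega>"
    using assms by (auto simp: test_function_def S_def)
  have 0: "f x = 0" if "x \<notin> S" for x
    using closure_subset[of "{x. f x \<noteq> 0}"] that unfolding S_def by blast
  have "pd e f x = 0" if "x \<notin> S" for x e
  proof (rule pd_eq)
    have "open (- S)"
      using S(2) by (simp add: compact_imp_closed open_Compl)
    then show "(f has_derivative (\<lambda>h. 0)) (at x)"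
      by (rule has_derivative_transform_within_open[OF has_derivative_const]) (simp_all add: 0 that)
  qed
  with S 0 show ?thesis by (rule that)
qed

lemma test_function_pd: "test_function \<Omega> f \<Longrightarrow> e \<in> Basis \<Longrightarrow> test_function \<Omega> (pd e f)"
  by (erule test_functionD, rule test_functionI) (auto intro: smooth_pd)

lemma test_function_smooth: "test_function \<Omega> f \<Longrightarrow> smooth f"
  by (auto simp: test_function_def)

lemma test_function_mult_left:
  fixes f g :: "'a::euclidean_space \<Rightarrow> 'b::real_normed_algebra"
  shows "smooth f \<Longrightarrow> test_function \<Omega> g \<Longrightarrow> test_function \<Omega> (\<lambda>x. f x * g x)"
  by (erule test_functionD, rule test_functionI) (auto intro: smooth_mult)

lemma test_function_linear:
  assumes "test_function \<Omega> f" "bounded_linear L"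
  shows "test_function \<Omega> (\<lambda>x. L (f x))"
  using assms(1)
  by (rule test_functionD, intro test_functionI)
    (auto intro: smooth_linear simp: assms(2) linear_simps)

lemma test_function_bounded:
  assumes "test_function \<Omega> f"
  obtains B where "B \<ge> 0" "\<And>x. norm (f x) \<le> B"
  using assms
proof (rule test_functionD)
  fix S assume S: "smooth f" "compact S" "\<And>x. x \<notin> S \<Longrightarrow> f x = 0"
  have "compact (f ` S)"
    using S by (intro compact_continuous_image smooth_continuous)
  then obtain B where "\<And>x. x \<in> S \<Longrightarrow> norm (f x) \<le> B"
    by (meson bounded_iff compact_imp_bounded imageI)
  then have "norm (f x) \<le> max B 0" for x
    by (cases "x \<in> S") (auto simp: S(3) le_max_iff_disj)
  then show ?thesis using that[of "max B 0"] by auto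
qed

lemma integrable_continuous_compact_support:
  fixes f :: "'a::euclidean_space \<Rightarrow> 'b::{banach,second_countable_topology}"
  assumes "continuous_on UNIV f" "compact S" "\<And>x. x \<notin> S \<Longrightarrow> f x = 0"
  shows "integrable lborel f"
proof -
  have "set_integrable lborel S f"
    unfolding set_integrable_def scaleR_conv_of_real[symmetric]
    using borel_integrable_compact[OF assms(2) continuous_on_subset[OF assms(1)]] by simp
  moreover have "(\<lambda>x. indicator S x *\<^sub>R f x) = f"
    by (auto simp: fun_eq_iff indicator_def assms(3))
  ultimately show ?thesis by (simp add: set_integrable_def)
qed

lemma test_function_integrable:
  fixes f :: "'a::euclidean_space \<Rightarrow> 'b::{banach,second_countable_topology}"
  assumes "test_function \<Omega> f"
  shows "integrable lborel f"
  using assms by (rule test_functionD) (auto intro: integrable_continuous_compact_support smooth_continuous)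

section \<open>Differentiation under the integral sign and integration by parts\<close>

text \<open>Dominated convergence is applied to the normalised remainder along sequences tending to
  \<open>x0\<close>. Convexity of \<open>U\<close> is what lets the mean value inequality bound the
  difference quotients by \<open>g\<close>.\<close>

lemma has_derivative_integral:
  fixes f :: "'a::{real_normed_vector,perfect_space} \<Rightarrow> 'c \<Rightarrow> 'b::{banach,second_countable_topology}"
  assumes U: "open U" "convex U" "x0 \<in> U"
    and int: "\<And>x. x \<in> U \<Longrightarrow> integrable M (f x)"
    and der: "\<And>x y. x \<in> U \<Longrightarrow> ((\<lambda>x. f x y) has_derivative D x y) (at x)"
    and meas: "\<And>h. (\<lambda>y. D x0 y h) \<in> borel_measurable M"
    and bound: "\<And>x y h. x \<in> U \<Longrightarrow> norm (D x y h) \<le> g y * norm h"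
    and g: "integrable M g"
  shows "((\<lambda>x. LINT y|M. f x y) has_derivative (\<lambda>h. LINT y|M. D x0 y h)) (at x0)"
proof -
  have lin: "bounded_linear (D x y)" if "x \<in> U" for x y
    using der[OF that] by (rule has_derivative_bounded_linear)
  have intD: "integrable M (\<lambda>y. D x0 y h)" for h
    by (rule Bochner_Integration.integrable_bound[of _ "\<lambda>y. g y * norm h"])
      (use g meas bound[OF U(3)] in \<open>auto intro!: AE_I2 intro: order_trans[OF _ abs_ge_self]\<close>)
  have "bounded_linear (\<lambda>h. LINT y|M. D x0 y h)"
  proof (rule bounded_linear_intro[where K = "\<integral>y. g y \<partial>M"])
    show "(LINT y|M. D x0 y (h + k)) = (LINT y|M. D x0 y h) + (LINT y|M. D x0 y k)" for h k
      using linear_add[OF bounded_linear.linear[OF lin[OF U(3)]]] intD by simp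
    show "(LINT y|M. D x0 y (r *\<^sub>R h)) = r *\<^sub>R (LINT y|M. D x0 y h)" for r h
      using linear_cmul[OF bounded_linear.linear[OF lin[OF U(3)]]] intD by simp
    show "norm (LINT y|M. D x0 y h) \<le> norm h * (\<integral>y. g y \<partial>M)" for h
    proof -
      have "norm (LINT y|M. D x0 y h) \<le> (LINT y|M. g y * norm h)"
        by (rule order_trans[OF integral_norm_bound integral_mono]) (use intD bound U g in auto)
      then show ?thesis by (simp add: mult.commute)
    qed
  qed
  moreover have "((\<lambda>x. norm ((LINT y|M. f x y) - (LINT y|M. f x0 y) - (LINT y|M. D x0 y (x - x0))) / norm (x - x0))
      \<longlongrightarrow> 0) (at x0)"
    unfolding tendsto_at_iff_sequentially o_def
  proof (intro allI impI)
    fix X :: "nat \<Rightarrow> 'a"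
    assume X: "\<forall>i. X i \<in> UNIV - {x0}" "X \<longlonglongrightarrow> x0"
    have "\<forall>\<^sub>F i in sequentially. X i \<in> U"
      using X(2) U by (auto simp: tendsto_def)
    then obtain N where N: "\<And>i. i \<ge> N \<Longrightarrow> X i \<in> U"
      by (auto simp: eventually_sequentially)
    \<comment> \<open>Dropping the first \<open>N\<close> terms puts the whole sequence into
      \<open>U\<close>, where the bounds hold.\<close>
    define Y where "Y i = X (i + N)" for i
    have Y: "Y i \<in> U" "Y i \<noteq> x0" for i
      using X N by (auto simp: Y_def)
    have Ylim: "Y \<longlonglongrightarrow> x0"
      unfolding Y_def using X(2) by (rule LIMSEQ_ignore_initial_segment)
    define q where "q i y = (f (Y i) y - f x0 y - D x0 y (Y i - x0)) /\<^sub>R norm (Y i - x0)" for i y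
    have qint: "integrable M (q i)" for i
      unfolding q_def using int Y U intD by (intro integrable_scaleR_right Bochner_Integration.integrable_diff) auto
    have qlim: "(\<lambda>i. q i y) \<longlonglongrightarrow> 0" for y
    proof -
      have "((\<lambda>x. norm (f x y - f x0 y - D x0 y (x - x0)) / norm (x - x0)) \<longlongrightarrow> 0) (at x0)"
        using der[OF U(3)] by (simp add: has_derivative_iff_norm)
      then have "(\<lambda>i. norm (f (Y i) y - f x0 y - D x0 y (Y i - x0)) / norm (Y i - x0)) \<longlonglongrightarrow> 0"
        using Y(2) Ylim unfolding tendsto_at_iff_sequentially o_def by auto
      then have "(\<lambda>i. norm (q i y)) \<longlonglongrightarrow> 0"
        by (simp add: q_def divide_inverse_commute)
      then show ?thesis by (rule tendsto_norm_zero_cancel)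
    qed
    \<comment> \<open>One \<open>g y\<close> bounds the increment by the mean value inequality, the
      other bounds the derivative at \<open>x0\<close>.\<close>
    have qbound: "norm (q i y) \<le> 2 * g y" for i y
    proof -
      have "norm (f (Y i) y - f x0 y) \<le> g y * norm (Y i - x0)"
      proof (rule differentiable_bound[OF U(2)])
        show "((\<lambda>x. f x y) has_derivative D x y) (at x within U)" if "x \<in> U" for x
          using der[OF that] by (rule has_derivative_at_withinI)
        show "onorm (D x y) \<le> g y" if "x \<in> U" for x
          by (rule onorm_le[OF bound[OF that]])
      qed (use Y U in auto)
      moreover have "norm (D x0 y (Y i - x0)) \<le> g y * norm (Y i - x0)"
        by (rule bound[OF U(3)])
      ultimately have "norm (f (Y i) y - f x0 y - D x0 y (Y i - x0)) \<le> 2 * g y * norm (Y i - x0)"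
        using norm_triangle_ineq4[of "f (Y i) y - f x0 y" "D x0 y (Y i - x0)"] by linarith
      moreover have "norm (q i y) = norm (f (Y i) y - f x0 y - D x0 y (Y i - x0)) / norm (Y i - x0)"
        by (simp add: q_def divide_inverse_commute)
      ultimately show ?thesis
        using Y(2)[of i] by (simp add: pos_divide_le_eq)
    qed
    have "(\<lambda>i. LINT y|M. q i y) \<longlonglongrightarrow> (LINT y|M. 0)"
    proof (rule integral_dominated_convergence[where w = "\<lambda>y. 2 * g y"])
      show "q i \<in> borel_measurable M" for i using qint by simp
    qed (use qlim qbound g in auto)
    then have "(\<lambda>i. norm (LINT y|M. q i y)) \<longlonglongrightarrow> 0"
      by (simp add: tendsto_norm_zero)
    moreover have "norm (LINT y|M. q i y) = norm ((LINT y|M. f (Y i) y) - (LINT y|M. f x0 y)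
        - (LINT y|M. D x0 y (Y i - x0))) / norm (Y i - x0)" for i
      unfolding q_def using int Y U intD
      by (simp add: divide_inverse_commute)
    ultimately have "(\<lambda>i. norm ((LINT y|M. f (Y i) y) - (LINT y|M. f x0 y)
        - (LINT y|M. D x0 y (Y i - x0))) / norm (Y i - x0)) \<longlonglongrightarrow> 0"
      by simp
    then show "(\<lambda>i. norm ((LINT y|M. f (X i) y) - (LINT y|M. f x0 y)
        - (LINT y|M. D x0 y (X i - x0))) / norm (X i - x0)) \<longlonglongrightarrow> 0"
      unfolding Y_def by (rule LIMSEQ_offset)
  qed
  ultimately show ?thesis
    by (simp add: has_derivative_iff_norm)
qed

section \<open>Affine substitutions in Lebesgue integrals\<close>

lemma
  fixes f :: "'a::euclidean_space \<Rightarrow> 'b::{banach,second_countable_topology}"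
  assumes "integrable lborel f" "c \<noteq> 0"
  shows lborel_integrable_affine: "integrable lborel (\<lambda>x. f (t + c *\<^sub>R x))"
    and lborel_integral_affine: "(LINT x|lborel. f (t + c *\<^sub>R x)) = (LINT x|lborel. f x) /\<^sub>R \<bar>c\<bar> ^ DIM('a)"
proof -
  have [measurable]: "f \<in> borel_measurable borel" using assms(1) by auto
  have eq: "lborel = density (distr lborel borel (\<lambda>x::'a. t + c *\<^sub>R x)) (\<lambda>_. ennreal (\<bar>c\<bar> ^ DIM('a)))"
    using lborel_affine[OF assms(2), of t] by (simp add: ennreal_power)
  have "integrable (density (distr lborel borel (\<lambda>x::'a. t + c *\<^sub>R x)) (\<lambda>_. ennreal (\<bar>c\<bar> ^ DIM('a)))) f"
    using assms(1) eq by simp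
  then have "integrable lborel (\<lambda>x. \<bar>c\<bar> ^ DIM('a) *\<^sub>R f (t + c *\<^sub>R x))"
    by (simp add: integrable_density integrable_distr_eq)
  from integrable_scaleR_right[OF this, of "inverse (\<bar>c\<bar> ^ DIM('a))"]
  show "integrable lborel (\<lambda>x. f (t + c *\<^sub>R x))"
    using assms(2) by simp
  have "(LINT x|lborel. f x) = (LINT x|density (distr lborel borel (\<lambda>x::'a. t + c *\<^sub>R x)) (\<lambda>_. ennreal (\<bar>c\<bar> ^ DIM('a))). f x)"
    using eq by simp
  also have "\<dots> = \<bar>c\<bar> ^ DIM('a) *\<^sub>R (LINT x|lborel. f (t + c *\<^sub>R x))"
    by (simp add: integral_density integral_distr)
  finally show "(LINT x|lborel. f (t + c *\<^sub>R x)) = (LINT x|lborel. f x) /\<^sub>R \<bar>c\<bar> ^ DIM('a)"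
    using assms(2) by simp
qed

lemma
  fixes f :: "'a::euclidean_space \<Rightarrow> 'b::{banach,second_countable_topology}"
  assumes "integrable lborel f"
  shows lborel_integrable_translate: "integrable lborel (\<lambda>x. f (x + t))"
    and lborel_integral_translate: "(LINT x|lborel. f (x + t)) = (LINT x|lborel. f x)"
    and lborel_integrable_translate_minus: "integrable lborel (\<lambda>x. f (x - t))"
    and lborel_integral_translate_minus: "(LINT x|lborel. f (x - t)) = (LINT x|lborel. f x)"
    and lborel_integrable_reflect: "integrable lborel (\<lambda>x. f (t - x))"
    and lborel_integral_reflect: "(LINT x|lborel. f (t - x)) = (LINT x|lborel. f x)"
  using lborel_integrable_affine[OF assms, of 1 t] lborel_integral_affine[OF assms, of 1 t]
    lborel_integrable_affine[OF assms, of "-1" t] lborel_integral_affine[OF assms, of "-1" t]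
    lborel_integrable_affine[OF assms, of 1 "-t"] lborel_integral_affine[OF assms, of 1 "-t"]
  by (simp_all add: add.commute)

text \<open>By translation invariance the integral of F (x + t e) over x does not depend on t;
  differentiating under the integral sign at t = 0 gives the claim. This is integration by parts
  without a reduction to one variable.\<close>

lemma integral_derivative_compact_support:
  fixes F :: "'a::euclidean_space \<Rightarrow> 'b::{banach,second_countable_topology}"
  assumes der: "\<And>x. (F has_derivative F' x) (at x)"
    and cont: "continuous_on UNIV (\<lambda>x. F' x e)"
    and S: "compact S" "\<And>x. x \<notin> S \<Longrightarrow> F x = 0"
  shows "(LINT x|lborel. F' x e) = 0"
proof -
  have F'0: "F' x e = 0" if "x \<notin> S" for x
  proof -
    have "open (- S)"
      using S(1) by (simp add: compact_imp_closed open_Compl)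
    then have "(F has_derivative (\<lambda>h. 0)) (at x)"
      by (rule has_derivative_transform_within_open[OF has_derivative_const]) (simp_all add: S that)
    then show ?thesis
      using has_derivative_unique[OF der] by metis
  qed
  have F: "integrable lborel F"
    using S der by (intro integrable_continuous_compact_support)
      (auto intro!: continuous_at_imp_continuous_on has_derivative_continuous)
  obtain B where B: "\<And>x. norm (F' x e) \<le> B" and "B \<ge> 0"
  proof -
    have "compact ((\<lambda>x. F' x e) ` S)"
      using cont S by (auto intro!: compact_continuous_image intro: continuous_on_subset)
    then obtain B where "\<And>x. x \<in> S \<Longrightarrow> norm (F' x e) \<le> B"
      by (meson bounded_iff compact_imp_bounded imageI)
    then have "norm (F' x e) \<le> max B 0" for x
      by (cases "x \<in> S") (auto simp: F'0 le_max_iff_disj)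
    then show ?thesis by (intro that[of "max B 0"]) auto
  qed
  \<comment> \<open>\<open>S'\<close> contains every point with a translate by t e, |t| < 1, in
    \<open>S\<close>, so it carries the dominating function for all such t.\<close>
  define S' where "S' = {a + b |a b. a \<in> S \<and> b \<in> cball 0 (norm e)}"
  have S': "compact S'" unfolding S'_def by (intro compact_sums S compact_cball)
  have lin: "linear (F' x)" for x
    using der has_derivative_linear by blast
  have inS': "x \<in> S'" if "x + t *\<^sub>R e \<in> S" "t \<in> ball 0 1" for x t
  proof -
    have "norm (- t *\<^sub>R e) \<le> norm e"
      using that(2) mult_left_le_one_le[of "norm e" "\<bar>t\<bar>"] by simp
    then show ?thesis
      unfolding S'_def using that(1)
      by (intro CollectI exI[of _ "x + t *\<^sub>R e"] exI[of _ "- t *\<^sub>R e"]) (auto simp del: norm_scaleR)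
  qed
  have "((\<lambda>t. LINT x|lborel. F (x + t *\<^sub>R e)) has_derivative
      (\<lambda>h. LINT x|lborel. F' (x + 0 *\<^sub>R e) (h *\<^sub>R e))) (at 0)"
  proof (rule has_derivative_integral[where U = "ball 0 1" and g = "\<lambda>x. B * indicator S' x"])
    show "integrable lborel (\<lambda>x. F (x + t *\<^sub>R e))" for t
      by (rule lborel_integrable_translate[OF F])
    show "((\<lambda>t. F (x + t *\<^sub>R e)) has_derivative (\<lambda>h. F' (x + t *\<^sub>R e) (h *\<^sub>R e))) (at t)" for x t
      by (rule has_derivative_compose[OF _ der]) (auto intro!: derivative_eq_intros)
    show "(\<lambda>x. F' (x + 0 *\<^sub>R e) (h *\<^sub>R e)) \<in> borel_measurable lborel" for h
      using borel_measurable_continuous_onI[OF cont] by (simp add: linear_cmul[OF lin])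
    show "norm (F' (x + t *\<^sub>R e) (h *\<^sub>R e)) \<le> B * indicator S' x * norm h" if "t \<in> ball 0 1" for t x h
    proof (cases "x + t *\<^sub>R e \<in> S")
      case True
      then show ?thesis
        using inS'[OF True that] B[of "x + t *\<^sub>R e"]
        by (simp add: linear_cmul[OF lin] mult.commute[of B] mult_left_mono)
    next
      case False
      then show ?thesis
        using F'0[OF False] \<open>B \<ge> 0\<close> by (simp add: linear_cmul[OF lin])
    qed
    show "integrable lborel (\<lambda>x. B * indicator S' x)"
      using S' by (intro integrable_mult_right integrable_real_indicator)
        (use emeasure_bounded_finite[OF compact_imp_bounded[OF S']] in \<open>auto simp: borel_compact\<close>)
  qed auto
  then have "((\<lambda>t::real. LINT x|lborel. F x) has_derivative (\<lambda>h. LINT x|lborel. F' x (h *\<^sub>R e))) (at 0)"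
    by (simp add: lborel_integral_translate[OF F])
  then have "(\<lambda>h. LINT x|lborel. F' x (h *\<^sub>R e)) = (\<lambda>h. 0)"
    using has_derivative_unique has_derivative_const by blast
  from fun_cong[OF this, of 1] show ?thesis by simp
qed

section \<open>Correlation with a kernel\<close>

text \<open>Correlation is convolution with the reflected kernel. It matches
  \<open>fourier_modulate\<close>: modulating by \<open>cis (k \<bullet> x)\<close> turns a
  transform into \<open>fourier f (y - x)\<close>, which is the shape of the kernel here. The price
  is a minus sign in every derivative.\<close>

definition corr :: "('a::euclidean_space \<Rightarrow> 'b::{real_normed_field,banach,second_countable_topology}) \<Rightarrow> ('a \<Rightarrow> 'b) \<Rightarrow> 'a \<Rightarrow> 'b"
  where "corr f \<kappa> x = (LINT y|lborel. f y * \<kappa> (y - x))"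

lemma integrable_mult_bounded:
  fixes f g :: "'c \<Rightarrow> 'b::{real_normed_field,banach,second_countable_topology}"
  assumes "integrable M f" "g \<in> borel_measurable M" "AE x in M. norm (g x) \<le> B"
  shows "integrable M (\<lambda>x. f x * g x)"
proof (rule Bochner_Integration.integrable_bound[of _ "\<lambda>x. B * norm (f x)"])
  show "AE x in M. norm (f x * g x) \<le> norm (B * norm (f x))"
    using assms(3) by eventually_elim
      (auto simp: norm_mult mult.commute[of "norm (f _)"] abs_mult
        intro!: mult_right_mono order_trans[OF _ abs_ge_self])
qed (use assms in auto)

lemma corr_integrand_integrable:
  fixes f \<kappa> :: "'a::euclidean_space \<Rightarrow> 'b::{real_normed_field,banach,second_countable_topology}"
  assumes "integrable lborel f" "\<kappa> \<in> borel_measurable borel" "\<And>x. norm (\<kappa> x) \<le> B"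
  shows "integrable lborel (\<lambda>y. f y * \<kappa> (y - x))"
proof (rule integrable_mult_bounded[where B = B])
  show "(\<lambda>y. \<kappa> (y - x)) \<in> borel_measurable lborel"
    using assms(2) by simp
qed (use assms in auto)

lemma corr_product_integrable:
  fixes f \<kappa> :: "'a::euclidean_space \<Rightarrow> 'b::{real_normed_field,banach,second_countable_topology}"
  assumes "integrable lborel f" "integrable lborel \<kappa>"
  shows "integrable (lborel \<Otimes>\<^sub>M lborel) (\<lambda>(y, x). f y * \<kappa> (y - x))"
proof (rule lborel_pair.Fubini_integrable)
  have [measurable]: "f \<in> borel_measurable borel" "\<kappa> \<in> borel_measurable borel"
    using assms by auto
  show "(\<lambda>(y, x). f y * \<kappa> (y - x)) \<in> borel_measurable (lborel \<Otimes>\<^sub>M lborel)"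
    by measurable
  have "(LINT x|lborel. norm (f y * \<kappa> (y - x))) = norm (f y) * (LINT x|lborel. norm (\<kappa> x))" for y
    using lborel_integral_reflect[OF integrable_norm[OF assms(2)], of y] by (simp add: norm_mult)
  then show "integrable lborel (\<lambda>y. LINT x|lborel. norm (case (y, x) of (y, x) \<Rightarrow> f y * \<kappa> (y - x)))"
    using assms by simp
  show "AE y in lborel. integrable lborel (\<lambda>x. case (y, x) of (y, x) \<Rightarrow> f y * \<kappa> (y - x))"
    using lborel_integrable_reflect[OF assms(2)] by (intro AE_I2) simp
qed

lemma corr_integrable:
  assumes "integrable lborel f" "integrable lborel \<kappa>"
  shows "integrable lborel (corr f \<kappa>)"
  unfolding corr_def
  using lborel_pair.integrable_snd[OF corr_product_integrable[OF assms]] by simp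

text \<open>Young's inequality for two L1 factors: after Fubini the inner integral over x is the
  norm of the kernel, by reflection.\<close>

lemma corr_L1_bound:
  assumes "integrable lborel f" "integrable lborel \<kappa>"
  shows "(LINT x|lborel. norm (corr f \<kappa> x)) \<le> (LINT x|lborel. norm (f x)) * (LINT x|lborel. norm (\<kappa> x))"
proof -
  have P: "integrable (lborel \<Otimes>\<^sub>M lborel) (\<lambda>(y, x). norm (f y * \<kappa> (y - x)))"
    using integrable_norm[OF corr_product_integrable[OF assms]] by (simp add: case_prod_unfold)
  have "(LINT x|lborel. norm (corr f \<kappa> x)) \<le> (LINT x|lborel. LINT y|lborel. norm (f y * \<kappa> (y - x)))"
  proof (rule integral_mono)
    show "integrable lborel (\<lambda>x. norm (corr f \<kappa> x))"
      using corr_integrable[OF assms] by simp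
    show "integrable lborel (\<lambda>x. LINT y|lborel. norm (f y * \<kappa> (y - x)))"
      using lborel_pair.integrable_snd[OF P] by simp
    show "norm (corr f \<kappa> x) \<le> (LINT y|lborel. norm (f y * \<kappa> (y - x)))" for x
      unfolding corr_def by (rule integral_norm_bound)
  qed
  also have "\<dots> = (LINT y|lborel. LINT x|lborel. norm (f y * \<kappa> (y - x)))"
    using lborel_pair.Fubini_integral[OF P] by simp
  also have "\<dots> = (LINT y|lborel. norm (f y) * (LINT x|lborel. norm (\<kappa> x)))"
    using lborel_integral_reflect[OF integrable_norm[OF assms(2)]] by (simp add: norm_mult)
  finally show ?thesis by simp
qed

lemma corr_bounded:
  assumes "f \<in> borel_measurable borel" "AE y in lborel. norm (f y) \<le> B" "integrable lborel \<kappa>"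
  shows "norm (corr f \<kappa> x) \<le> B * (LINT y|lborel. norm (\<kappa> y))"
proof -
  have \<kappa>: "integrable lborel (\<lambda>y. \<kappa> (y - x))"
    by (rule lborel_integrable_translate_minus[OF assms(3)])
  have "norm (corr f \<kappa> x) \<le> (LINT y|lborel. norm (f y * \<kappa> (y - x)))"
    unfolding corr_def by (rule integral_norm_bound)
  also have "\<dots> \<le> (LINT y|lborel. B * norm (\<kappa> (y - x)))"
  proof (rule integral_mono_AE)
    have "integrable lborel (\<lambda>y. \<kappa> (y - x) * f y)"
      using assms by (intro integrable_mult_bounded[OF \<kappa>, where B = B]) auto
    then show "integrable lborel (\<lambda>y. norm (f y * \<kappa> (y - x)))"
      by (simp add: mult.commute)
    show "AE y in lborel. norm (f y * \<kappa> (y - x)) \<le> B * norm (\<kappa> (y - x))"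
      using assms(2) by eventually_elim (auto simp: norm_mult intro!: mult_right_mono)
  qed (use \<kappa> in auto)
  also have "\<dots> = B * (LINT y|lborel. norm (\<kappa> y))"
    using lborel_integral_translate_minus[OF integrable_norm[OF assms(3)]] by simp
  finally show ?thesis .
qed

text \<open>\<open>smooth\<close> and \<open>smooth_pd\<close> speak of basis directions only;
  linearity of the derivative carries their content to every direction.\<close>

lemma smooth_pd_sum:
  assumes "smooth f"
  shows "pd h f x = (\<Sum>b\<in>Basis. (h \<bullet> b) *\<^sub>R pd b f x)"
proof -
  have lin: "linear (\<lambda>h. pd h f x)"
    using smooth_has_derivative[OF assms] has_derivative_linear by blast
  have "pd (\<Sum>b\<in>Basis. (h \<bullet> b) *\<^sub>R b) f x = (\<Sum>b\<in>Basis. pd ((h \<bullet> b) *\<^sub>R b) f x)"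
    by (rule linear_sum[OF lin])
  also have "\<dots> = (\<Sum>b\<in>Basis. (h \<bullet> b) *\<^sub>R pd b f x)"
    by (intro sum.cong refl linear_cmul[OF lin])
  finally show ?thesis by (simp add: euclidean_representation)
qed

lemma smooth_pd_bound:
  assumes "smooth f" "\<And>b. b \<in> Basis \<Longrightarrow> norm (pd b f x) \<le> B"
  shows "norm (pd h f x) \<le> real DIM('a) * B * norm (h::'a::euclidean_space)"
proof -
  have "norm (pd h f x) \<le> (\<Sum>b\<in>Basis. \<bar>h \<bullet> b\<bar> * norm (pd b f x))"
    by (subst smooth_pd_sum[OF assms(1)], rule order_trans[OF norm_sum]) simp
  also have "\<dots> \<le> (\<Sum>b\<in>(Basis::'a set). norm h * B)"
    by (intro sum_mono mult_mono Basis_le_norm assms) auto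
  finally show ?thesis by (simp add: mult_ac)
qed

lemma smooth_pd_continuous:
  assumes "smooth f"
  shows "continuous_on S (pd h f)"
proof -
  have "continuous_on S (\<lambda>x. \<Sum>b\<in>Basis. (h \<bullet> b) *\<^sub>R pd b f x)"
    by (intro continuous_intros smooth_continuous smooth_pd assms)
  then show ?thesis
    by (subst smooth_pd_sum[OF assms])
qed

lemma corr_has_derivative:
  fixes f \<kappa> :: "'a::euclidean_space \<Rightarrow> 'b::{real_normed_field,banach,second_countable_topology}"
  assumes f: "integrable lborel f" and \<kappa>: "smooth \<kappa>" "\<And>x. norm (\<kappa> x) \<le> B"
    and B': "\<And>x b. b \<in> Basis \<Longrightarrow> norm (pd b \<kappa> x) \<le> B'"
  shows "(corr f \<kappa> has_derivative (\<lambda>h. - corr f (pd h \<kappa>) x)) (at x)"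
proof -
  have [measurable]: "f \<in> borel_measurable borel" "\<kappa> \<in> borel_measurable borel"
    "pd h \<kappa> \<in> borel_measurable borel" for h
    using f smooth_continuous[OF \<kappa>(1)] smooth_pd_continuous[OF \<kappa>(1)]
    by (auto intro: borel_measurable_continuous_onI)
  have "((\<lambda>x. LINT y|lborel. f y * \<kappa> (y - x)) has_derivative
      (\<lambda>h. LINT y|lborel. f y * (- pd h \<kappa> (y - x)))) (at x)"
  proof (rule has_derivative_integral[of UNIV _ _ _ _ "\<lambda>y. norm (f y) * (real DIM('a) * B')"])
    show "((\<lambda>x. f y * \<kappa> (y - x)) has_derivative (\<lambda>h. f y * (- pd h \<kappa> (y - x)))) (at x)" for x y
    proof -
      have "((\<lambda>x. \<kappa> (y - x)) has_derivative (\<lambda>h. pd (- h) \<kappa> (y - x))) (at x)"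
        by (rule has_derivative_compose[OF _ smooth_has_derivative[OF \<kappa>(1)]])
          (auto intro!: derivative_eq_intros)
      moreover have "pd (- h) \<kappa> (y - x) = - pd h \<kappa> (y - x)" for h
        using linear_neg[OF has_derivative_linear[OF smooth_has_derivative[OF \<kappa>(1)]]] by simp
      ultimately have "((\<lambda>x. \<kappa> (y - x)) has_derivative (\<lambda>h. - pd h \<kappa> (y - x))) (at x)"
        by simp
      then show ?thesis
        by (rule has_derivative_mult_right)
    qed
    show "norm (f y * (- pd h \<kappa> (y - x))) \<le> norm (f y) * (real DIM('a) * B') * norm h" for x y h
      using smooth_pd_bound[OF \<kappa>(1) B', of "y - x" h] by (simp add: norm_mult mult_left_mono mult.assoc)
    show "integrable lborel (\<lambda>y. f y * \<kappa> (y - x))" for x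
      by (rule corr_integrand_integrable[OF f _ \<kappa>(2)]) simp
  qed (use f in auto)
  then show ?thesis
    unfolding corr_def by simp
qed

lemma corr_test_has_derivative:
  fixes f \<kappa> :: "'a::euclidean_space \<Rightarrow> 'b::{real_normed_field,banach,second_countable_topology}"
  assumes f: "integrable lborel f" and \<kappa>: "test_function UNIV \<kappa>"
  shows "(corr f \<kappa> has_derivative (\<lambda>h. - corr f (pd h \<kappa>) x)) (at x)"
proof -
  obtain B where B: "\<And>x. norm (\<kappa> x) \<le> B"
    using test_function_bounded[OF \<kappa>] by blast
  have "\<forall>b\<in>Basis. \<exists>B'\<ge>0. \<forall>x. norm (pd b \<kappa> x) \<le> B'"
    using test_function_bounded[OF test_function_pd[OF \<kappa>]] by metis
  then obtain B' where B': "\<And>b. b \<in> Basis \<Longrightarrow> B' b \<ge> 0" "\<And>b x. b \<in> Basis \<Longrightarrow> norm (pd b \<kappa> x) \<le> B' b"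
    by metis
  have "norm (pd b \<kappa> x) \<le> (\<Sum>b\<in>Basis. B' b)" if "b \<in> Basis" for b x
    using B' member_le_sum[OF that, of B'] that by (auto intro: order_trans)
  then show ?thesis
    using corr_has_derivative[OF f test_function_smooth[OF \<kappa>] B] by blast
qed

lemma pd_corr:
  fixes f \<kappa> :: "'a::euclidean_space \<Rightarrow> 'b::{real_normed_field,banach,second_countable_topology}"
  assumes "integrable lborel f" "test_function UNIV \<kappa>"
  shows "pd h (corr f \<kappa>) = (\<lambda>x. - corr f (pd h \<kappa>) x)"
  using pd_eq[OF corr_test_has_derivative[OF assms]] by auto

lemma smooth_corr:
  fixes f \<kappa> :: "'a::euclidean_space \<Rightarrow> 'b::{real_normed_field,banach,second_countable_topology}"
  assumes f: "integrable lborel f" and \<kappa>: "test_function UNIV \<kappa>"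
  shows "smooth (corr f \<kappa>)"
proof (rule smooth_coinduct[where P = "\<lambda>h. \<exists>\<kappa>. test_function UNIV \<kappa> \<and> h = corr f \<kappa>"])
  show "\<exists>\<kappa>'. test_function UNIV \<kappa>' \<and> corr f \<kappa> = corr f \<kappa>'" using \<kappa> by blast
  show "h differentiable (at x)" if "\<exists>\<kappa>. test_function UNIV \<kappa> \<and> h = corr f \<kappa>" for h x
    using that corr_test_has_derivative[OF f] unfolding differentiable_def by blast
  show "\<exists>\<kappa>. test_function UNIV \<kappa> \<and> pd e h = corr f \<kappa>"
    if h: "\<exists>\<kappa>. test_function UNIV \<kappa> \<and> h = corr f \<kappa>" and e: "e \<in> Basis" for e h
  proof -
    obtain \<kappa> where \<kappa>: "test_function UNIV \<kappa>" "h = corr f \<kappa>"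
      using h by blast
    have "pd e h = corr f (\<lambda>x. - pd e \<kappa> x)"
      by (auto simp: \<kappa>(2) pd_corr[OF f \<kappa>(1)] corr_def)
    moreover have "test_function UNIV (\<lambda>x. - pd e \<kappa> x)"
      by (intro test_function_linear[OF test_function_pd[OF \<kappa>(1) e]] bounded_linear_minus bounded_linear_ident)
    ultimately show ?thesis by blast
  qed
qed

lemma corr_pairing:
  fixes f \<kappa> \<psi> :: "'a::euclidean_space \<Rightarrow> 'b::{real_normed_field,banach,second_countable_topology}"
  assumes f: "integrable lborel f" and \<kappa>: "integrable lborel \<kappa>"
    and \<psi>: "\<psi> \<in> borel_measurable borel" "\<And>x. norm (\<psi> x) \<le> B"
  shows "(LINT x|lborel. corr f \<kappa> x * \<psi> x) = (LINT y|lborel. f y * (LINT x|lborel. \<kappa> (y - x) * \<psi> x))"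
proof -
  have [measurable]: "\<psi> \<in> borel_measurable borel" by fact
  have "integrable (lborel \<Otimes>\<^sub>M lborel) (\<lambda>z. (case z of (y, x) \<Rightarrow> f y * \<kappa> (y - x)) * \<psi> (snd z))"
    by (rule integrable_mult_bounded[OF corr_product_integrable[OF f \<kappa>], where B = B]) (auto simp: \<psi>)
  then have P: "integrable (lborel \<Otimes>\<^sub>M lborel) (\<lambda>(y, x). f y * \<kappa> (y - x) * \<psi> x)"
    by (simp add: case_prod_unfold)
  show ?thesis
    unfolding corr_def using lborel_pair.Fubini_integral[OF P]
    by (simp add: mult.assoc flip: integral_mult_left_zero integral_mult_right_zero)
qed

text \<open>Both sides pair \<open>f\<close> with the convolution of the two kernels, which is
  commutative.\<close>

lemma corr_commute:
  fixes f \<kappa> \<rho> :: "'a::euclidean_space \<Rightarrow> 'b::{real_normed_field,banach,second_countable_topology}"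
  assumes f: "integrable lborel f" and \<kappa>: "integrable lborel \<kappa>" "\<And>x. norm (\<kappa> x) \<le> B"
    and \<rho>: "integrable lborel \<rho>" "\<And>x. norm (\<rho> x) \<le> B'"
  shows "corr (corr f \<kappa>) \<rho> x = corr (corr f \<rho>) \<kappa> x"
proof -
  have inner: "(LINT z|lborel. \<kappa> (y - z) * \<rho> (z - x)) = (LINT z|lborel. \<rho> (y - z) * \<kappa> (z - x))" for y
  proof -
    have [measurable]: "\<rho> \<in> borel_measurable borel" using \<rho> by auto
    have "integrable lborel (\<lambda>z. \<kappa> (y - z) * \<rho> (z - x))"
      using \<rho> by (intro integrable_mult_bounded[OF lborel_integrable_reflect[OF \<kappa>(1)], where B = B']) auto
    \<comment> \<open>Substituting y + x - z for z exchanges the arguments y - z and z - x of the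
      two kernels.\<close>
    from lborel_integral_reflect[OF this, of "y + x"] show ?thesis
      by (simp add: mult.commute algebra_simps)
  qed
  have [measurable]: "\<rho> \<in> borel_measurable borel" "\<kappa> \<in> borel_measurable borel"
    using \<rho> \<kappa> by auto
  have "corr (corr f \<kappa>) \<rho> x = (LINT y|lborel. f y * (LINT z|lborel. \<kappa> (y - z) * \<rho> (z - x)))"
    using corr_pairing[OF f \<kappa>(1), of "\<lambda>z. \<rho> (z - x)" B'] \<rho>(2) by (simp add: corr_def)
  also have "\<dots> = corr (corr f \<rho>) \<kappa> x"
    using corr_pairing[OF f \<rho>(1), of "\<lambda>z. \<kappa> (z - x)" B] \<kappa>(2) by (simp add: inner corr_def)
  finally show ?thesis .
qed

text \<open>A kernel of integral one and small first moment nearly reproduces the value at the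
  origin. The Lipschitz bound is asked for at the base point 0 only, so that \<open>\<psi>\<close>
  may be a translate or a reflection of the function of interest.\<close>

lemma kernel_approximation:
  fixes \<kappa> \<psi> :: "'a::euclidean_space \<Rightarrow> 'b::{real_normed_field,banach,second_countable_topology}"
  assumes \<kappa>: "integrable lborel \<kappa>" "integrable lborel (\<lambda>z. norm z * norm (\<kappa> z))"
    and \<psi>: "\<psi> \<in> borel_measurable borel" "\<And>z. norm (\<psi> z - c) \<le> L * norm z"
  shows "norm ((LINT z|lborel. \<kappa> z * \<psi> z) - (LINT z|lborel. \<kappa> z) * c) \<le> L * (LINT z|lborel. norm z * norm (\<kappa> z))"
proof -
  have [measurable]: "\<psi> \<in> borel_measurable borel" "\<kappa> \<in> borel_measurable borel"
    using \<psi> \<kappa> by auto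
  have bound: "norm (\<kappa> z * (\<psi> z - c)) \<le> L * (norm z * norm (\<kappa> z))" for z
    using mult_left_mono[OF \<psi>(2), of "norm (\<kappa> z)" z] by (simp add: norm_mult mult_ac)
  have int: "integrable lborel (\<lambda>z. \<kappa> z * (\<psi> z - c))"
    by (rule Bochner_Integration.integrable_bound[OF integrable_mult_right[OF \<kappa>(2), of L]])
      (use bound in \<open>auto intro!: AE_I2 intro: order_trans[OF _ abs_ge_self]\<close>)
  have "(LINT z|lborel. \<kappa> z * \<psi> z) = (LINT z|lborel. \<kappa> z * (\<psi> z - c) + \<kappa> z * c)"
    by (simp add: algebra_simps)
  also have "\<dots> = (LINT z|lborel. \<kappa> z * (\<psi> z - c)) + (LINT z|lborel. \<kappa> z) * c"
    using int \<kappa> by simp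
  finally have "norm ((LINT z|lborel. \<kappa> z * \<psi> z) - (LINT z|lborel. \<kappa> z) * c) = norm (LINT z|lborel. \<kappa> z * (\<psi> z - c))"
    by simp
  also have "\<dots> \<le> (LINT z|lborel. L * (norm z * norm (\<kappa> z)))"
    by (rule Bochner_Integration.integral_norm_bound_integral) (use int \<kappa> bound in auto)
  finally show ?thesis by simp
qed

section \<open>The Fourier transform of a test function\<close>

text \<open>Dyadic splitting: where |x| is about 2^k the integrand is at most 2^(-k m), and the ball
  of radius 2^(k+1) has volume a constant times 2^(k n). As m >= n + 1, the products decay at least
  like 2^(-k).\<close>

lemma integrable_norm_power_decay:
  assumes "m > DIM('a)"
  shows "integrable lborel (\<lambda>x::'a::euclidean_space. inverse ((1 + norm x) ^ m))"
proof (rule integrableI_bounded)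
  let ?V = "unit_ball_vol (real DIM('a))" and ?n = "DIM('a)"
  have le: "ennreal (inverse ((1 + norm x) ^ m)) \<le> (\<Sum>k. ennreal (inverse (2 ^ (k * m))) * indicator (ball 0 (2 ^ Suc k)) x)"
    for x :: 'a
  proof -
    define F where "F k = ennreal (inverse (2 ^ (k * m))) * indicator (ball 0 (2 ^ Suc k)) x" for k
    \<comment> \<open>The least \<open>k\<close> with |x| < 2^(k+1); minimality gives 2^k <= 1 +
      |x|, where the summand 1 covers the case k = 0.\<close>
    define k where "k = (LEAST k. norm x < 2 ^ Suc k)"
    have ex: "\<exists>k. norm x < 2 ^ Suc k"
      using real_arch_pow[of 2 "norm x"] by (metis one_less_numeral_iff semiring_norm(76) power_Suc
          less_trans power_strict_increasing_iff lessI)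
    have k: "norm x < 2 ^ Suc k" unfolding k_def using ex by (rule LeastI_ex)
    have "2 ^ k \<le> 1 + norm x"
    proof (cases k)
      case (Suc j)
      then have "\<not> norm x < 2 ^ Suc j" using not_less_Least[of j "\<lambda>k. norm x < 2 ^ Suc k"] k_def by auto
      then show ?thesis using Suc by simp
    qed simp
    then have "(2 ^ k) ^ m \<le> (1 + norm x) ^ m" by (intro power_mono) auto
    then have "inverse ((1 + norm x) ^ m) \<le> inverse (2 ^ (k * m))"
      by (intro le_imp_inverse_le) (auto simp: power_mult)
    then have "ennreal (inverse ((1 + norm x) ^ m)) \<le> ennreal (inverse (2 ^ (k * m))) * indicator (ball 0 (2 ^ Suc k)) x"
      using k by (auto simp: ennreal_leI)
    also have "\<dots> = F k" by (simp only: F_def)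
    also have "\<dots> \<le> suminf F"
      using sum_le_suminf[of F "{k}"] by simp
    finally show ?thesis by (simp only: F_def[abs_def])
  qed
  have summand_le: "ennreal (inverse (2 ^ (k * m))) * emeasure lborel (ball (0::'a) (2 ^ Suc k))
      \<le> ennreal (?V * 2 ^ ?n * (1/2) ^ k)" for k
  proof -
    have "inverse (2 ^ (k * m)) * (?V * (2 ^ Suc k) ^ ?n) = ?V * 2 ^ ?n * (inverse (2 ^ m) * 2 ^ ?n) ^ k"
      by (simp add: power_mult_distrib field_simps flip: power_mult power_add)
    also have "\<dots> \<le> ?V * 2 ^ ?n * (1/2) ^ k"
    proof (intro mult_left_mono power_mono)
      have "(2::real) ^ Suc ?n \<le> 2 ^ m" using assms by (intro power_increasing) auto
      then show "inverse (2 ^ m) * 2 ^ ?n \<le> (1/2::real)" by (simp add: field_simps)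
    qed auto
    finally show ?thesis
      by (subst emeasure_ball) (auto simp: ennreal_leI simp flip: ennreal_mult)
  qed
  have "(\<integral>\<^sup>+(x::'a). ennreal (norm (inverse ((1 + norm x) ^ m))) \<partial>lborel)
      \<le> (\<integral>\<^sup>+(x::'a). (\<Sum>k. ennreal (inverse (2 ^ (k * m))) * indicator (ball 0 (2 ^ Suc k)) x) \<partial>lborel)"
    using le by (intro nn_integral_mono) simp
  also have "\<dots> = (\<Sum>k. ennreal (inverse (2 ^ (k * m))) * emeasure lborel (ball (0::'a) (2 ^ Suc k)))"
    by (subst nn_integral_suminf)
      (auto simp: nn_integral_cmult_indicator intro!: borel_measurable_times_ennreal borel_measurable_indicator)
  also have "\<dots> \<le> (\<Sum>k. ennreal (?V * 2 ^ ?n * (1/2) ^ k))"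
    by (intro suminf_le summand_le) auto
  also have "\<dots> = ennreal (\<Sum>k. ?V * 2 ^ ?n * (1/2) ^ k)"
    by (intro suminf_ennreal2) (auto intro!: summable_mult summable_geometric)
  also have "\<dots> < \<infinity>" by simp
  finally show "(\<integral>\<^sup>+(x::'a). ennreal (norm (inverse ((1 + norm x) ^ m))) \<partial>lborel) < \<infinity>" .
qed simp

text \<open>\<open>fourier\<close> integrates over the completed measure; for Borel functions this
  moves to \<open>lborel\<close>, on which Fubini and the substitution rules are stated.\<close>

lemma fourier_lborel:
  assumes "f \<in> borel_measurable borel"
  shows "fourier f k = (LINT x|lborel. cis (- (k \<bullet> x)) * f x)"
proof -
  have "(\<lambda>x. cis (- (k \<bullet> x)) * f x) \<in> borel_measurable lborel"
    using assms by (simp add: cis_conv_exp)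
  then show ?thesis unfolding fourier_def by (rule integral_completion)
qed

lemma inv_fourier_lborel:
  fixes f :: "'a::euclidean_space \<Rightarrow> complex"
  assumes "f \<in> borel_measurable borel"
  shows "inv_fourier f k = (LINT x|lborel. cis (x \<bullet> k) * f x) / of_real ((2 * pi) ^ DIM('a))"
proof -
  have "(\<lambda>x. cis (x \<bullet> k) * f x) \<in> borel_measurable lborel"
    using assms by (simp add: cis_conv_exp)
  then show ?thesis unfolding inv_fourier_def by (subst integral_completion) auto
qed

lemma integrable_cis_mult:
  assumes "integrable lborel f"
  shows "integrable lborel (\<lambda>x. cis (k \<bullet> x) * f x)"
  using integrable_mult_bounded[OF assms, of "\<lambda>x. cis (k \<bullet> x)" 1]
  by (simp add: cis_conv_exp mult.commute)

lemma fourier_bound: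
  assumes "integrable lborel f"
  shows "norm (fourier f k) \<le> (LINT x|lborel. norm (f x))"
proof -
  have "norm (fourier f k) \<le> (LINT x|lborel. norm (cis (- (k \<bullet> x)) * f x))"
    using assms by (subst fourier_lborel) (auto intro: integral_norm_bound)
  then show ?thesis by (simp add: norm_mult)
qed

lemma fourier_has_derivative:
  fixes f :: "'a::euclidean_space \<Rightarrow> complex"
  assumes f: "integrable lborel f" "integrable lborel (\<lambda>x. norm x * norm (f x))"
  shows "(fourier f has_derivative (\<lambda>h. fourier (\<lambda>x. - \<i> * of_real (x \<bullet> h) * f x) k)) (at k)"
proof -
  have [measurable]: "f \<in> borel_measurable borel" using f by auto
  have "((\<lambda>k. LINT x|lborel. cis (- (k \<bullet> x)) * f x) has_derivative
      (\<lambda>h. LINT x|lborel. cis (- (k \<bullet> x)) * (- \<i> * of_real (x \<bullet> h) * f x))) (at k)"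
  proof (rule has_derivative_integral[of UNIV _ _ _ _ "\<lambda>x. norm x * norm (f x)"])
    show "((\<lambda>k. cis (- (k \<bullet> x)) * f x) has_derivative (\<lambda>h. cis (- (k \<bullet> x)) * (- \<i> * of_real (x \<bullet> h) * f x))) (at k)"
      for k x
    proof -
      have "((\<lambda>k. - (k \<bullet> x)) has_derivative (\<lambda>h. - (h \<bullet> x))) (at k)"
        by (auto intro!: derivative_eq_intros)
      from has_derivative_mult_left[OF has_derivative_cis[OF this], of "f x"] show ?thesis
        by (simp add: scaleR_conv_of_real inner_commute mult_ac)
    qed
    show "norm (cis (- (k \<bullet> x)) * (- \<i> * of_real (x \<bullet> h) * f x)) \<le> norm x * norm (f x) * norm h" for k x h
      using mult_right_mono[OF Cauchy_Schwarz_ineq2[of x h], of "norm (f x)"]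
      by (simp add: norm_mult mult_ac)
    show "integrable lborel (\<lambda>x. cis (- (k \<bullet> x)) * f x)" for k
      using integrable_cis_mult[OF f(1), of "- k"] by simp
  qed (use f in \<open>auto simp: cis_conv_exp\<close>)
  moreover have "fourier f = (\<lambda>k. LINT x|lborel. cis (- (k \<bullet> x)) * f x)"
    by (rule ext, rule fourier_lborel) simp
  moreover have "fourier (\<lambda>x. - \<i> * of_real (x \<bullet> h) * f x) k
      = (LINT x|lborel. cis (- (k \<bullet> x)) * (- \<i> * of_real (x \<bullet> h) * f x))" for h
    by (rule fourier_lborel) simp
  ultimately show ?thesis by simp
qed

lemma test_function_measurable:
  "test_function \<Omega> f \<Longrightarrow> f \<in> borel_measurable borel"
  by (auto intro: borel_measurable_continuous_onI smooth_continuous test_function_smooth)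

lemma smooth_of_real_inner: "smooth (\<lambda>x. complex_of_real (x \<bullet> h))"
  by (intro smooth_bounded_linear bounded_linear_compose[OF bounded_linear_of_real] bounded_linear_inner_left)

lemma test_function_fourier_multiplier:
  fixes f :: "'a::euclidean_space \<Rightarrow> complex"
  assumes "test_function \<Omega> f"
  shows "test_function \<Omega> (\<lambda>x. - \<i> * of_real (x \<bullet> h) * f x)"
  by (intro test_function_mult_left smooth_mult smooth_const smooth_of_real_inner assms)

lemma fourier_test_has_derivative:
  fixes f :: "'a::euclidean_space \<Rightarrow> complex"
  assumes f: "test_function \<Omega> f"
  shows "(fourier f has_derivative (\<lambda>h. fourier (\<lambda>x. - \<i> * of_real (x \<bullet> h) * f x) k)) (at k)"
proof (rule fourier_has_derivative)
  show "integrable lborel f" by (rule test_function_integrable[OF f])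
  obtain S where S: "compact S" "\<And>x. x \<notin> S \<Longrightarrow> f x = 0" "smooth f"
    using test_functionD[OF f] by metis
  show "integrable lborel (\<lambda>x. norm x * norm (f x))"
    using smooth_continuous[OF S(3)]
    by (intro integrable_continuous_compact_support[OF _ S(1)]) (auto intro!: continuous_intros simp: S(2))
qed

lemma pd_fourier:
  assumes "test_function \<Omega> f"
  shows "pd h (fourier f) = fourier (\<lambda>x. - \<i> * of_real (x \<bullet> h) * f x)"
  using pd_eq[OF fourier_test_has_derivative[OF assms]] by auto

lemma smooth_fourier:
  assumes "test_function \<Omega> f"
  shows "smooth (fourier f)"
proof (rule smooth_coinduct[where P = "\<lambda>h. \<exists>f. test_function \<Omega> f \<and> h = fourier f"])
  show "h differentiable (at x)" if "\<exists>f. test_function \<Omega> f \<and> h = fourier f" for h x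
    using that fourier_test_has_derivative unfolding differentiable_def by blast
  show "\<exists>f. test_function \<Omega> f \<and> pd e h = fourier f" if "\<exists>f. test_function \<Omega> f \<and> h = fourier f" for e h
    using that pd_fourier test_function_fourier_multiplier by blast
qed (use assms in blast)

lemma iter_deriv_fourier:
  assumes "test_function \<Omega> f"
  shows "\<exists>g. test_function \<Omega> g \<and> iter_deriv es (fourier f) = fourier g"
proof (induction es)
  case (Cons e es)
  then show ?case
    using pd_fourier test_function_fourier_multiplier by fastforce
qed (use assms in auto)

text \<open>The derivative of \<open>cis (- (k \<bullet> x)) * f x\<close> in direction
  \<open>e\<close> integrates to zero, and its two terms give the two sides.\<close>

lemma fourier_pd:
  fixes f :: "'a::euclidean_space \<Rightarrow> complex"
  assumes f: "test_function \<Omega> f" and e: "e \<in> Basis"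
  shows "fourier (pd e f) k = \<i> * of_real (k \<bullet> e) * fourier f k"
proof -
  obtain S where S: "compact S" "\<And>x. x \<notin> S \<Longrightarrow> f x = 0" and sm: "smooth f"
    using test_functionD[OF f] by metis
  define F where "F x = cis (- (k \<bullet> x)) * f x" for x
  define F' where "F' x h = cis (- (k \<bullet> x)) * pd h f x + cis (- (k \<bullet> x)) * (- \<i> * of_real (k \<bullet> h) * f x)" for x h
  have "(LINT x|lborel. F' x e) = 0"
  proof (rule integral_derivative_compact_support[where F = F and S = S])
    show "(F has_derivative F' x) (at x)" for x
    proof -
      have "((\<lambda>x. - (k \<bullet> x)) has_derivative (\<lambda>h. - (k \<bullet> h))) (at x)"
        by (auto intro!: derivative_eq_intros)
      from has_derivative_mult[OF has_derivative_cis[OF this] smooth_has_derivative[OF sm]] show ?thesis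
        unfolding F_def F'_def by (simp add: scaleR_conv_of_real mult_ac)
    qed
    show "continuous_on UNIV (\<lambda>x. F' x e)"
      unfolding F'_def cis_conv_exp by (intro continuous_intros smooth_continuous smooth_pd sm e)
  qed (use S in \<open>auto simp: F_def\<close>)
  moreover have "integrable lborel (\<lambda>x. cis (- (k \<bullet> x)) * pd e f x)"
    using integrable_cis_mult[OF test_function_integrable[OF test_function_pd[OF f e]], of "- k"] by simp
  moreover have "integrable lborel (\<lambda>x. cis (- (k \<bullet> x)) * f x)"
    using integrable_cis_mult[OF test_function_integrable[OF f], of "- k"] by simp
  from integrable_mult_right[OF this, of "- \<i> * of_real (k \<bullet> e)"]
  have "integrable lborel (\<lambda>x. cis (- (k \<bullet> x)) * (- \<i> * of_real (k \<bullet> e) * f x))"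
    by (simp add: mult_ac)
  ultimately have "fourier (pd e f) k + (LINT x|lborel. cis (- (k \<bullet> x)) * (- \<i> * of_real (k \<bullet> e) * f x)) = 0"
    unfolding F'_def fourier_lborel[OF test_function_measurable[OF test_function_pd[OF f e]]] by simp
  moreover have "(LINT x|lborel. cis (- (k \<bullet> x)) * (- \<i> * of_real (k \<bullet> e) * f x))
      = (LINT x|lborel. (- \<i> * of_real (k \<bullet> e)) * (cis (- (k \<bullet> x)) * f x))"
    by (simp add: mult_ac)
  then have "(LINT x|lborel. cis (- (k \<bullet> x)) * (- \<i> * of_real (k \<bullet> e) * f x)) = - \<i> * of_real (k \<bullet> e) * fourier f k"
    unfolding fourier_lborel[OF test_function_measurable[OF f]] by simp
  ultimately show ?thesis by (simp add: add_eq_0_iff2)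
qed

text \<open>Induction on the power: a further factor 1 + |x| is at most 1 plus the sum of the |x .
  b| over basis vectors, and by \<open>fourier_pd\<close> each |x . b| is absorbed by passing from
  \<open>f\<close> to \<open>pd b f\<close>.\<close>

lemma fourier_decay:
  fixes f :: "'a::euclidean_space \<Rightarrow> complex"
  assumes "test_function \<Omega> f"
  shows "\<exists>C\<ge>0. \<forall>x. (1 + norm x) ^ m * norm (fourier f x) \<le> C"
  using assms
proof (induction m arbitrary: f)
  case 0
  show ?case
    using fourier_bound[OF test_function_integrable[OF 0]]
    by (intro exI[of _ "LINT x|lborel. norm (f x)"]) auto
next
  case (Suc m)
  obtain C0 where C0: "C0 \<ge> 0" "\<And>x. (1 + norm x) ^ m * norm (fourier f x) \<le> C0"
    using Suc by blast
  have "\<forall>b\<in>Basis. \<exists>C\<ge>0. \<forall>x. (1 + norm x) ^ m * norm (fourier (pd b f) x) \<le> C"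
    using Suc.IH test_function_pd[OF Suc.prems] by blast
  then obtain C where C: "\<And>b. b \<in> Basis \<Longrightarrow> C b \<ge> 0"
    "\<And>b x. b \<in> Basis \<Longrightarrow> (1 + norm x) ^ m * norm (fourier (pd b f) x) \<le> C b"
    by metis
  have "(1 + norm x) ^ Suc m * norm (fourier f x) \<le> C0 + (\<Sum>b\<in>Basis. C b)" for x
  proof -
    have "norm x \<le> (\<Sum>b\<in>Basis. \<bar>x \<bullet> b\<bar>)" by (rule norm_le_l1)
    then have "(1 + norm x) ^ m * norm (fourier f x) * (1 + norm x)
        \<le> (1 + norm x) ^ m * norm (fourier f x) * (1 + (\<Sum>b\<in>Basis. \<bar>x \<bullet> b\<bar>))"
      by (intro mult_left_mono) auto
    also have "\<dots> = (1 + norm x) ^ m * norm (fourier f x)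
        + (\<Sum>b\<in>Basis. (1 + norm x) ^ m * norm (fourier (pd b f) x))"
      by (simp add: fourier_pd[OF Suc.prems] norm_mult distrib_left sum_distrib_left mult_ac)
    also have "\<dots> \<le> C0 + (\<Sum>b\<in>Basis. C b)"
      by (intro add_mono C0 sum_mono C)
    finally show ?thesis by (simp add: mult_ac)
  qed
  moreover have "C0 + (\<Sum>b\<in>Basis. C b) \<ge> 0"
    by (intro add_nonneg_nonneg C0 sum_nonneg C)
  ultimately show ?case by blast
qed

text \<open>Tempered distributions can be tested on Schwartz functions only, and these transforms
  are the supply used here. By \<open>iter_deriv_fourier\<close> their derivatives are again
  transforms of test functions, so \<open>fourier_decay\<close> covers every seminorm.\<close>

lemma schwartz_fourier:
  assumes "test_function \<Omega> f"
  shows "schwartz (fourier f)"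
  unfolding schwartz_def
proof (intro conjI allI impI)
  show "smooth (fourier f)" by (rule smooth_fourier[OF assms])
  fix k es
  obtain g where g: "test_function \<Omega> g" "iter_deriv es (fourier f) = fourier g"
    using iter_deriv_fourier[OF assms] by blast
  obtain C where "\<And>x. (1 + norm x) ^ k * norm (fourier g x) \<le> C"
    using fourier_decay[OF g(1)] by blast
  then show "bounded (range (\<lambda>x. (1 + norm x) ^ k *\<^sub>R iter_deriv es (fourier f) x))"
    unfolding g(2) bounded_iff by (intro exI[of _ C]) auto
qed

lemma fourier_moment_integrable:
  fixes f :: "'a::euclidean_space \<Rightarrow> complex"
  assumes "test_function \<Omega> f"
  shows "integrable lborel (\<lambda>x. norm x ^ m * norm (fourier f x))"
proof -
  \<comment> \<open>\<open>Suc DIM('a)\<close> powers are reserved for integrability, the other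
    \<open>m\<close> for the weight.\<close>
  let ?M = "m + Suc DIM('a)"
  obtain C where C: "C \<ge> 0" "\<And>x. (1 + norm x) ^ ?M * norm (fourier f x) \<le> C"
    using fourier_decay[OF assms] by blast
  have [measurable]: "fourier f \<in> borel_measurable borel"
    by (intro borel_measurable_continuous_onI smooth_continuous smooth_fourier[OF assms])
  show ?thesis
  proof (rule Bochner_Integration.integrable_bound)
    show "integrable lborel (\<lambda>x::'a. C * inverse ((1 + norm x) ^ Suc DIM('a)))"
      by (intro integrable_mult_right integrable_norm_power_decay) auto
    show "AE x in lborel. norm (norm x ^ m * norm (fourier f x)) \<le> norm (C * inverse ((1 + norm x) ^ Suc DIM('a)))"
    proof (intro AE_I2)
      fix x :: 'a
      have "norm x ^ m * norm (fourier f x) * (1 + norm x) ^ Suc DIM('a)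
          \<le> (1 + norm x) ^ m * norm (fourier f x) * (1 + norm x) ^ Suc DIM('a)"
        by (intro mult_right_mono power_mono) auto
      also have "\<dots> = (1 + norm x) ^ ?M * norm (fourier f x)"
        by (simp only: power_add mult_ac)
      also have "\<dots> \<le> C" by (rule C)
      finally have "norm x ^ m * norm (fourier f x) \<le> C / (1 + norm x) ^ Suc DIM('a)"
        by (subst pos_le_divide_eq) (auto simp del: power_Suc intro!: zero_less_power add_pos_nonneg)
      then show "norm (norm x ^ m * norm (fourier f x)) \<le> norm (C * inverse ((1 + norm x) ^ Suc DIM('a)))"
        using C(1) by (simp add: divide_inverse abs_mult del: power_Suc)
    qed
  qed simp
qed

lemma fourier_integrable:
  assumes "test_function \<Omega> f"
  shows "integrable lborel (fourier f)"
proof (rule integrable_norm_cancel)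
  show "integrable lborel (\<lambda>x. norm (fourier f x))"
    using fourier_moment_integrable[OF assms, of 0] by simp
  show "fourier f \<in> borel_measurable lborel"
    by (simp add: borel_measurable_continuous_onI smooth_continuous smooth_fourier[OF assms])
qed

section \<open>Fourier inversion up to a constant and Littlewood-Paley projectors\<close>

lemma smooth_add:
  assumes "smooth f" "smooth g"
  shows "smooth (\<lambda>x. f x + g x)"
proof -
  have "bilinear_span scaleR (\<lambda>x. (1::real) *\<^sub>R f x + 1 *\<^sub>R g x)"
    by (intro bilinear_span.intros smooth_const assms)
  from smooth_bilinear_span[OF bounded_bilinear_scaleR this] show ?thesis by simp
qed

lemma smooth_diff:
  assumes "smooth f" "smooth g"
  shows "smooth (\<lambda>x. f x - g x)"
  using smooth_add[OF assms(1) smooth_linear[OF assms(2) bounded_linear_minus[OF bounded_linear_ident]]] by simp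

lemma fourier_scale:
  fixes f :: "'a::euclidean_space \<Rightarrow> complex"
  assumes "integrable lborel f" "N > 0"
  shows "fourier (\<lambda>k. f (k /\<^sub>R N)) x = of_real (N ^ DIM('a)) * fourier f (N *\<^sub>R x)"
proof -
  have [measurable]: "f \<in> borel_measurable borel" using assms by auto
  have "integrable lborel (\<lambda>k. cis (- (N *\<^sub>R x) \<bullet> k) * f k)"
    by (rule integrable_cis_mult[OF assms(1)])
  moreover have inv: "inverse N * (N * t) = t" for t using assms(2) by simp
  ultimately
  have "(LINT k|lborel. cis (- (x \<bullet> k)) * f (k /\<^sub>R N)) = (LINT k|lborel. cis (- ((N *\<^sub>R x) \<bullet> k)) * f k) /\<^sub>R \<bar>inverse N\<bar> ^ DIM('a)"
    using lborel_integral_affine[of "\<lambda>k. cis (- (N *\<^sub>R x) \<bullet> k) * f k" "inverse N" 0] assms(2) by (simp add: inv)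
  then show ?thesis
    using assms(2) by (simp add: fourier_lborel scaleR_conv_of_real power_inverse)
qed

lemma fourier_modulate:
  "fourier (\<lambda>k. cis (k \<bullet> x) * f k) y = fourier f (y - x)"
proof -
  have "cis (- (y \<bullet> k)) * (cis (k \<bullet> x) * f k) = cis (- ((y - x) \<bullet> k)) * f k" for k
    unfolding mult.assoc[symmetric] cis_mult by (simp add: inner_diff_left inner_commute[of x k])
  then show ?thesis unfolding fourier_def by (simp only:)
qed

lemma fourier_translate:
  assumes "integrable lborel f"
  shows "fourier (\<lambda>x. f (x + a)) k = cis (k \<bullet> a) * fourier f k"
proof -
  have [measurable]: "f \<in> borel_measurable borel" using assms by auto
  have "integrable lborel (\<lambda>x. cis (k \<bullet> a) * (cis (- k \<bullet> x) * f x))"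
    by (intro integrable_mult_right integrable_cis_mult[OF assms])
  from lborel_integral_translate[OF this, of a]
  have "(LINT x|lborel. cis (k \<bullet> a) * (cis (- k \<bullet> (x + a)) * f (x + a))) = cis (k \<bullet> a) * fourier f k"
    by (simp add: fourier_lborel)
  moreover have "cis (k \<bullet> a) * (cis (- k \<bullet> (x + a)) * f (x + a)) = cis (- (k \<bullet> x)) * f (x + a)" for x
    unfolding mult.assoc[symmetric] cis_mult by (simp add: inner_add_right)
  ultimately have "(LINT x|lborel. cis (- (k \<bullet> x)) * f (x + a)) = cis (k \<bullet> a) * fourier f k"
    by (simp only:)
  then show ?thesis by (subst fourier_lborel) auto
qed

lemma fourier_multiplication_formula:
  fixes f g :: "'a::euclidean_space \<Rightarrow> complex"
  assumes "integrable lborel f" "integrable lborel g"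
  shows "(LINT x|lborel. fourier f x * g x) = (LINT x|lborel. f x * fourier g x)"
proof -
  have [measurable]: "f \<in> borel_measurable borel" "g \<in> borel_measurable borel"
    using assms by auto
  have P: "integrable (lborel \<Otimes>\<^sub>M lborel) (\<lambda>(x, y). cis (- (x \<bullet> y)) * f y * g x)"
  proof (rule lborel_pair.Fubini_integrable)
    show "(\<lambda>(x, y). cis (- (x \<bullet> y)) * f y * g x) \<in> borel_measurable (lborel \<Otimes>\<^sub>M lborel)"
      unfolding cis_conv_exp by measurable
    show "integrable lborel (\<lambda>x. LINT y|lborel. norm (case (x, y) of (x, y) \<Rightarrow> cis (- (x \<bullet> y)) * f y * g x))"
      using assms by (simp add: norm_mult)
    show "AE x in lborel. integrable lborel (\<lambda>y. case (x, y) of (x, y) \<Rightarrow> cis (- (x \<bullet> y)) * f y * g x)"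
      using integrable_cis_mult[OF assms(1), of "- x" for x] by (intro AE_I2) simp
  qed
  have "(LINT x|lborel. fourier f x * g x) = (LINT x|lborel. LINT y|lborel. cis (- (x \<bullet> y)) * f y * g x)"
    by (simp add: fourier_lborel)
  also have "\<dots> = (LINT y|lborel. LINT x|lborel. cis (- (x \<bullet> y)) * f y * g x)"
    using lborel_pair.Fubini_integral[OF P] by simp
  also have "\<dots> = (LINT y|lborel. LINT x|lborel. f y * (cis (- (y \<bullet> x)) * g x))"
    by (simp add: inner_commute mult_ac)
  also have "\<dots> = (LINT y|lborel. f y * fourier g y)"
    by (simp add: fourier_lborel)
  finally show ?thesis .
qed

section \<open>Inversion by dilating test functions\<close>

lemma integral_dilation_tendsto:
  fixes f g :: "'a::euclidean_space \<Rightarrow> complex"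
  assumes f: "integrable lborel f" and g: "continuous_on UNIV g" "\<And>x. norm (g x) \<le> B"
  shows "(\<lambda>i. LINT x|lborel. f x * g (x /\<^sub>R real (Suc i))) \<longlonglongrightarrow> (LINT x|lborel. f x) * g 0"
proof -
  have [measurable]: "f \<in> borel_measurable borel" "g \<in> borel_measurable borel"
    using f borel_measurable_continuous_onI[OF g(1)] by auto
  have "(\<lambda>i. LINT x|lborel. f x * g (x /\<^sub>R real (Suc i))) \<longlonglongrightarrow> (LINT x|lborel. f x * g 0)"
  proof (rule integral_dominated_convergence[where w = "\<lambda>x. B * norm (f x)"])
    show "AE x in lborel. (\<lambda>i. f x * g (x /\<^sub>R real (Suc i))) \<longlonglongrightarrow> f x * g 0"
    proof (intro AE_I2 tendsto_mult tendsto_const)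
      fix x :: 'a
      have "(\<lambda>i. inverse (real (Suc i)) *\<^sub>R x) \<longlonglongrightarrow> 0 *\<^sub>R x"
        by (intro tendsto_intros LIMSEQ_inverse_real_of_nat)
      then have "(\<lambda>i. x /\<^sub>R real (Suc i)) \<longlonglongrightarrow> 0" by simp
      moreover have "isCont g 0" using g(1) by (simp add: continuous_on_eq_continuous_at)
      ultimately show "(\<lambda>i. g (x /\<^sub>R real (Suc i))) \<longlonglongrightarrow> g 0"
        by (rule isCont_tendsto_compose[rotated])
    qed
    show "AE x in lborel. norm (f x * g (x /\<^sub>R real (Suc i))) \<le> B * norm (f x)" for i
      using g(2) by (intro AE_I2) (auto simp: norm_mult mult.commute[of B] intro: mult_left_mono)
  qed (use f in auto)
  then show ?thesis by simp
qed

text \<open>In the multiplication formula for \<open>g\<close> and the dilate h (x / N), rescaling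
  moves the dilation over to \<open>g\<close>. As N tends to infinity, the dilated functions on both
  sides tend to their values at 0. Hence the integral of a transform is a universal multiple of the
  value of the function at 0.\<close>

lemma integral_fourier_symmetric:
  fixes g h :: "'a::euclidean_space \<Rightarrow> complex"
  assumes g: "test_function \<Omega> g" and h: "test_function \<Omega>' h"
  shows "(LINT x|lborel. fourier g x) * h 0 = (LINT x|lborel. fourier h x) * g 0"
proof (rule LIMSEQ_unique)
  note gi = test_function_integrable[OF g] and hi = test_function_integrable[OF h]
  obtain Bh where Bh: "\<And>x. norm (h x) \<le> Bh" using test_function_bounded[OF h] by blast
  obtain Bg where Bg: "\<And>x. norm (g x) \<le> Bg" using test_function_bounded[OF g] by blast
  show "(\<lambda>i. LINT x|lborel. fourier g x * h (x /\<^sub>R real (Suc i))) \<longlonglongrightarrow> (LINT x|lborel. fourier g x) * h 0"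
    by (rule integral_dilation_tendsto[OF fourier_integrable[OF g] smooth_continuous[OF test_function_smooth[OF h]] Bh])
  have "(LINT x|lborel. fourier g x * h (x /\<^sub>R N)) = (LINT x|lborel. fourier h x * g (x /\<^sub>R N))" if "N > 0" for N :: real
  proof -
    have "integrable lborel (\<lambda>x. h (x /\<^sub>R N))"
      using lborel_integrable_affine[OF hi, of "inverse N" 0] that by simp
    from fourier_multiplication_formula[OF gi this]
    have "(LINT x|lborel. fourier g x * h (x /\<^sub>R N)) = (LINT x|lborel. g x * (of_real (N ^ DIM('a)) * fourier h (N *\<^sub>R x)))"
      using fourier_scale[OF hi that] by simp
    also have "\<dots> = (LINT x|lborel. of_real (N ^ DIM('a)) * (g (N *\<^sub>R x /\<^sub>R N) * fourier h (N *\<^sub>R x)))"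
      using that by (simp add: mult_ac)
    also have "\<dots> = of_real (N ^ DIM('a)) * (LINT x|lborel. g (N *\<^sub>R x /\<^sub>R N) * fourier h (N *\<^sub>R x))"
      by (rule integral_mult_right_zero)
    also have "(LINT x|lborel. g (N *\<^sub>R x /\<^sub>R N) * fourier h (N *\<^sub>R x))
        = (LINT x|lborel. fourier h x * g (x /\<^sub>R N)) /\<^sub>R \<bar>N\<bar> ^ DIM('a)"
    proof -
      have [measurable]: "g \<in> borel_measurable borel" by (rule test_function_measurable[OF g])
      have "integrable lborel (\<lambda>x. fourier h x * g (x /\<^sub>R N))"
        by (rule integrable_mult_bounded[OF fourier_integrable[OF h], of _ Bg]) (auto simp: Bg)
      from lborel_integral_affine[OF this, of N 0] show ?thesis
        using that by (simp add: mult.commute)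
    qed
    finally show ?thesis using that by (simp add: scaleR_conv_of_real)
  qed
  then have "(\<lambda>i. LINT x|lborel. fourier g x * h (x /\<^sub>R real (Suc i)))
      = (\<lambda>i. LINT x|lborel. fourier h x * g (x /\<^sub>R real (Suc i)))"
    by simp
  then show "(\<lambda>i. LINT x|lborel. fourier g x * h (x /\<^sub>R real (Suc i))) \<longlonglongrightarrow> (LINT x|lborel. fourier h x) * g 0"
    using integral_dilation_tendsto[OF fourier_integrable[OF h] smooth_continuous[OF test_function_smooth[OF g]] Bg]
    by simp
qed

text \<open>This is \<open>integral_fourier_symmetric\<close> for the translate of \<open>g\<close>
  by \<open>k\<close>, whose transform carries the factor
  \<open>cis (x \<bullet> k)\<close>.\<close>

lemma integral_cis_fourier:
  fixes g h :: "'a::euclidean_space \<Rightarrow> complex"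
  assumes g: "test_function UNIV g" and h: "test_function UNIV h" "h 0 = 1"
  shows "(LINT x|lborel. cis (x \<bullet> k) * fourier g x) = (LINT x|lborel. fourier h x) * g k"
proof -
  obtain S where S: "smooth g" "compact S" "\<And>x. x \<notin> S \<Longrightarrow> g x = 0"
    using test_functionD[OF g] by metis
  have "test_function UNIV (\<lambda>x. g (x + k))"
  proof (rule test_functionI)
    show "smooth (\<lambda>x. g (x + k))" using smooth_affine[OF S(1), of 1 k] by simp
    show "compact ((\<lambda>x. x - k) ` S)" using S(2) by (rule compact_translation_subtract)
    show "g (x + k) = 0" if "x \<notin> (\<lambda>x. x - k) ` S" for x
      using that by (intro S(3)) (auto simp: image_iff algebra_simps)
  qed simp
  from integral_fourier_symmetric[OF this h(1)] show ?thesis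
    by (simp add: h fourier_translate[OF test_function_integrable[OF g]])
qed

lemma inv_fourier_fourier:
  fixes g h :: "'a::euclidean_space \<Rightarrow> complex"
  assumes g: "test_function UNIV g" and h: "test_function UNIV h" "h 0 = 1"
  shows "inv_fourier (fourier g) k = (LINT x|lborel. fourier h x) / of_real ((2 * pi) ^ DIM('a)) * g k"
proof -
  have "fourier g \<in> borel_measurable borel"
    using fourier_integrable[OF g] by auto
  then show ?thesis
    using integral_cis_fourier[OF assms] by (simp add: inv_fourier_lborel)
qed

text \<open>If the constant in the inversion formula vanished, the multiplication formula for \<open>h\<close> and
  the conjugate of its transform would force the transform to vanish identically.\<close>

lemma integral_fourier_nonzero:
  fixes h :: "'a::euclidean_space \<Rightarrow> complex"
  assumes h: "test_function UNIV h" "h 0 = 1" and pos: "(LINT x|lborel. h x) \<noteq> 0"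
  shows "(LINT x|lborel. fourier h x) \<noteq> 0"
proof
  assume 0: "(LINT x|lborel. fourier h x) = 0"
  have int: "integrable lborel (\<lambda>x. cnj (fourier h x))"
    using fourier_integrable[OF h(1)] by simp
  have cont: "continuous_on UNIV (fourier h)"
    by (rule smooth_continuous[OF smooth_fourier[OF h(1)]])
  have [measurable]: "fourier h \<in> borel_measurable borel"
    using cont by (rule borel_measurable_continuous_onI)
  have sq: "fourier h x * cnj (fourier h x) = complex_of_real ((norm (fourier h x))\<^sup>2)" for x
    by (rule complex_norm_square[symmetric])
  have "fourier (\<lambda>x. cnj (fourier h x)) k = 0" for k
  proof -
    have m: "(\<lambda>x. cnj (fourier h x)) \<in> borel_measurable borel"
      using borel_measurable_integrable[OF int] by simp
    have "fourier (\<lambda>x. cnj (fourier h x)) k = (LINT x|lborel. cnj (cis (x \<bullet> k) * fourier h x))"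
      unfolding fourier_lborel[OF m] by (simp add: cis_cnj inner_commute[of k])
    also have "\<dots> = 0"
      using integral_cis_fourier[OF h(1) h, of k] 0 integral_bounded_linear[OF bounded_linear_cnj integrable_cis_mult[OF fourier_integrable[OF h(1)], of k]]
      by (simp add: inner_commute)
    finally show ?thesis .
  qed
  then have "(LINT x|lborel. fourier h x * cnj (fourier h x)) = 0"
    using fourier_multiplication_formula[OF test_function_integrable[OF h(1)] int] by simp
  then have I0: "(LINT x|lborel. (norm (fourier h x))\<^sup>2) = 0"
    unfolding sq integral_complex_of_real by simp
  have "integrable lborel (\<lambda>x. (norm (fourier h x))\<^sup>2)"
  proof -
    have "integrable lborel (\<lambda>x. fourier h x * cnj (fourier h x))"
      using fourier_bound[OF test_function_integrable[OF h(1)]] borel_measurable_integrable[OF int]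
      by (intro integrable_mult_bounded[OF fourier_integrable[OF h(1)]]) auto
    then show ?thesis unfolding sq complex_of_real_integrable_eq .
  qed
  then have "AE x in lborel. (norm (fourier h x))\<^sup>2 = 0"
    using I0 by (subst (asm) integral_nonneg_eq_0_iff_AE) auto
  then have "AE x in lborel. x \<notin> {x. fourier h x \<noteq> 0}" by simp
  then have "{x. fourier h x \<noteq> 0} \<in> null_sets lborel"
    by (subst AE_iff_null_sets) (auto intro!: borel_open open_Collect_neq cont continuous_on_const)
  then have "negligible {x. fourier h x \<noteq> 0}"
    by (simp add: negligible_iff_null_sets null_sets_completionI)
  then have "{x. fourier h x \<noteq> 0} = {}"
    using open_not_negligible[OF open_Collect_neq[OF cont continuous_on_const]] by blast
  then have "fourier h 0 = 0" by blast
  \<comment> \<open>The transform at frequency 0 is the integral of \<open>h\<close>, which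
    \<open>pos\<close> makes nonzero.\<close>
  then show False
    using pos fourier_lborel[OF test_function_measurable[OF h(1)], of 0] by simp
qed

section \<open>The Littlewood-Paley bump and its projectors\<close>

lemma LP_bumpD:
  assumes "LP_bump \<phi>"
  shows LP_bump_smooth: "smooth \<phi>" and LP_bump_nonneg: "\<phi> k \<ge> 0"
    and LP_bump_eq_1: "norm k \<le> 1 \<Longrightarrow> \<phi> k = 1" and LP_bump_eq_0: "norm k > 2 \<Longrightarrow> \<phi> k = 0"
proof -
  show "smooth \<phi>" "\<phi> k \<ge> 0" "norm k \<le> 1 \<Longrightarrow> \<phi> k = 1" using assms unfolding LP_bump_def by blast+
  have "closure {k. \<phi> k \<noteq> 0} \<subseteq> cball 0 2" using assms unfolding LP_bump_def by blast
  with closure_subset have "{k. \<phi> k \<noteq> 0} \<subseteq> cball 0 2" by (rule order_trans)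
  then show "norm k > 2 \<Longrightarrow> \<phi> k = 0" by (auto simp: subset_iff)
qed

lemma LP_bump_test_function: "LP_bump \<phi> \<Longrightarrow> test_function UNIV \<phi>"
  by (rule test_functionI[of _ "cball 0 2"]) (auto simp: LP_bump_smooth LP_bump_eq_0)

lemma LP_bump_integral_pos:
  fixes \<phi> :: "'a::euclidean_space \<Rightarrow> real"
  assumes "LP_bump \<phi>"
  shows "(LINT x|lborel. \<phi> x) > 0"
proof -
  have "measure lborel (cball (0::'a) 1) = (LINT x|lborel. indicator (cball (0::'a) 1) x)"
    by simp
  also have "\<dots> \<le> (LINT x|lborel. \<phi> x)"
  proof (rule integral_mono)
    show "integrable lborel (indicator (cball (0::'a) 1) :: _ \<Rightarrow> real)"
      using emeasure_bounded_finite[OF bounded_cball, of "0::'a" 1] by (intro integrable_real_indicator) auto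
    show "indicator (cball 0 1) x \<le> \<phi> x" for x
      using LP_bump_eq_1[OF assms, of x] LP_bump_nonneg[OF assms, of x] by (auto simp: indicator_def)
  qed (rule test_function_integrable[OF LP_bump_test_function[OF assms]])
  finally show ?thesis
    by (rule less_le_trans[rotated]) (rule content_cball_pos, simp)
qed

text \<open>By \<open>integral_cis_fourier\<close> this is the factor c for which integrating
  \<open>cis (x \<bullet> k) * fourier g x\<close> gives c times g k, since \<open>\<phi>\<close> is
  1 at the origin. Its classical value is (2 pi)^n.\<close>

definition LP_const :: "('a::euclidean_space \<Rightarrow> real) \<Rightarrow> complex" where
  "LP_const \<phi> = (LINT x|lborel. fourier (\<lambda>k. of_real (\<phi> k)) x)"

lemma LP_bump_complex: "LP_bump \<phi> \<Longrightarrow> test_function UNIV (\<lambda>k. complex_of_real (\<phi> k))"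
  by (rule test_function_linear[OF LP_bump_test_function bounded_linear_of_real])

lemma LP_const_nonzero:
  assumes "LP_bump \<phi>"
  shows "LP_const \<phi> \<noteq> 0"
  unfolding LP_const_def
proof (rule integral_fourier_nonzero[OF LP_bump_complex[OF assms]])
  show "complex_of_real (\<phi> 0) = 1" using LP_bump_eq_1[OF assms, of 0] by simp
  show "(LINT x|lborel. complex_of_real (\<phi> x)) \<noteq> 0"
    using LP_bump_integral_pos[OF assms] by simp
qed

text \<open>Testing with the transform of a test function lets the inverse transform inside
  \<open>LP_projector\<close> cancel up to the constant of inversion. The abstract projector becomes
  an integral of \<open>V\<close> against an explicit transform, and the later estimates use it in
  this form.\<close>

lemma LP_projector_pairing:
  fixes \<phi> :: "'a::euclidean_space \<Rightarrow> real"
  assumes \<phi>: "LP_bump \<phi>" and V: "represents V T" and f: "represents f (LP_projector \<phi> N T)"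
    and g: "test_function UNIV g"
  shows "(LINT x|lebesgue. f x * fourier g x) = LP_const \<phi> / of_real ((2 * pi) ^ DIM('a)) *
     (LINT x|lebesgue. V x * fourier (\<lambda>k. of_real (\<phi> (k /\<^sub>R N) - \<phi> ((2 / N) *\<^sub>R k)) * g k) x)"
proof -
  let ?w = "\<lambda>k. complex_of_real (\<phi> (k /\<^sub>R N) - \<phi> ((2 / N) *\<^sub>R k))"
  define c where "c = LP_const \<phi> / of_real ((2 * pi) ^ DIM('a))"
  have sm: "smooth \<phi>" and 1: "\<phi> 0 = 1" using LP_bump_smooth[OF \<phi>] LP_bump_eq_1[OF \<phi>, of 0] by simp_all
  have "smooth ?w"
    using smooth_affine[OF sm, of "inverse N" 0] smooth_affine[OF sm, of "2 / N" 0]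
    by (intro smooth_linear[OF _ bounded_linear_of_real] smooth_diff) simp_all
  then have wg: "test_function UNIV (\<lambda>k. ?w k * g k)" by (rule test_function_mult_left[OF _ g])
  then have cwg: "test_function UNIV (\<lambda>k. c * (?w k * g k))"
    by (rule test_function_mult_left[OF smooth_const])
  have "inv_fourier (fourier g) = (\<lambda>k. c * g k)"
    using inv_fourier_fourier[OF g LP_bump_complex[OF \<phi>]] 1 by (auto simp: c_def LP_const_def)
  then have "LP_projector \<phi> N T (fourier g) = T (fourier (\<lambda>k. c * (?w k * g k)))"
    by (simp add: LP_projector_def dist_inv_fourier_def dist_mult_def dist_fourier_def mult_ac)
  also have "\<dots> = (LINT x|lebesgue. V x * fourier (\<lambda>k. c * (?w k * g k)) x)"
    using V schwartz_fourier[OF cwg] by (auto simp: represents_def)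
  also have "fourier (\<lambda>k. c * (?w k * g k)) = (\<lambda>x. c * fourier (\<lambda>k. ?w k * g k) x)"
    unfolding fourier_def by (simp add: mult.left_commute)
  also have "(LINT x|lebesgue. V x * (c * fourier (\<lambda>k. ?w k * g k) x)) = c * (LINT x|lebesgue. V x * fourier (\<lambda>k. ?w k * g k) x)"
    by (simp add: mult.left_commute)
  finally show ?thesis
    using f schwartz_fourier[OF g] by (auto simp: represents_def c_def)
qed

section \<open>The boundary layer of a bounded \<open>C\<^sup>1\<^sup>,\<^sup>1\<close> domain\<close>

lemma infdist_frontier_point:
  fixes x :: "'a::euclidean_space"
  assumes "x \<in> \<Omega>" "infdist x (- \<Omega>) < \<delta>" "- \<Omega> \<noteq> {}"
  obtains y where "y \<in> frontier \<Omega>" "dist x y < \<delta>"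
proof -
  obtain z where z: "z \<notin> \<Omega>" "dist x z < \<delta>"
  proof -
    have "\<exists>z\<in>- \<Omega>. dist x z < \<delta>"
    proof (rule ccontr)
      assume "\<not> ?thesis"
      then have "\<delta> \<le> infdist x (- \<Omega>)"
        unfolding infdist_def using assms(3) by (auto intro!: cINF_greatest simp: not_less)
      with assms(2) show False by simp
    qed
    then show ?thesis using that by auto
  qed
  \<comment> \<open>The segment leaves \<open>\<Omega>\<close>, so it meets the frontier, no farther
    from \<open>x\<close> than \<open>z\<close> is.\<close>
  have "closed_segment x z \<inter> frontier \<Omega> \<noteq> {}"
    using assms(1) z(1) by (intro connected_Int_frontier connected_segment) auto
  then obtain y where y: "y \<in> closed_segment x z" "y \<in> frontier \<Omega>" by blast
  have "dist x y \<le> dist x z"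
    using y(1) by (metis dist_commute dist_in_closed_segment(1))
  with y z show ?thesis using that by force
qed

text \<open>A globally Lipschitz gradient grows at most linearly, so it is bounded on balls and the
  mean value inequality applies.\<close>

lemma C11_function_lipschitz_on_ball:
  fixes g :: "'a::euclidean_space \<Rightarrow> real"
  assumes "C11_function g"
  obtains G where "G \<ge> 0" "\<And>x y. norm x \<le> R \<Longrightarrow> norm y \<le> R \<Longrightarrow> \<bar>g x - g y\<bar> \<le> G * norm (x - y)"
proof -
  obtain D L where D: "\<And>x. (g has_derivative (\<lambda>h. D x \<bullet> h)) (at x)" and L: "L-lipschitz_on UNIV D"
    using assms unfolding C11_function_def by blast
  have "norm (D x) \<le> norm (D 0) + L * \<bar>R\<bar>" if "norm x \<le> R" for x
  proof -
    have "dist (D x) (D 0) \<le> L * dist x 0"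
      using L by (rule lipschitz_onD) auto
    moreover have "L * norm x \<le> L * \<bar>R\<bar>"
      using that lipschitz_on_nonneg[OF L] by (intro mult_left_mono) auto
    ultimately show ?thesis
      using norm_triangle_ineq2[of "D x" "D 0"] by (simp add: dist_norm)
  qed
  then have "onorm (\<lambda>h. D x \<bullet> h) \<le> norm (D 0) + L * \<bar>R\<bar>" if "x \<in> cball 0 R" for x
    using that by (intro onorm_le) (auto intro!: order_trans[OF Cauchy_Schwarz_ineq2] mult_right_mono)
  then have "norm (g x - g y) \<le> (norm (D 0) + L * \<bar>R\<bar>) * norm (x - y)" if "norm x \<le> R" "norm y \<le> R" for x y
    using that D by (intro differentiable_bound[of "cball 0 R"]) (auto intro: has_derivative_at_withinI)
  moreover have "norm (D 0) + L * \<bar>R\<bar> \<ge> 0"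
    using lipschitz_on_nonneg[OF L] by simp
  ultimately show ?thesis using that by simp
qed

text \<open>The function \<open>h\<close> grows with unit speed along \<open>e\<close>, so the thin level set of \<open>h\<close> has about
  \<open>1 / \<delta>\<close> pairwise disjoint translates inside a fixed ball; no integration over \<open>e\<^sup>\<bottom>\<close> is needed.\<close>

lemma emeasure_thin_level_set:
  fixes h :: "'a::euclidean_space \<Rightarrow> real"
  assumes e: "norm e = 1" and h: "\<And>x t. h (x + t *\<^sub>R e) = h x + t"
    and S: "S \<in> sets borel" "S \<subseteq> ball x0 r" "\<And>x. x \<in> S \<Longrightarrow> \<bar>h x\<bar> \<le> d" and d: "d > 0"
  shows "emeasure lborel S \<le> ennreal (3 * d * measure lborel (ball x0 (r + 1)))"
proof -
  \<comment> \<open>There are \<open>J\<close> translates with spacing 3 d, more than the thickness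
    2 d, so they are disjoint. Rounding up gives 1 <= 3 d J, while 3 d (J - 1) < 1 keeps all of them
    in the ball of radius r + 1.\<close>
  define J where "J = nat \<lceil>1 / (3 * d)\<rceil>"
  have J: "1 / (3 * d) \<le> real J" "real J - 1 < 1 / (3 * d)"
    using d unfolding J_def by (auto simp: real_nat_ceiling_ge) (use ceiling_correct[of "1 / (3 * d)"] in simp)
  define T where "T j = (\<lambda>x. x - (3 * d * real j) *\<^sub>R e) -` S" for j
  have T_meas: "T j \<in> sets borel" for j
    unfolding T_def using S(1) by (intro measurable_sets_borel[of _ borel]) auto
  have T_emeasure: "emeasure lborel (T j) = emeasure lborel S" for j
  proof -
    have "emeasure lborel S = emeasure (distr lborel borel ((+) (- (3 * d * real j) *\<^sub>R e))) S"
      by (simp add: lborel_distr_plus)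
    also have "\<dots> = emeasure lborel (T j)"
      using S(1) by (subst emeasure_distr) (auto simp: T_def vimage_def)
    finally show ?thesis by simp
  qed
  have T_h: "\<bar>h x - 3 * d * real j\<bar> \<le> d" if "x \<in> T j" for x j
    using S(3)[of "x - (3 * d * real j) *\<^sub>R e"] that h[of x "- (3 * d * real j)"] by (simp add: T_def)
  have disj: "disjoint_family_on T {..<J}"
    unfolding disjoint_family_on_def
  proof (intro ballI impI)
    fix i j :: nat assume "i \<noteq> j"
    have False if x: "x \<in> T i" "x \<in> T j" for x
    proof -
      have "\<bar>3 * d * real i - 3 * d * real j\<bar> \<le> 2 * d"
        using T_h[OF x(1)] T_h[OF x(2)] by linarith
      moreover have "\<bar>3 * d * real i - 3 * d * real j\<bar> = 3 * d * \<bar>real i - real j\<bar>"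
        using d by (simp add: abs_mult flip: right_diff_distrib)
      moreover have "1 \<le> \<bar>real i - real j\<bar>" using \<open>i \<noteq> j\<close> by linarith
      then have "3 * d * 1 \<le> 3 * d * \<bar>real i - real j\<bar>" using d by (intro mult_left_mono) auto
      ultimately show False using d by linarith
    qed
    then show "T i \<inter> T j = {}" by blast
  qed
  have sub: "T j \<subseteq> ball x0 (r + 1)" if "j < J" for j
  proof
    fix x assume "x \<in> T j"
    then have "dist x0 (x - (3 * d * real j) *\<^sub>R e) < r"
      using S(2) by (auto simp: T_def)
    moreover have "dist (x - (3 * d * real j) *\<^sub>R e) x = 3 * d * real j"
      using e d by (simp add: dist_norm)
    moreover have "3 * d * real j \<le> 1"
    proof -
      have "real j \<le> real J - 1" using that by linarith
      also have "\<dots> < 1 / (3 * d)" by (rule J)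
      finally show ?thesis using d by (simp add: field_simps)
    qed
    ultimately show "x \<in> ball x0 (r + 1)"
      using dist_triangle[of x0 x "x - (3 * d * real j) *\<^sub>R e"] by simp
  qed
  have "ennreal (real J) * emeasure lborel S = (\<Sum>j<J. emeasure lborel (T j))"
    by (simp add: T_emeasure ennreal_of_nat_eq_real_of_nat)
  also have "\<dots> = emeasure lborel (\<Union>j<J. T j)"
    using T_meas disj by (intro sum_emeasure) auto
  also have "\<dots> \<le> emeasure lborel (ball x0 (r + 1))"
    using sub by (intro emeasure_mono) auto
  also have "\<dots> = ennreal (measure lborel (ball x0 (r + 1)))"
    using emeasure_bounded_finite[OF bounded_ball] by (intro emeasure_eq_ennreal_measure) (auto simp: less_top)
  finally have le: "ennreal (real J) * emeasure lborel S \<le> ennreal (measure lborel (ball x0 (r + 1)))" .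
  have "emeasure lborel S \<le> ennreal (3 * d * real J) * emeasure lborel S"
  proof -
    have "1 \<le> 3 * d * real J" using J(1) d by (simp add: field_simps)
    then have "ennreal 1 * emeasure lborel S \<le> ennreal (3 * d * real J) * emeasure lborel S"
      by (intro mult_right_mono ennreal_leI) auto
    then show ?thesis by simp
  qed
  also have "\<dots> = ennreal (3 * d) * (ennreal (real J) * emeasure lborel S)"
    using d by (simp add: ennreal_mult mult.assoc)
  also have "\<dots> \<le> ennreal (3 * d) * ennreal (measure lborel (ball x0 (r + 1)))"
    by (rule mult_left_mono[OF le]) auto
  finally show ?thesis using d by (simp add: ennreal_mult)
qed

text \<open>With h the height above the graph, \<open>\<Omega>\<close> is locally {h > 0} and its
  frontier lies in {h = 0}. As h is Lipschitz, a \<delta>-neighbourhood of the frontier lies in a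
  thin level set, which gives the first claim. Moving from \<open>x0\<close> against
  \<open>e\<close> makes h negative, which gives the second.\<close>

lemma C11_boundary_local:
  fixes \<Omega> :: "'a::euclidean_space set"
  assumes \<Omega>: "open \<Omega>" "C11_boundary \<Omega>" and x0: "x0 \<in> frontier \<Omega>"
  shows "\<exists>r>0. \<exists>C\<ge>0. \<forall>\<delta>. 0 < \<delta> \<and> \<delta> < r \<longrightarrow>
      (\<exists>S\<in>sets borel. emeasure lborel S \<le> ennreal (C * \<delta>) \<and>
        {x. \<exists>y\<in>frontier \<Omega> \<inter> ball x0 r. dist x y < \<delta>} \<subseteq> S)" (is ?A)
    and "\<forall>\<eta>>0. \<exists>x. x \<notin> closure \<Omega> \<and> dist x0 x < \<eta>" (is ?B)
proof -
  obtain r e g where r: "r > 0" and e: "norm e = 1" and g: "C11_function g"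
    and eq: "\<Omega> \<inter> ball x0 r = {x \<in> ball x0 r. x \<bullet> e > g (x - (x \<bullet> e) *\<^sub>R e)}"
    using \<Omega>(2) x0 unfolding C11_boundary_def by blast
  define h where "h x = x \<bullet> e - g (x - (x \<bullet> e) *\<^sub>R e)" for x
  have ee: "e \<bullet> e = 1" using e by (simp add: norm_eq_1)
  have h_shift: "h (x + t *\<^sub>R e) = h x + t" for x t
    by (simp add: h_def ee algebra_simps)
  have g_cont: "continuous_on UNIV g"
    using g unfolding C11_function_def
    by (auto intro!: continuous_at_imp_continuous_on intro: has_derivative_continuous)
  have h_cont: "continuous_on UNIV h"
    unfolding h_def by (intro continuous_intros continuous_on_compose2[OF g_cont]) auto
  have h_meas [measurable]: "h \<in> borel_measurable borel"
    using h_cont by (rule borel_measurable_continuous_onI)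
  have in_\<Omega>: "x \<in> \<Omega> \<longleftrightarrow> h x > 0" if "x \<in> ball x0 r" for x
  proof -
    have "x \<in> \<Omega> \<inter> ball x0 r \<longleftrightarrow> x \<in> ball x0 r \<and> x \<bullet> e > g (x - (x \<bullet> e) *\<^sub>R e)"
      by (simp only: eq mem_Collect_eq)
    with that show ?thesis unfolding h_def by simp
  qed
  have outside: "x \<notin> closure \<Omega>" if "x \<in> ball x0 r" "h x < 0" for x
  proof -
    have "open (ball x0 r \<inter> {x. h x < 0})"
      by (intro open_Int open_ball open_Collect_less h_cont continuous_on_const)
    moreover have "ball x0 r \<inter> {x. h x < 0} \<inter> \<Omega> = {}" using in_\<Omega> by force
    ultimately have "ball x0 r \<inter> {x. h x < 0} \<inter> closure \<Omega> = {}"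
      by (simp add: open_Int_closure_eq_empty)
    with that show ?thesis by blast
  qed
  have h_frontier: "h y = 0" if "y \<in> frontier \<Omega>" "y \<in> ball x0 r" for y
  proof -
    have "y \<notin> \<Omega>" "y \<in> closure \<Omega>"
      using that(1) \<Omega>(1) by (auto simp: frontier_def interior_open)
    then show ?thesis using in_\<Omega>[OF that(2)] outside[OF that(2)] by force
  qed
  obtain G where G: "G \<ge> 0"
    "\<And>x y. norm x \<le> 2 * (norm x0 + r) \<Longrightarrow> norm y \<le> 2 * (norm x0 + r) \<Longrightarrow> \<bar>g x - g y\<bar> \<le> G * norm (x - y)"
    using C11_function_lipschitz_on_ball[OF g] by blast
  \<comment> \<open>The 1 is for the vertical coordinate; 2 G is for the graph function after the
    horizontal projection, whose norm \<open>perp\<close> bounds crudely by 2.\<close>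
  define L where "L = 1 + 2 * G"
  have perp: "norm (x - (x \<bullet> e) *\<^sub>R e) \<le> 2 * norm x" for x
    using norm_triangle_ineq4[of x "(x \<bullet> e) *\<^sub>R e"] Cauchy_Schwarz_ineq2[of x e] e by simp
  have h_lip: "\<bar>h x - h y\<bar> \<le> L * dist x y" if "x \<in> ball x0 r" "y \<in> ball x0 r" for x y
  proof -
    have n: "norm z \<le> norm x0 + r" if "z \<in> ball x0 r" for z
      using that norm_triangle_ineq2[of z x0] by (simp add: dist_norm norm_minus_commute)
    have "\<bar>g (x - (x \<bullet> e) *\<^sub>R e) - g (y - (y \<bullet> e) *\<^sub>R e)\<bar>
        \<le> G * norm ((x - (x \<bullet> e) *\<^sub>R e) - (y - (y \<bullet> e) *\<^sub>R e))"
      using perp[of x] perp[of y] n[OF that(1)] n[OF that(2)] by (intro G) auto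
    also have "(x - (x \<bullet> e) *\<^sub>R e) - (y - (y \<bullet> e) *\<^sub>R e) = (x - y) - ((x - y) \<bullet> e) *\<^sub>R e"
      by (simp add: algebra_simps)
    also have "G * norm \<dots> \<le> G * (2 * norm (x - y))"
      by (intro mult_left_mono perp G)
    finally have "\<bar>g (x - (x \<bullet> e) *\<^sub>R e) - g (y - (y \<bullet> e) *\<^sub>R e)\<bar> \<le> 2 * G * norm (x - y)"
      by simp
    moreover have "\<bar>x \<bullet> e - y \<bullet> e\<bar> \<le> norm (x - y)"
      using Cauchy_Schwarz_ineq2[of "x - y" e] e by (simp add: inner_diff_left)
    ultimately show ?thesis
      unfolding h_def L_def dist_norm by (simp add: distrib_right)
  qed
  have L: "L > 0" using G by (simp add: L_def)
  show ?A
  \<comment> \<open>Half the radius: a point closer than \<delta> < r / 2 to a point of the smaller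
    ball is still in \<open>ball x0 r\<close>, where h describes \<open>\<Omega>\<close>.\<close>
  proof (rule exI[of _ "r / 2"], rule conjI, simp add: r, rule exI[of _ "3 * L * measure lborel (ball x0 (r + 1))"],
      rule conjI, simp add: L less_imp_le, intro allI impI)
    fix \<delta> assume \<delta>: "0 < \<delta> \<and> \<delta> < r / 2"
    define S where "S = ball x0 r \<inter> {x. \<bar>h x\<bar> \<le> L * \<delta>}"
    show "\<exists>S\<in>sets borel. emeasure lborel S \<le> ennreal (3 * L * measure lborel (ball x0 (r + 1)) * \<delta>) \<and>
        {x. \<exists>y\<in>frontier \<Omega> \<inter> ball x0 (r / 2). dist x y < \<delta>} \<subseteq> S"
    proof (intro bexI[of _ S] conjI)
      show S_meas: "S \<in> sets borel" unfolding S_def by measurable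
      have "emeasure lborel S \<le> ennreal (3 * (L * \<delta>) * measure lborel (ball x0 (r + 1)))"
        by (rule emeasure_thin_level_set[OF e h_shift S_meas]) (use L \<delta> in \<open>auto simp: S_def\<close>)
      then show "emeasure lborel S \<le> ennreal (3 * L * measure lborel (ball x0 (r + 1)) * \<delta>)"
        by (simp add: mult_ac)
      show "{x. \<exists>y\<in>frontier \<Omega> \<inter> ball x0 (r / 2). dist x y < \<delta>} \<subseteq> S"
      proof safe
        fix x y assume y: "y \<in> frontier \<Omega>" "y \<in> ball x0 (r / 2)" "dist x y < \<delta>"
        have "x \<in> ball x0 r" "y \<in> ball x0 r"
          using y \<delta> r dist_triangle[of x0 x y] by (auto simp: dist_commute)
        moreover have "L * dist x y \<le> L * \<delta>" using y L by (intro mult_left_mono) auto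
        ultimately show "x \<in> S"
          using h_lip[of x y] h_frontier[OF y(1)] by (auto simp: S_def)
      qed
    qed
  qed
  show ?B
  proof (intro allI impI)
    fix \<eta> :: real assume "\<eta> > 0"
    define t where "t = min \<eta> r / 2"
    have t: "0 < t" "t < \<eta>" "t < r" using \<open>\<eta> > 0\<close> r by (auto simp: t_def)
    have d: "dist x0 (x0 + (- t) *\<^sub>R e) = t" using e t by (simp add: dist_norm)
    have "h (x0 + (- t) *\<^sub>R e) = - t"
      using h_shift[of x0 "- t"] h_frontier[OF x0] r by simp
    then have "x0 + (- t) *\<^sub>R e \<notin> closure \<Omega>"
      using d t by (intro outside) auto
    with d t show "\<exists>x. x \<notin> closure \<Omega> \<and> dist x0 x < \<eta>" by metis
  qed
qed

lemma boundary_layer_emeasure: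
  fixes \<Omega> :: "'a::euclidean_space set"
  assumes \<Omega>: "bounded_C11_domain \<Omega>"
  shows "\<exists>C\<ge>0. \<exists>\<delta>0>0. \<forall>\<delta>. 0 < \<delta> \<and> \<delta> < \<delta>0 \<longrightarrow>
    emeasure lborel {x \<in> \<Omega>. infdist x (- \<Omega>) < \<delta>} \<le> ennreal (C * \<delta>)"
proof -
  have op: "open \<Omega>" and b: "bounded \<Omega>" and C: "C11_boundary \<Omega>"
    using \<Omega> by (auto simp: bounded_C11_domain_def)
  have ne: "- \<Omega> \<noteq> {}" using b not_bounded_UNIV by (metis Compl_UNIV_eq double_compl)
  define P where "P x0 r c \<longleftrightarrow> (\<forall>\<delta>. 0 < \<delta> \<and> \<delta> < r \<longrightarrow>
      (\<exists>S\<in>sets borel. emeasure lborel S \<le> ennreal (c * \<delta>) \<and>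
        {x. \<exists>y\<in>frontier \<Omega> \<inter> ball x0 r. dist x y < \<delta>} \<subseteq> S))" for x0 r c
  have "\<forall>x0\<in>frontier \<Omega>. \<exists>r c. r > 0 \<and> c \<ge> 0 \<and> P x0 r c"
    unfolding P_def using C11_boundary_local(1)[OF op C] by blast
  then obtain r c where r: "\<And>x0. x0 \<in> frontier \<Omega> \<Longrightarrow> r x0 > 0" "\<And>x0. x0 \<in> frontier \<Omega> \<Longrightarrow> c x0 \<ge> 0"
    and P: "\<And>x0. x0 \<in> frontier \<Omega> \<Longrightarrow> P x0 (r x0) (c x0)"
    by metis
  note rc = r P[unfolded P_def, rule_format]
  have "compact (frontier \<Omega>)" by (rule compact_frontier_bounded[OF b])
  then obtain X where X: "X \<subseteq> frontier \<Omega>" "finite X" "frontier \<Omega> \<subseteq> (\<Union>x0\<in>X. ball x0 (r x0))"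
  proof (rule compactE_image[of _ "frontier \<Omega>" "\<lambda>x0. ball x0 (r x0)"])
    show "frontier \<Omega> \<subseteq> (\<Union>c\<in>frontier \<Omega>. ball c (r c))"
      using rc(1) by force
  qed auto
  \<comment> \<open>The 1 keeps the minimum meaningful if the cover is empty.\<close>
  define \<delta>0 where "\<delta>0 = Min (insert 1 (r ` X))"
  have \<delta>0: "\<delta>0 > 0" "\<And>x0. x0 \<in> X \<Longrightarrow> \<delta>0 \<le> r x0"
    using X rc(1) by (auto simp: \<delta>0_def Min_gr_iff)
  show ?thesis
  proof (rule exI[of _ "\<Sum>x0\<in>X. c x0"], rule conjI, goal_cases)
    case 1
    show "(\<Sum>x0\<in>X. c x0) \<ge> 0" using X rc(2) by (intro sum_nonneg) auto
  next
    case 2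
    show ?case
    proof (rule exI[of _ \<delta>0], intro conjI allI impI, rule \<delta>0)
      fix \<delta> assume \<delta>: "0 < \<delta> \<and> \<delta> < \<delta>0"
      define Q where "Q x0 S \<longleftrightarrow> emeasure lborel S \<le> ennreal (c x0 * \<delta>) \<and>
          {x. \<exists>y\<in>frontier \<Omega> \<inter> ball x0 (r x0). dist x y < \<delta>} \<subseteq> S" for x0 S
      have "\<exists>S\<in>sets borel. Q x0 S" if x0: "x0 \<in> X" for x0
        unfolding Q_def using x0 X(1) \<delta> \<delta>0(2)[OF x0] by (intro rc(3)) auto
      then obtain S where S: "\<And>x0. x0 \<in> X \<Longrightarrow> S x0 \<in> sets borel" and Q: "\<And>x0. x0 \<in> X \<Longrightarrow> Q x0 (S x0)"
        by metis
      note S = S Q[unfolded Q_def, THEN conjunct1] Q[unfolded Q_def, THEN conjunct2]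
      have "{x \<in> \<Omega>. infdist x (- \<Omega>) < \<delta>} \<subseteq> (\<Union>x0\<in>X. S x0)"
      proof safe
        fix x assume x: "x \<in> \<Omega>" "infdist x (- \<Omega>) < \<delta>"
        obtain y where y: "y \<in> frontier \<Omega>" "dist x y < \<delta>"
          using infdist_frontier_point[OF x ne] by blast
        then obtain x0 where "x0 \<in> X" "y \<in> ball x0 (r x0)" using X(3) by blast
        with y S(3)[of x0] show "x \<in> (\<Union>x0\<in>X. S x0)" by blast
      qed
      then have "emeasure lborel {x \<in> \<Omega>. infdist x (- \<Omega>) < \<delta>} \<le> emeasure lborel (\<Union>x0\<in>X. S x0)"
        using S X(2) by (intro emeasure_mono) auto
      also have "\<dots> \<le> (\<Sum>x0\<in>X. emeasure lborel (S x0))"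
        using S X(2) by (intro emeasure_subadditive_finite) auto
      also have "\<dots> \<le> (\<Sum>x0\<in>X. ennreal (c x0 * \<delta>))"
        by (intro sum_mono S)
      also have "\<dots> = ennreal (sum c X * \<delta>)"
        using X rc(2) \<delta> by (subst sum_ennreal) (auto simp: sum_distrib_right)
      finally show "emeasure lborel {x \<in> \<Omega>. infdist x (- \<Omega>) < \<delta>} \<le> ennreal (sum c X * \<delta>)" .
    qed
  qed
qed

text \<open>A frontier point would not do: \<open>v\<close> is known to vanish only outside the
  closure, so smallness of the low-frequency part is first obtained at points having a whole
  neighbourhood there. Such points come arbitrarily close to every frontier point.\<close>

lemma exterior_point_near_layer:
  fixes \<Omega> :: "'a::euclidean_space set"
  assumes \<Omega>: "bounded_C11_domain \<Omega>" and x: "x \<in> \<Omega>" "infdist x (- \<Omega>) < \<delta>"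
  obtains x0 where "x0 \<notin> closure \<Omega>" "dist x x0 < \<delta>"
proof -
  have op: "open \<Omega>" and b: "bounded \<Omega>" and C: "C11_boundary \<Omega>"
    using \<Omega> by (auto simp: bounded_C11_domain_def)
  have "- \<Omega> \<noteq> {}" using b not_bounded_UNIV by (metis Compl_UNIV_eq double_compl)
  then obtain y where y: "y \<in> frontier \<Omega>" "dist x y < \<delta>"
    using infdist_frontier_point[OF x] by blast
  then obtain x0 where "x0 \<notin> closure \<Omega>" "dist y x0 < \<delta> - dist x y"
    using C11_boundary_local(2)[OF op C y(1)] by (meson diff_gt_0_iff_gt)
  then show ?thesis using that dist_triangle[of x x0 y] by force
qed

section \<open>Cutoff functions and the fundamental lemma of the calculus of variations\<close>

lemma smooth_scale_const:
  fixes f :: "'a::euclidean_space \<Rightarrow> real"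
  assumes "smooth f"
  shows "smooth (\<lambda>y. c * f (y /\<^sub>R d))"
  using smooth_linear_affine[OF assms bounded_linear_mult_right, of c "inverse d" 0] by simp

lemma pd_scale:
  fixes f :: "'a::euclidean_space \<Rightarrow> real"
  assumes "smooth f"
  shows "pd e (\<lambda>y. c * f (y /\<^sub>R d)) y = c / d * pd e f (y /\<^sub>R d)"
proof -
  have "((\<lambda>y. f (y /\<^sub>R d)) has_derivative (\<lambda>h. pd (h /\<^sub>R d) f (y /\<^sub>R d))) (at y)"
    by (rule has_derivative_compose[OF _ smooth_has_derivative[OF assms]])
      (auto intro!: derivative_eq_intros)
  then have "((\<lambda>y. c * f (y /\<^sub>R d)) has_derivative (\<lambda>h. c * pd (h /\<^sub>R d) f (y /\<^sub>R d))) (at y)"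
    by (rule has_derivative_mult_right)
  from pd_eq[OF this, of e] have "pd e (\<lambda>y. c * f (y /\<^sub>R d)) y = c * pd (e /\<^sub>R d) f (y /\<^sub>R d)" .
  moreover have "pd (e /\<^sub>R d) f (y /\<^sub>R d) = pd e f (y /\<^sub>R d) /\<^sub>R d"
    by (rule linear_cmul[OF has_derivative_linear[OF smooth_has_derivative[OF assms]]])
  ultimately show "pd e (\<lambda>y. c * f (y /\<^sub>R d)) y = c / d * pd e f (y /\<^sub>R d)"
    by (simp add: divide_inverse mult_ac)
qed

lemma integral_scale:
  fixes f :: "'a::euclidean_space \<Rightarrow> real"
  assumes "integrable lborel f" "d > 0"
  shows "integrable lborel (\<lambda>y. c * f (y /\<^sub>R d))"
    and "(LINT y|lborel. c * f (y /\<^sub>R d)) = c * d ^ DIM('a) * (LINT y|lborel. f y)"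
    and "(LINT y|lborel. norm (c * f (y /\<^sub>R d))) = \<bar>c\<bar> * d ^ DIM('a) * (LINT y|lborel. \<bar>f y\<bar>)"
  using lborel_integrable_affine[OF assms(1), of "inverse d" 0] lborel_integral_affine[OF assms(1), of "inverse d" 0]
    lborel_integral_affine[OF integrable_abs[OF assms(1)], of "inverse d" 0] assms(2)
  by (auto simp: power_inverse abs_mult)

text \<open>The Littlewood-Paley bump also serves as mollifier: rescaled to integral one, it is
  supported in the ball of radius 2 d.\<close>

definition mollifier :: "('a::euclidean_space \<Rightarrow> real) \<Rightarrow> real \<Rightarrow> 'a \<Rightarrow> real" where
  "mollifier \<phi> d = (\<lambda>y. 1 / (d ^ DIM('a) * (LINT x|lborel. \<phi> x)) * \<phi> (y /\<^sub>R d))"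

lemma mollifier_props:
  fixes \<phi> :: "'a::euclidean_space \<Rightarrow> real"
  assumes \<phi>: "LP_bump \<phi>" and d: "d > 0"
  shows mollifier_test: "test_function UNIV (mollifier \<phi> d)"
    and mollifier_nonneg: "mollifier \<phi> d y \<ge> 0"
    and mollifier_eq_0: "norm y > 2 * d \<Longrightarrow> mollifier \<phi> d y = 0"
    and mollifier_integral: "(LINT y|lborel. mollifier \<phi> d y) = 1"
    and mollifier_integral_norm: "(LINT y|lborel. norm (mollifier \<phi> d y)) = 1"
    and mollifier_integral_pd: "(LINT y|lborel. norm (pd e (mollifier \<phi> d) y))
      = (LINT y|lborel. \<bar>pd e \<phi> y\<bar>) / (LINT y|lborel. \<phi> y) / d"
    and mollifier_integral_pd2: "e \<in> Basis \<Longrightarrow> (LINT y|lborel. norm (pd e' (pd e (mollifier \<phi> d)) y))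
      = (LINT y|lborel. \<bar>pd e' (pd e \<phi>) y\<bar>) / (LINT y|lborel. \<phi> y) / d\<^sup>2"
proof -
  note pos = LP_bump_integral_pos[OF \<phi>] and sm = LP_bump_smooth[OF \<phi>]
  note int = test_function_integrable[OF LP_bump_test_function[OF \<phi>]]
  show zero: "mollifier \<phi> d y = 0" if "norm y > 2 * d" for y
    using that d LP_bump_eq_0[OF \<phi>, of "y /\<^sub>R d"] by (simp add: mollifier_def field_simps)
  have "smooth (mollifier \<phi> d)"
    unfolding mollifier_def by (rule smooth_scale_const[OF sm])
  then show "test_function UNIV (mollifier \<phi> d)"
    by (rule test_functionI[of _ "cball 0 (2 * d)"]) (auto intro: zero)
  show nonneg: "mollifier \<phi> d y \<ge> 0" for y
    using pos d LP_bump_nonneg[OF \<phi>] by (simp add: mollifier_def)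
  show one: "(LINT y|lborel. mollifier \<phi> d y) = 1"
    unfolding mollifier_def integral_scale(2)[OF int d] using pos d by simp
  show "(LINT y|lborel. norm (mollifier \<phi> d y)) = 1"
    using one nonneg by simp
  have pdi: "integrable lborel (pd e \<phi>)" for e
  proof -
    have "integrable lborel (\<lambda>x. \<Sum>b\<in>Basis. (e \<bullet> b) *\<^sub>R pd b \<phi> x)"
      by (intro Bochner_Integration.integrable_sum integrable_scaleR_right
        test_function_integrable[OF test_function_pd[OF LP_bump_test_function[OF \<phi>]]])
    then show ?thesis by (subst smooth_pd_sum[OF sm])
  qed
  show "(LINT y|lborel. norm (pd e (mollifier \<phi> d) y)) = (LINT y|lborel. \<bar>pd e \<phi> y\<bar>) / (LINT y|lborel. \<phi> y) / d"
    unfolding mollifier_def pd_scale[OF sm] integral_scale(3)[OF pdi d] using pos d by simp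
  assume e: "e \<in> Basis"
  have pd2i: "integrable lborel (pd e' (pd e \<phi>))"
  proof -
    have "integrable lborel (\<lambda>x. \<Sum>b\<in>Basis. (e' \<bullet> b) *\<^sub>R pd b (pd e \<phi>) x)"
      by (intro Bochner_Integration.integrable_sum integrable_scaleR_right
        test_function_integrable[OF test_function_pd[OF test_function_pd[OF LP_bump_test_function[OF \<phi>] e]]])
    then show ?thesis by (subst smooth_pd_sum[OF smooth_pd[OF sm e]])
  qed
  show "(LINT y|lborel. norm (pd e' (pd e (mollifier \<phi> d)) y))
      = (LINT y|lborel. \<bar>pd e' (pd e \<phi>) y\<bar>) / (LINT y|lborel. \<phi> y) / d\<^sup>2"
    unfolding mollifier_def pd_scale[OF sm] pd_scale[OF smooth_pd[OF sm e]] integral_scale(3)[OF pd2i d]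
    using pos d by (simp add: power2_eq_square)
qed

text \<open>The margin 2 d is the support radius of the mollifier. The constant is a parameter so
  that one value can serve all \<open>A\<close> and \<open>d\<close>.\<close>

definition is_cutoff :: "real \<Rightarrow> 'a::euclidean_space set \<Rightarrow> real \<Rightarrow> ('a \<Rightarrow> real) \<Rightarrow> bool" where
  "is_cutoff C A d \<eta> \<longleftrightarrow> smooth \<eta> \<and> (\<forall>x. 0 \<le> \<eta> x \<and> \<eta> x \<le> 1) \<and>
     (\<forall>x. cball x (2 * d) \<subseteq> A \<longrightarrow> \<eta> x = 1) \<and> (\<forall>x. cball x (2 * d) \<inter> A = {} \<longrightarrow> \<eta> x = 0) \<and>
     (\<forall>x. \<forall>e\<in>Basis. \<bar>pd e \<eta> x\<bar> \<le> C / d) \<and>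
     (\<forall>x. \<forall>e\<in>Basis. \<forall>e'\<in>Basis. \<bar>pd e' (pd e \<eta>) x\<bar> \<le> C / d\<^sup>2)"

text \<open>The cutoff is the indicator of \<open>A\<close> correlated with the mollifier of scale
  \<open>d\<close>. Derivatives fall on the mollifier, and the L1 norms of its derivatives scale
  like 1 / d and 1 / d^2 whatever \<open>A\<close> is.\<close>

lemma cutoff_exists:
  fixes \<phi> :: "'a::euclidean_space \<Rightarrow> real"
  assumes \<phi>: "LP_bump \<phi>"
  shows "\<exists>C\<ge>0. \<forall>A d. bounded A \<longrightarrow> A \<in> sets borel \<longrightarrow> d > 0 \<longrightarrow> (\<exists>\<eta>::'a \<Rightarrow> real. is_cutoff C A d \<eta>)"
proof -
  let ?I = "LINT y|lborel. \<phi> y"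
  define C1 where "C1 = (\<Sum>e\<in>Basis. (LINT y|lborel. \<bar>pd e \<phi> y\<bar>) / ?I)"
  define C2 where "C2 = (\<Sum>e\<in>Basis. \<Sum>e'\<in>Basis. (LINT y|lborel. \<bar>pd e' (pd e \<phi>) y\<bar>) / ?I)"
  have I: "?I > 0" by (rule LP_bump_integral_pos[OF \<phi>])
  have nn: "C1 \<ge> 0" "C2 \<ge> 0"
    unfolding C1_def C2_def using I by (auto intro!: sum_nonneg)
  have "\<exists>\<eta>::'a \<Rightarrow> real. is_cutoff (C1 + C2) A d \<eta>"
    if A: "bounded A" "A \<in> sets borel" and d: "d > 0" for A :: "'a set" and d :: real
  proof -
    define f where "f = (indicator A :: 'a \<Rightarrow> real)"
    define \<eta> where "\<eta> = corr f (mollifier \<phi> d)"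
    note \<kappa> = mollifier_test[OF \<phi> d]
    note \<kappa>i = test_function_integrable[OF \<kappa>]
    have f: "integrable lborel f"
      unfolding f_def using A emeasure_bounded_finite[OF A(1)] by (intro integrable_real_indicator) auto
    have f_meas [measurable]: "f \<in> borel_measurable borel" using f by auto
    have f1: "AE y in lborel. norm (f y) \<le> 1" by (auto simp: f_def indicator_def)
    have f01: "0 \<le> f y" "f y \<le> 1" for y by (auto simp: f_def indicator_def)
    have pd1: "pd e \<eta> x = - corr f (pd e (mollifier \<phi> d)) x" for e x
      unfolding \<eta>_def using fun_cong[OF pd_corr[OF f \<kappa>]] .
    have pd2: "pd e' (pd e \<eta>) x = corr f (pd e' (pd e (mollifier \<phi> d))) x" if e: "e \<in> Basis" for e e' x
    proof -
      have "((\<lambda>x. - corr f (pd e (mollifier \<phi> d)) x) has_derivative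
          (\<lambda>h. - (- corr f (pd h (pd e (mollifier \<phi> d))) x))) (at x)"
        by (intro has_derivative_minus corr_test_has_derivative[OF f test_function_pd[OF \<kappa> e]])
      from pd_eq[OF this, of e'] show ?thesis unfolding pd1 by simp
    qed
    have int: "integrable lborel (\<lambda>y. f y * mollifier \<phi> d (y - x))" for x
    proof -
      obtain B where "\<And>x. norm (mollifier \<phi> d x) \<le> B" using test_function_bounded[OF \<kappa>] by blast
      then show ?thesis by (rule corr_integrand_integrable[OF f test_function_measurable[OF \<kappa>]])
    qed
    have ones: "(LINT y|lborel. mollifier \<phi> d (y - x)) = 1" for x
      using lborel_integral_translate_minus[OF \<kappa>i] mollifier_integral[OF \<phi> d] by simp
    have near: "norm (y - x) \<le> 2 * d" if "mollifier \<phi> d (y - x) \<noteq> 0" for x y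
      using that mollifier_eq_0[OF \<phi> d, of "y - x"] by force
    show ?thesis
      unfolding is_cutoff_def
    proof (intro exI[of _ \<eta>] conjI allI impI ballI)
      show "smooth \<eta>" unfolding \<eta>_def by (rule smooth_corr[OF f \<kappa>])
      fix x
      show "0 \<le> \<eta> x"
        unfolding \<eta>_def corr_def using f01 mollifier_nonneg[OF \<phi> d] by (intro integral_nonneg_AE) auto
      have "\<eta> x \<le> (LINT y|lborel. mollifier \<phi> d (y - x))"
        unfolding \<eta>_def corr_def
      proof (rule integral_mono[OF int lborel_integrable_translate_minus[OF \<kappa>i]])
        show "f y * mollifier \<phi> d (y - x) \<le> mollifier \<phi> d (y - x)" for y
          using f01 mollifier_nonneg[OF \<phi> d] by (intro mult_left_le_one_le) auto
      qed
      then show "\<eta> x \<le> 1" by (simp add: ones)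
      show "\<eta> x = 1" if sub: "cball x (2 * d) \<subseteq> A"
      proof -
        have "f y * mollifier \<phi> d (y - x) = mollifier \<phi> d (y - x)" for y
        proof (cases "mollifier \<phi> d (y - x) = 0")
          case False
          then have "y \<in> A" using near[of y x] sub by (auto simp: dist_norm norm_minus_commute)
          then show ?thesis by (simp add: f_def)
        qed simp
        then show ?thesis unfolding \<eta>_def corr_def by (simp only: ones)
      qed
      show "\<eta> x = 0" if disj: "cball x (2 * d) \<inter> A = {}"
      proof -
        have "f y * mollifier \<phi> d (y - x) = 0" for y
        proof (cases "mollifier \<phi> d (y - x) = 0")
          case False
          then have "y \<notin> A" using near[of y x] disj by (auto simp: dist_norm norm_minus_commute)
          then show ?thesis by (simp add: f_def)
        qed simp
        then show ?thesis unfolding \<eta>_def corr_def by (simp only: integral_zero)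
      qed
      fix e :: 'a assume e: "e \<in> Basis"
      have "\<bar>pd e \<eta> x\<bar> \<le> 1 * (LINT y|lborel. norm (pd e (mollifier \<phi> d) y))"
        using corr_bounded[OF f_meas f1 test_function_integrable[OF test_function_pd[OF \<kappa> e]], of x]
        by (simp add: pd1)
      also have "\<dots> = (LINT y|lborel. \<bar>pd e \<phi> y\<bar>) / ?I / d"
        using mollifier_integral_pd[OF \<phi> d] by simp
      also have "(LINT y|lborel. \<bar>pd e \<phi> y\<bar>) / ?I \<le> C1"
        unfolding C1_def using e I by (intro member_le_sum) auto
      finally show "\<bar>pd e \<eta> x\<bar> \<le> (C1 + C2) / d"
        using d nn by (auto simp: divide_right_mono intro: order_trans)
      fix e' :: 'a assume e': "e' \<in> Basis"
      have "\<bar>pd e' (pd e \<eta>) x\<bar> \<le> 1 * (LINT y|lborel. norm (pd e' (pd e (mollifier \<phi> d)) y))"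
        using corr_bounded[OF f_meas f1 test_function_integrable[OF test_function_pd[OF test_function_pd[OF \<kappa> e] e']], of x]
        by (simp add: pd2[OF e])
      also have "\<dots> = (LINT y|lborel. \<bar>pd e' (pd e \<phi>) y\<bar>) / ?I / d\<^sup>2"
        using mollifier_integral_pd2[OF \<phi> d e] by simp
      also have "(LINT y|lborel. \<bar>pd e' (pd e \<phi>) y\<bar>) / ?I \<le> (\<Sum>e'\<in>Basis. (LINT y|lborel. \<bar>pd e' (pd e \<phi>) y\<bar>) / ?I)"
        using e' I by (intro member_le_sum) auto
      also have "\<dots> \<le> C2"
        unfolding C2_def using e I
        by (intro member_le_sum[where f = "\<lambda>e. \<Sum>e'\<in>Basis. (LINT y|lborel. \<bar>pd e' (pd e \<phi>) y\<bar>) / ?I"])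
          (auto intro!: sum_nonneg)
      finally show "\<bar>pd e' (pd e \<eta>) x\<bar> \<le> (C1 + C2) / d\<^sup>2"
        using d nn by (auto simp: divide_right_mono intro: order_trans)
    qed
  qed
  with nn show ?thesis by (intro exI[of _ "C1 + C2"]) auto
qed

text \<open>Cutoffs converging to the indicator of a compact set show that \<open>f\<close> has
  integral zero over every compact set. A compact set on which \<open>f\<close> has one strict sign
  is therefore null, and inner regularity makes {f > 0} and {f < 0} null.\<close>

lemma AE_zero_of_test_pairings:
  fixes f :: "'a::euclidean_space \<Rightarrow> real"
  assumes \<phi>: "LP_bump (\<phi> :: 'a \<Rightarrow> real)" and f: "f \<in> borel_measurable borel"
    and loc: "\<And>S. compact S \<Longrightarrow> set_integrable lborel S f"
    and test: "\<And>\<zeta>. test_function UNIV \<zeta> \<Longrightarrow> (LINT x|lborel. f x * \<zeta> x) = 0"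
  shows "AE x in lborel. f x = 0"
proof -
  have compact_zero: "(LINT x:K|lborel. f x) = 0" if K: "compact K" for K
  proof (cases "K = {}")
    case False
    define d where "d i = inverse (real (Suc i))" for i
    have d: "d i > 0" "d i \<le> 1" for i by (auto simp: d_def field_simps)
    obtain C where C: "\<And>A d. bounded A \<Longrightarrow> A \<in> sets borel \<Longrightarrow> d > 0 \<Longrightarrow> \<exists>\<eta>::'a \<Rightarrow> real. is_cutoff C A d \<eta>"
      using cutoff_exists[OF \<phi>] by blast
    define Q where "Q \<eta> i \<longleftrightarrow> smooth \<eta> \<and> (\<forall>x. 0 \<le> \<eta> x \<and> \<eta> x \<le> 1) \<and> (\<forall>x\<in>K. \<eta> x = 1) \<and>
        (\<forall>x. infdist x K > 4 * d i \<longrightarrow> \<eta> x = 0)" for \<eta> :: "'a \<Rightarrow> real" and i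
    have "\<exists>\<eta>. Q \<eta> i" for i
    proof -
      \<comment> \<open>The enlargement 2 d and the cutoff margin 2 d together make the cutoff 1 on
        \<open>K\<close> and 0 beyond distance 4 d.\<close>
      let ?A = "{x. infdist x K \<le> 2 * d i}"
      have A: "compact ?A" using K False d by (intro compact_infdist_le) auto
      have in_A: "cball x (2 * d i) \<subseteq> ?A" if "x \<in> K" for x
        using infdist_le2[OF that] by (auto simp: dist_commute)
      have out_A: "cball x (2 * d i) \<inter> ?A = {}" if "infdist x K > 4 * d i" for x
      proof -
        have False if "dist x y \<le> 2 * d i" "infdist y K \<le> 2 * d i" for y
          using infdist_triangle[of x K y] that \<open>infdist x K > 4 * d i\<close> by linarith
        then show ?thesis by auto
      qed
      obtain \<eta> :: "'a \<Rightarrow> real" where "is_cutoff C ?A (d i) \<eta>"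
        using C[OF compact_imp_bounded[OF A] borel_compact[OF A] d(1)[of i]] by blast
      then have "Q \<eta> i" unfolding Q_def is_cutoff_def using in_A out_A by simp
      then show ?thesis by blast
    qed
    then obtain \<eta> :: "nat \<Rightarrow> 'a \<Rightarrow> real" where Q: "\<And>i. Q (\<eta> i) i" by metis
    have \<eta>: "\<And>i. smooth (\<eta> i)" "\<And>i x. 0 \<le> \<eta> i x \<and> \<eta> i x \<le> 1"
      "\<And>i x. x \<in> K \<Longrightarrow> \<eta> i x = 1" "\<And>i x. infdist x K > 4 * d i \<Longrightarrow> \<eta> i x = 0"
      using Q unfolding Q_def by blast+
    \<comment> \<open>As \<open>d i\<close> is at most 1, this one compact set contains the supports
      of all the cutoffs and carries the dominating function.\<close>
    have S: "compact {x. infdist x K \<le> 4}" using K False by (intro compact_infdist_le) auto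
    have \<eta>_out: "\<eta> i x = 0" if "infdist x K > 4" for i x
      using d(2)[of i] that by (intro \<eta>(4)) auto
    have "test_function UNIV (\<eta> i)" for i
      by (rule test_functionI[OF \<eta>(1) S]) (auto intro!: \<eta>_out)
    then have zero: "(LINT x|lborel. f x * \<eta> i x) = 0" for i by (rule test)
    have \<eta>_meas: "\<eta> i \<in> borel_measurable borel" for i
      by (intro borel_measurable_continuous_onI smooth_continuous \<eta>)
    have "(\<lambda>i. LINT x|lborel. f x * \<eta> i x) \<longlonglongrightarrow> (LINT x|lborel. indicator K x *\<^sub>R f x)"
    proof (rule integral_dominated_convergence[where w = "\<lambda>x. norm (indicator {x. infdist x K \<le> 4} x *\<^sub>R f x)"])
      show "integrable lborel (\<lambda>x. norm (indicator {x. infdist x K \<le> 4} x *\<^sub>R f x))"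
        using loc[OF S] unfolding set_integrable_def by (rule integrable_norm)
      show "AE x in lborel. (\<lambda>i. f x * \<eta> i x) \<longlonglongrightarrow> indicator K x *\<^sub>R f x"
      proof (intro AE_I2)
        fix x
        show "(\<lambda>i. f x * \<eta> i x) \<longlonglongrightarrow> indicator K x *\<^sub>R f x"
        proof (cases "x \<in> K")
          case True
          then show ?thesis by (simp add: \<eta>(3))
        next
          case out: False
          then have "infdist x K > 0"
            using K False by (metis compact_imp_closed in_closed_iff_infdist_zero infdist_nonneg less_eq_real_def)
          then have "eventually (\<lambda>i. d i < infdist x K / 4) sequentially"
            unfolding d_def by (intro order_tendstoD[OF LIMSEQ_inverse_real_of_nat]) auto
          then have "eventually (\<lambda>i. f x * \<eta> i x = indicator K x *\<^sub>R f x) sequentially"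
            by eventually_elim (use out in \<open>simp add: \<eta>(4)\<close>)
          then show ?thesis by (rule tendsto_eventually)
        qed
      qed
      show "AE x in lborel. norm (f x * \<eta> i x) \<le> norm (indicator {x. infdist x K \<le> 4} x *\<^sub>R f x)" for i
      proof (intro AE_I2)
        fix x
        show "norm (f x * \<eta> i x) \<le> norm (indicator {x. infdist x K \<le> 4} x *\<^sub>R f x)"
          using \<eta>(2)[of i x] \<eta>_out[of x i] mult_left_le[of "\<eta> i x" "\<bar>f x\<bar>"]
          by (cases "infdist x K \<le> 4") (auto simp: abs_mult)
      qed
    qed (use f \<eta>_meas K in \<open>auto intro!: borel_measurable_times borel_measurable_indicator simp: borel_compact\<close>)
    then have "(\<lambda>i::nat. 0) \<longlonglongrightarrow> (LINT x|lborel. indicator K x *\<^sub>R f x)"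
      unfolding zero .
    then show ?thesis
      unfolding set_lebesgue_integral_def using LIMSEQ_unique tendsto_const by blast
  qed (simp add: set_lebesgue_integral_def)
  have null: "S \<in> null_sets lborel"
    if S: "S \<in> sets borel" "bounded S" and sgn: "(\<forall>x\<in>S. f x > 0) \<or> (\<forall>x\<in>S. f x < 0)" for S
  proof -
    have "emeasure lborel S \<le> 0 + ennreal e" if e: "e > 0" for e
    proof -
      have "S \<in> sets lebesgue" using S by auto
      then obtain T where T: "closed T" "T \<subseteq> S" "S - T \<in> lmeasurable" "emeasure lebesgue (S - T) < ennreal e"
        using sets_lebesgue_inner_closed[OF _ e] by metis
      have K: "compact T"
        using T S by (meson bounded_subset compact_eq_bounded_closed)
      have Ts: "T \<in> sets borel" using T by auto
      have int: "integrable lborel (\<lambda>x. indicator T x *\<^sub>R f x)"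
        using loc[OF K] by (simp add: set_integrable_def)
      have "AE x in lborel. indicator T x *\<^sub>R f x = 0"
      proof (cases "\<forall>x\<in>S. f x > 0")
        case True
        then show ?thesis
          using compact_zero[OF K] T(2) int unfolding set_lebesgue_integral_def
          by (subst (asm) integral_nonneg_eq_0_iff_AE) (auto simp: indicator_def less_imp_le subset_iff)
      next
        case False
        then have "AE x in lborel. - (indicator T x *\<^sub>R f x) = 0"
          using compact_zero[OF K] T(2) int sgn unfolding set_lebesgue_integral_def
          by (subst integral_nonneg_eq_0_iff_AE[symmetric]) (auto simp: indicator_def less_imp_le subset_iff)
        then show ?thesis by simp
      qed
      then have "AE x in lborel. x \<notin> T"
        by eventually_elim (use T(2) sgn in \<open>force simp: indicator_def\<close>)
      then have "emeasure lborel T = 0"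
        using Ts AE_iff_null_sets[of T lborel] by (auto simp: null_sets_def)
      moreover have "emeasure lborel S \<le> emeasure lborel T + emeasure lborel (S - T)"
        using emeasure_subadditive[of T lborel "S - T"] T(2) Ts S(1) by (simp add: Un_absorb1 Un_absorb2)
      moreover have "emeasure lborel (S - T) \<le> ennreal e"
        using T(4) Ts S(1) by (simp add: less_imp_le)
      ultimately show ?thesis by (metis add_mono dual_order.trans order_refl)
    qed
    then have "emeasure lborel S \<le> 0"
      by (rule ennreal_le_epsilon) auto
    then show ?thesis using S(1) by auto
  qed
  have meas: "{x \<in> ball 0 r. f x > 0} \<in> sets borel" "{x \<in> ball 0 r. f x < 0} \<in> sets borel" for r
  proof -
    have "f -` {0<..} \<inter> ball 0 r \<in> sets borel" "f -` {..<0} \<inter> ball 0 r \<in> sets borel"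
      using measurable_sets_borel[OF f, of "{0<..}"] measurable_sets_borel[OF f, of "{..<0}"] by auto
    moreover have "{x \<in> ball 0 r. f x > 0} = f -` {0<..} \<inter> ball 0 r" "{x \<in> ball 0 r. f x < 0} = f -` {..<0} \<inter> ball 0 r"
      by auto
    ultimately show "{x \<in> ball 0 r. f x > 0} \<in> sets borel" "{x \<in> ball 0 r. f x < 0} \<in> sets borel"
      by simp_all
  qed
  have "{x \<in> ball 0 (real n). f x > 0} \<union> {x \<in> ball 0 (real n). f x < 0} \<in> null_sets lborel" for n
  proof (intro null_sets.Un null meas)
    show "bounded {x \<in> ball 0 (real n). f x > 0}" "bounded {x \<in> ball 0 (real n). f x < 0}"
      by (rule bounded_subset[OF bounded_ball[of 0 "real n"]], blast)+
  qed auto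
  then have "(\<Union>n::nat. {x \<in> ball 0 (real n). f x > 0} \<union> {x \<in> ball 0 (real n). f x < 0}) \<in> null_sets lborel"
    by (rule null_sets_UN)
  moreover have "{x. f x \<noteq> 0} \<subseteq> (\<Union>n::nat. {x \<in> ball 0 (real n). f x > 0} \<union> {x \<in> ball 0 (real n). f x < 0})"
    using reals_Archimedean2 by (fastforce simp: neq_iff)
  ultimately show ?thesis
    by (intro AE_I') auto
qed

section \<open>Littlewood-Paley kernels and Bernstein's inequality\<close>

text \<open>Summability of the norms gives absolute convergence a.e. What is recorded about the sum,
  its norm and its integrals against bounded functions, is what \<open>pd_V_L1\<close> takes to
  identify and estimate it.\<close>

lemma integral_series_L1:
  fixes e :: "nat \<Rightarrow> 'a \<Rightarrow> real"
  assumes e: "\<And>j. integrable M (e j)" and sum: "summable (\<lambda>j. LINT x|M. \<bar>e j x\<bar>)"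
  obtains S where "integrable M S" "(LINT x|M. \<bar>S x\<bar>) \<le> (\<Sum>j. LINT x|M. \<bar>e j x\<bar>)"
    "\<And>(\<zeta> :: 'a \<Rightarrow> real) B. \<zeta> \<in> borel_measurable M \<Longrightarrow> (\<And>x. \<bar>\<zeta> x\<bar> \<le> B) \<Longrightarrow> (\<lambda>j. LINT x|M. e j x * \<zeta> x) sums (LINT x|M. S x * \<zeta> x)"
proof -
  have [measurable]: "e j \<in> borel_measurable M" for j using e by auto
  have nn: "(\<integral>\<^sup>+x. ennreal \<bar>e j x\<bar> \<partial>M) = ennreal (LINT x|M. \<bar>e j x\<bar>)" for j
    using e by (intro nn_integral_eq_integral) auto
  have "(\<integral>\<^sup>+x. (\<Sum>j. ennreal \<bar>e j x\<bar>) \<partial>M) = (\<Sum>j. ennreal (LINT x|M. \<bar>e j x\<bar>))"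
    by (subst nn_integral_suminf) (auto simp: nn)
  also have "\<dots> = ennreal (\<Sum>j. LINT x|M. \<bar>e j x\<bar>)"
    using sum by (intro suminf_ennreal2) auto
  finally have "(\<integral>\<^sup>+x. (\<Sum>j. ennreal \<bar>e j x\<bar>) \<partial>M) \<noteq> \<infinity>" by simp
  then have "AE x in M. (\<Sum>j. ennreal \<bar>e j x\<bar>) \<noteq> \<infinity>"
    by (intro nn_integral_PInf_AE) auto
  then have AE: "AE x in M. summable (\<lambda>j. \<bar>e j x\<bar>)"
    by eventually_elim (auto intro: summable_suminf_not_top)
  define S where "S x = (\<Sum>j. e j x)" for x
  have S: "integrable M S"
    unfolding S_def using AE sum by (intro integrable_suminf e) auto
  show thesis
  proof (rule that[OF S])
    have "(LINT x|M. \<bar>S x\<bar>) \<le> (LINT x|M. (\<Sum>j. \<bar>e j x\<bar>))"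
    proof (rule integral_mono_AE)
      show "integrable M (\<lambda>x. \<Sum>j. \<bar>e j x\<bar>)"
        using AE sum e by (intro integrable_suminf) auto
      show "AE x in M. \<bar>S x\<bar> \<le> (\<Sum>j. \<bar>e j x\<bar>)"
        using AE by eventually_elim (auto simp: S_def intro: summable_rabs)
    qed (use S in auto)
    also have "\<dots> = (\<Sum>j. LINT x|M. \<bar>e j x\<bar>)"
      using AE sum e by (intro integral_suminf) auto
    finally show "(LINT x|M. \<bar>S x\<bar>) \<le> (\<Sum>j. LINT x|M. \<bar>e j x\<bar>)" .
    fix \<zeta> :: "'a \<Rightarrow> real" and B assume \<zeta>: "\<zeta> \<in> borel_measurable M" "\<And>x. \<bar>\<zeta> x\<bar> \<le> B"
    have int: "integrable M (\<lambda>x. e j x * \<zeta> x)" for j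
      using \<zeta> by (intro integrable_mult_bounded[OF e, where B = B]) auto
    have "(\<lambda>j. LINT x|M. e j x * \<zeta> x) sums (LINT x|M. (\<Sum>j. e j x * \<zeta> x))"
    proof (rule sums_integral[OF int])
      show "AE x in M. summable (\<lambda>j. norm (e j x * \<zeta> x))"
        using AE by eventually_elim (auto simp: abs_mult intro: summable_mult2)
      show "summable (\<lambda>j. LINT x|M. norm (e j x * \<zeta> x))"
      proof (rule summable_comparison_test'[OF summable_mult[OF sum, of B]])
        show "norm (LINT x|M. norm (e j x * \<zeta> x)) \<le> B * (LINT x|M. \<bar>e j x\<bar>)" for j
        proof -
          have "(LINT x|M. norm (e j x * \<zeta> x)) \<le> (LINT x|M. B * \<bar>e j x\<bar>)"
            using e \<zeta>(2) by (intro integral_mono integrable_norm[OF int])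
              (auto simp: abs_mult mult.commute[of B] intro!: mult_left_mono)
          then show ?thesis by simp
        qed
      qed
    qed
    moreover have "(LINT x|M. (\<Sum>j. e j x * \<zeta> x)) = (LINT x|M. S x * \<zeta> x)"
    proof (rule integral_cong_AE)
      show "AE x in M. (\<Sum>j. e j x * \<zeta> x) = S x * \<zeta> x"
        using AE by eventually_elim (auto simp: S_def intro!: suminf_mult2[symmetric] intro: summable_rabs_cancel)
      show "(\<lambda>x. \<Sum>j. e j x * \<zeta> x) \<in> borel_measurable M"
        using \<zeta>(1) by measurable
    qed (use S \<zeta> in auto)
    ultimately show "(\<lambda>j. LINT x|M. e j x * \<zeta> x) sums (LINT x|M. S x * \<zeta> x)" by simp
  qed
qed

text \<open>The kernel of the multiplier with symbol p(k) \<phi>(k / N), where \<open>p\<close> is 1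
  for the low-frequency part and a polynomial for its derivatives. Dividing by
  \<open>LP_const\<close> gives integral one for p = 1; the real part keeps correlations with real
  functions real.\<close>

definition LP_kernel :: "('a::euclidean_space \<Rightarrow> real) \<Rightarrow> ('a \<Rightarrow> complex) \<Rightarrow> real \<Rightarrow> 'a \<Rightarrow> real" where
  "LP_kernel \<phi> p N y = Re (fourier (\<lambda>k. p k * of_real (\<phi> (k /\<^sub>R N))) y / LP_const \<phi>)"

lemma Re_of_real_mult_divide: "Re (of_real r * z / w) = r * Re (z / w)"
  by (simp add: times_divide_eq_right[symmetric] del: times_divide_eq_right)

lemma bounded_linear_Re_divide: "bounded_linear (\<lambda>z. Re (z / c))"
  by (intro bounded_linear_compose[OF bounded_linear_Re] bounded_linear_divide)

context
  fixes \<phi> :: "'a::euclidean_space \<Rightarrow> real" and p :: "'a \<Rightarrow> complex" and N :: real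
  assumes \<phi>: "LP_bump \<phi>" and p: "smooth p" and N: "N > 0"
begin

lemma LP_kernel_multiplier: "test_function UNIV (\<lambda>k. p k * of_real (\<phi> (k /\<^sub>R N)))"
proof (rule test_function_mult_left[OF p])
  have "smooth (\<lambda>k. complex_of_real (\<phi> (k /\<^sub>R N)))"
    using smooth_linear_affine[OF LP_bump_smooth[OF \<phi>] bounded_linear_of_real, of "inverse N" 0] by simp
  then show "test_function UNIV (\<lambda>k. complex_of_real (\<phi> (k /\<^sub>R N)))"
    by (rule test_functionI[of _ "cball 0 (2 * N)"])
      (use N in \<open>auto intro!: LP_bump_eq_0[OF \<phi>] simp: field_simps\<close>)
qed

lemma smooth_LP_kernel: "smooth (LP_kernel \<phi> p N)"
  unfolding LP_kernel_def
  by (rule smooth_linear[OF smooth_fourier[OF LP_kernel_multiplier] bounded_linear_Re_divide])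

lemma pd_LP_kernel: "pd h (LP_kernel \<phi> p N) y = LP_kernel \<phi> (\<lambda>k. - \<i> * of_real (k \<bullet> h) * p k) N y"
proof -
  have "(LP_kernel \<phi> p N has_derivative
     (\<lambda>h. Re (fourier (\<lambda>k. - \<i> * of_real (k \<bullet> h) * (p k * of_real (\<phi> (k /\<^sub>R N)))) y / LP_const \<phi>))) (at y)"
    unfolding LP_kernel_def
    by (rule bounded_linear.has_derivative[OF bounded_linear_Re_divide fourier_test_has_derivative[OF LP_kernel_multiplier]])
  from pd_eq[OF this, of h] show ?thesis
    by (simp add: LP_kernel_def mult_ac)
qed

lemma LP_kernel_integrable: "integrable lborel (LP_kernel \<phi> p N)"
  unfolding LP_kernel_def
  by (rule integrable_bounded_linear[OF bounded_linear_Re_divide fourier_integrable[OF LP_kernel_multiplier]])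

lemma LP_kernel_moment_integrable: "integrable lborel (\<lambda>y. norm y * norm (LP_kernel \<phi> p N y))"
proof -
  let ?F = "fourier (\<lambda>k. p k * of_real (\<phi> (k /\<^sub>R N)))"
  have "integrable lborel (\<lambda>y. norm y * norm (?F y) / norm (LP_const \<phi>))"
    using fourier_moment_integrable[OF LP_kernel_multiplier, of 1] by simp
  then show ?thesis
  proof (rule Bochner_Integration.integrable_bound)
    show "AE y in lborel. norm (norm y * norm (LP_kernel \<phi> p N y)) \<le> norm (norm y * norm (?F y) / norm (LP_const \<phi>))"
    proof (intro AE_I2)
      fix y :: 'a
      have "norm (LP_kernel \<phi> p N y) \<le> norm (?F y) / norm (LP_const \<phi>)"
        unfolding LP_kernel_def real_norm_def norm_divide[symmetric] by (rule abs_Re_le_cmod)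
      from mult_left_mono[OF this, of "norm y"]
      show "norm (norm y * norm (LP_kernel \<phi> p N y)) \<le> norm (norm y * norm (?F y) / norm (LP_const \<phi>))"
        by (simp add: abs_mult)
    qed
  qed (use LP_kernel_integrable in auto)
qed

lemma LP_kernel_bounded: "\<exists>B. \<forall>y. norm (LP_kernel \<phi> p N y) \<le> B"
proof -
  let ?g = "\<lambda>k. p k * of_real (\<phi> (k /\<^sub>R N))"
  have "norm (LP_kernel \<phi> p N y) \<le> (LINT x|lborel. norm (?g x)) / norm (LP_const \<phi>)" for y
  proof -
    have "norm (LP_kernel \<phi> p N y) \<le> norm (fourier ?g y) / norm (LP_const \<phi>)"
      unfolding LP_kernel_def real_norm_def norm_divide[symmetric] by (rule abs_Re_le_cmod)
    also have "\<dots> \<le> (LINT x|lborel. norm (?g x)) / norm (LP_const \<phi>)"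
      by (intro divide_right_mono fourier_bound test_function_integrable[OF LP_kernel_multiplier]) auto
    finally show ?thesis .
  qed
  then show ?thesis by blast
qed

lemma fourier_LP_multiplier_scale:
  assumes hom: "\<And>a k. a > 0 \<Longrightarrow> p (a *\<^sub>R k) = of_real (a ^ d) * p k"
  shows "fourier (\<lambda>k. p k * of_real (\<phi> (k /\<^sub>R N))) y
    = of_real (N ^ (DIM('a) + d)) * fourier (\<lambda>k. p k * of_real (\<phi> k)) (N *\<^sub>R y)"
proof -
  have int: "integrable lborel (\<lambda>k. p k * of_real (\<phi> k))"
    by (rule test_function_integrable[OF test_function_mult_left[OF p LP_bump_complex[OF \<phi>]]])
  have "p k = of_real (N ^ d) * p (k /\<^sub>R N)" for k
    using hom[of N "k /\<^sub>R N"] N by simp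
  then have "fourier (\<lambda>k. p k * of_real (\<phi> (k /\<^sub>R N))) y
      = fourier (\<lambda>k. of_real (N ^ d) * (p (k /\<^sub>R N) * of_real (\<phi> (k /\<^sub>R N)))) y"
    by (metis mult.assoc)
  also have "\<dots> = of_real (N ^ d) * fourier (\<lambda>k. p (k /\<^sub>R N) * of_real (\<phi> (k /\<^sub>R N))) y"
    unfolding fourier_def by (simp add: mult.left_commute[of _ "of_real (N ^ d)"] del: of_real_power)
  also have "\<dots> = of_real (N ^ d) * (of_real (N ^ DIM('a)) * fourier (\<lambda>k. p k * of_real (\<phi> k)) (N *\<^sub>R y))"
    using fourier_scale[OF int N] by simp
  finally show ?thesis by (simp add: power_add mult_ac)
qed

lemma LP_kernel_scale:
  assumes hom: "\<And>a k. a > 0 \<Longrightarrow> p (a *\<^sub>R k) = of_real (a ^ d) * p k"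
  shows "LP_kernel \<phi> p N y = N ^ (DIM('a) + d) * LP_kernel \<phi> p 1 (N *\<^sub>R y)"
proof -
  have "fourier (\<lambda>k. p k * of_real (\<phi> (k /\<^sub>R N))) y
      = of_real (N ^ (DIM('a) + d)) * fourier (\<lambda>k. p k * of_real (\<phi> k)) (N *\<^sub>R y)"
    by (rule fourier_LP_multiplier_scale[OF hom])
  then have "LP_kernel \<phi> p N y = Re (of_real (N ^ (DIM('a) + d)) * fourier (\<lambda>k. p k * of_real (\<phi> k)) (N *\<^sub>R y) / LP_const \<phi>)"
    unfolding LP_kernel_def by (simp only:)
  then show ?thesis
    unfolding Re_of_real_mult_divide by (simp add: LP_kernel_def)
qed

end

text \<open>For \<open>p\<close> homogeneous of degree \<open>d\<close> the kernel is N^(n + d)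
  times a fixed kernel at N y. The substitution removes N^n, and the weight |y| brings a further 1 /
  N.\<close>

lemma LP_kernel_integral_norm:
  fixes \<phi> :: "'a::euclidean_space \<Rightarrow> real"
  assumes \<phi>: "LP_bump \<phi>" and p: "smooth p" and N: "N > 0"
    and hom: "\<And>a k. a > 0 \<Longrightarrow> p (a *\<^sub>R k) = of_real (a ^ d) * p k"
  shows "(LINT y|lborel. norm (LP_kernel \<phi> p N y)) = N ^ d * (LINT y|lborel. norm (LP_kernel \<phi> p 1 y))"
    and "(LINT y|lborel. norm y * norm (LP_kernel \<phi> p N y)) = N ^ d / N * (LINT y|lborel. norm y * norm (LP_kernel \<phi> p 1 y))"
proof -
  note sc = LP_kernel_scale[OF \<phi> p N hom]
  have "(LINT y|lborel. norm (LP_kernel \<phi> p 1 (N *\<^sub>R y))) = (LINT y|lborel. norm (LP_kernel \<phi> p 1 y)) / N ^ DIM('a)"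
    using lborel_integral_affine[OF integrable_norm[OF LP_kernel_integrable[OF \<phi> p, of 1]], of N 0] N
    by (simp add: divide_inverse mult_ac)
  then show "(LINT y|lborel. norm (LP_kernel \<phi> p N y)) = N ^ d * (LINT y|lborel. norm (LP_kernel \<phi> p 1 y))"
    using N by (simp add: sc abs_mult power_add)
  have "(LINT y|lborel. norm (N *\<^sub>R y) * norm (LP_kernel \<phi> p 1 (N *\<^sub>R y)))
      = (LINT y|lborel. norm y * norm (LP_kernel \<phi> p 1 y)) / N ^ DIM('a)"
    using lborel_integral_affine[OF LP_kernel_moment_integrable[OF \<phi> p, of 1], of N 0] N
    by (simp add: divide_inverse mult_ac)
  moreover have "norm y * norm (LP_kernel \<phi> p N y)
      = N ^ (DIM('a) + d) / N * (norm (N *\<^sub>R y) * norm (LP_kernel \<phi> p 1 (N *\<^sub>R y)))" for y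
    using N by (simp add: sc abs_mult)
  then have "(LINT y|lborel. norm y * norm (LP_kernel \<phi> p N y))
      = N ^ (DIM('a) + d) / N * (LINT y|lborel. norm (N *\<^sub>R y) * norm (LP_kernel \<phi> p 1 (N *\<^sub>R y)))"
    by (simp only: integral_mult_right_zero)
  ultimately show "(LINT y|lborel. norm y * norm (LP_kernel \<phi> p N y)) = N ^ d / N * (LINT y|lborel. norm y * norm (LP_kernel \<phi> p 1 y))"
    using N by (simp add: power_add)
qed

lemma LP_kernel_one_integral:
  fixes \<phi> :: "'a::euclidean_space \<Rightarrow> real"
  assumes \<phi>: "LP_bump \<phi>" and N: "N > 0"
  shows "(LINT y|lborel. LP_kernel \<phi> (\<lambda>k. 1) N y) = 1"
proof -
  have "(LINT y|lborel. LP_kernel \<phi> (\<lambda>k. 1) 1 y) = Re ((LINT y|lborel. fourier (\<lambda>k. 1 * of_real (\<phi> (k /\<^sub>R 1))) y) / LP_const \<phi>)"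
    unfolding LP_kernel_def
    by (rule integral_bounded_linear[OF bounded_linear_Re_divide fourier_integrable[OF LP_kernel_multiplier[OF \<phi> smooth_const]]]) simp
  also have "\<dots> = 1"
    using LP_const_nonzero[OF \<phi>] by (simp add: LP_const_def)
  finally have one: "(LINT y|lborel. LP_kernel \<phi> (\<lambda>k. 1) 1 y) = 1" .
  have "(LINT y|lborel. LP_kernel \<phi> (\<lambda>k. 1) 1 (N *\<^sub>R y)) = 1 / N ^ DIM('a)"
    using lborel_integral_affine[OF LP_kernel_integrable[OF \<phi> smooth_const, of 1 1], of N 0] N one
    by (simp add: divide_inverse)
  then show ?thesis
    using N LP_kernel_scale[OF \<phi> smooth_const N, of 1 0] by simp
qed

text \<open>Bernstein's inequality: the symbol of a dyadic block equals one on the support of the block,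
  so \<open>p(D) P\<^sub>N v\<close> is \<open>P\<^sub>N v\<close> correlated with a kernel of size \<open>N\<^sup>d\<close>.\<close>

lemma LP_block_bound:
  fixes \<phi> v :: "'a::euclidean_space \<Rightarrow> real" and f :: "'a \<Rightarrow> complex"
  assumes \<phi>: "LP_bump \<phi>" and p: "smooth p" and N: "N > 0"
    and hom: "\<And>a k. a > 0 \<Longrightarrow> p (a *\<^sub>R k) = of_real (a ^ d) * p k"
    and v: "integrable lborel v" and f: "integrable lborel f"
    and pair: "\<And>g. test_function UNIV g \<Longrightarrow> (LINT x|lborel. f x * fourier g x) =
      LP_const \<phi> / of_real ((2 * pi) ^ DIM('a)) *
      (LINT x|lborel. of_real (v x) * fourier (\<lambda>k. of_real (\<phi> (k /\<^sub>R N) - \<phi> ((2 / N) *\<^sub>R k)) * g k) x)"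
  shows "(LINT x|lborel. \<bar>corr v (LP_kernel \<phi> p N) x - corr v (LP_kernel \<phi> p (N / 2)) x\<bar>)
    \<le> (2 * pi) ^ DIM('a) / (norm (LP_const \<phi>))\<^sup>2 * (LINT x|lborel. norm (fourier (\<lambda>k. p k * of_real (\<phi> k)) x)) * (2 * N) ^ d
      * (LINT x|lborel. norm (f x))"
proof -
  define c0 where "c0 = LP_const \<phi>"
  have c0: "c0 \<noteq> 0" using LP_const_nonzero[OF \<phi>] by (simp add: c0_def)
  define P where "P M = (\<lambda>k. p k * complex_of_real (\<phi> (k /\<^sub>R M)))" for M
  have P: "test_function UNIV (P M)" if "M > 0" for M
    unfolding P_def by (rule LP_kernel_multiplier[OF \<phi> p that])
  define w where "w k = \<phi> (k /\<^sub>R N) - \<phi> ((2 / N) *\<^sub>R k)" for k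
  \<comment> \<open>Where |k| > 2 N both bumps in \<open>w\<close> vanish, and elsewhere the bump of
    scale 2 N is 1. Inserting that bump thus leaves \<open>w\<close> unchanged and supplies a
    compactly supported symbol.\<close>
  have w_absorb: "w k * \<phi> (k /\<^sub>R (2 * N)) = w k" for k
  proof (cases "norm k \<le> 2 * N")
    case True
    then have "\<phi> (k /\<^sub>R (2 * N)) = 1" using N by (intro LP_bump_eq_1[OF \<phi>]) (simp add: field_simps)
    then show ?thesis by simp
  next
    case False
    then have "\<phi> (k /\<^sub>R N) = 0" "\<phi> ((2 / N) *\<^sub>R k) = 0"
      using N by (auto intro!: LP_bump_eq_0[OF \<phi>] simp: field_simps)
    then show ?thesis by (simp add: w_def)
  qed
  have Fdiff: "fourier (P N) y - fourier (P (N / 2)) y = fourier (\<lambda>k. of_real (w k) * p k) y" for y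
  proof -
    have i: "integrable lborel (\<lambda>k. cis (- (y \<bullet> k)) * P M k)" if "M > 0" for M
      using integrable_cis_mult[OF test_function_integrable[OF P[OF that]], of "- y"] by simp
    have "fourier (P N) y - fourier (P (N / 2)) y = (LINT k|lborel. cis (- (y \<bullet> k)) * P N k - cis (- (y \<bullet> k)) * P (N / 2) k)"
      using i[of N] i[of "N / 2"] N P[of N] P[of "N / 2"]
      by (simp add: fourier_lborel test_function_measurable)
    also have "\<dots> = (LINT k|lborel. cis (- (y \<bullet> k)) * (P N k - P (N / 2) k))"
      by (simp add: right_diff_distrib)
    also have "\<dots> = fourier (\<lambda>k. P N k - P (N / 2) k) y"
      using N P[of N] P[of "N / 2"]
      by (subst fourier_lborel) (auto intro!: borel_measurable_diff dest: test_function_measurable)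
    also have "(\<lambda>k. P N k - P (N / 2) k) = (\<lambda>k. of_real (w k) * p k)"
      using N by (auto simp: P_def w_def algebra_simps)
    finally show ?thesis .
  qed
  have key: "c0 / of_real ((2 * pi) ^ DIM('a)) * (LINT y|lborel. of_real (v y) * (fourier (P N) (y - x) - fourier (P (N / 2)) (y - x)))
      = corr f (fourier (P (2 * N))) x" for x
  proof -
    \<comment> \<open>This choice makes both sides of \<open>pair\<close> correlations at
      \<open>x\<close>: the modulation shifts each transform by \<open>x\<close>, and by
      \<open>w_absorb\<close> the symbol on the side of \<open>v\<close> is that of the difference
      of the two kernels.\<close>
    have "test_function UNIV (\<lambda>k. cis (k \<bullet> x) * P (2 * N) k)"
      using N by (intro test_function_mult_left smooth_cis_inner P) simp
    note pair[OF this]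
    moreover have "(\<lambda>k. complex_of_real (\<phi> (k /\<^sub>R N) - \<phi> ((2 / N) *\<^sub>R k)) * (cis (k \<bullet> x) * P (2 * N) k))
        = (\<lambda>k. cis (k \<bullet> x) * (of_real (w k) * p k))"
    proof
      fix k
      have "complex_of_real (w k) * (cis (k \<bullet> x) * P (2 * N) k)
          = cis (k \<bullet> x) * (of_real (w k * \<phi> (k /\<^sub>R (2 * N))) * p k)"
        by (simp add: P_def mult_ac)
      then show "complex_of_real (\<phi> (k /\<^sub>R N) - \<phi> ((2 / N) *\<^sub>R k)) * (cis (k \<bullet> x) * P (2 * N) k)
          = cis (k \<bullet> x) * (of_real (w k) * p k)"
        unfolding w_absorb unfolding w_def .
    qed
    ultimately show ?thesis
      unfolding corr_def Fdiff c0_def by (simp add: fourier_modulate)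
  qed
  have bound: "\<bar>corr v (LP_kernel \<phi> p N) x - corr v (LP_kernel \<phi> p (N / 2)) x\<bar>
      \<le> (2 * pi) ^ DIM('a) / (norm c0)\<^sup>2 * norm (corr f (fourier (P (2 * N))) x)" for x
  proof -
    have int: "integrable lborel (\<lambda>y. v y * LP_kernel \<phi> p M (y - x))" if M: "M > 0" for M
    proof -
      obtain B where "\<And>y. norm (LP_kernel \<phi> p M y) \<le> B" using LP_kernel_bounded[OF \<phi> p M] by blast
      then show ?thesis
        using LP_kernel_integrable[OF \<phi> p M] by (intro corr_integrand_integrable[OF v]) auto
    qed
    have intc: "integrable lborel (\<lambda>y. of_real (v y) * (fourier (P N) (y - x) - fourier (P (N / 2)) (y - x)))"
    proof -
      have i: "integrable lborel (\<lambda>y. complex_of_real (v y) * fourier (P M) (y - x))" if "M > 0" for M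
        using fourier_bound[OF test_function_integrable[OF P[OF that]]] fourier_integrable[OF P[OF that]] v
        by (intro corr_integrand_integrable) auto
      then show ?thesis using i[of N] i[of "N / 2"] N by (simp add: right_diff_distrib)
    qed
    have "corr v (LP_kernel \<phi> p N) x - corr v (LP_kernel \<phi> p (N / 2)) x
        = (LINT y|lborel. v y * LP_kernel \<phi> p N (y - x) - v y * LP_kernel \<phi> p (N / 2) (y - x))"
      unfolding corr_def using int[of N] int[of "N / 2"] N by simp
    also have "\<dots> = (LINT y|lborel. Re (of_real (v y) * (fourier (P N) (y - x) - fourier (P (N / 2)) (y - x)) / c0))"
    proof (rule Bochner_Integration.integral_cong[OF refl])
      fix y
      show "v y * LP_kernel \<phi> p N (y - x) - v y * LP_kernel \<phi> p (N / 2) (y - x)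
          = Re (of_real (v y) * (fourier (P N) (y - x) - fourier (P (N / 2)) (y - x)) / c0)"
        unfolding Re_of_real_mult_divide diff_divide_distrib
        by (simp add: LP_kernel_def P_def c0_def right_diff_distrib)
    qed
    also have "\<dots> = Re ((LINT y|lborel. of_real (v y) * (fourier (P N) (y - x) - fourier (P (N / 2)) (y - x))) / c0)"
      by (rule integral_bounded_linear[OF bounded_linear_Re_divide intc])
    \<comment> \<open>One factor \<open>c0\<close> is the normalisation of the kernel, the other
      comes from the constant of inversion in \<open>pair\<close>.\<close>
    also have "(LINT y|lborel. of_real (v y) * (fourier (P N) (y - x) - fourier (P (N / 2)) (y - x))) / c0
        = of_real ((2 * pi) ^ DIM('a)) / c0\<^sup>2 * corr f (fourier (P (2 * N))) x"
      using key[of x] c0 by (simp add: field_simps power2_eq_square)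
    finally have "\<bar>corr v (LP_kernel \<phi> p N) x - corr v (LP_kernel \<phi> p (N / 2)) x\<bar>
        \<le> norm (of_real ((2 * pi) ^ DIM('a)) / c0\<^sup>2 * corr f (fourier (P (2 * N))) x)"
      by (simp only: abs_Re_le_cmod)
    then show ?thesis by (simp add: norm_mult norm_divide norm_power)
  qed
  have Fi: "integrable lborel (fourier (P (2 * N)))" using N by (intro fourier_integrable[OF P]) simp
  have FL1: "(LINT x|lborel. norm (fourier (P (2 * N)) x)) = (2 * N) ^ d * (LINT x|lborel. norm (fourier (\<lambda>k. p k * of_real (\<phi> k)) x))"
  proof -
    have "integrable lborel (\<lambda>x. norm (fourier (\<lambda>k. p k * of_real (\<phi> k)) x))"
      using fourier_integrable[OF P[of 1]] by (simp add: P_def)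
    from lborel_integral_affine[OF this, of "2 * N" 0]
    have "(LINT x|lborel. norm (fourier (\<lambda>k. p k * of_real (\<phi> k)) ((2 * N) *\<^sub>R x)))
        = (LINT x|lborel. norm (fourier (\<lambda>k. p k * of_real (\<phi> k)) x)) / (2 * N) ^ DIM('a)"
      using N by (simp add: divide_inverse mult_ac)
    moreover have "norm (fourier (P (2 * N)) x)
        = (2 * N) ^ DIM('a) * (2 * N) ^ d * norm (fourier (\<lambda>k. p k * of_real (\<phi> k)) ((2 * N) *\<^sub>R x))" for x
      unfolding P_def using N by (subst fourier_LP_multiplier_scale[OF \<phi> p _ hom]) (auto simp: norm_mult norm_power power_add)
    ultimately show ?thesis using N by simp
  qed
  have "(LINT x|lborel. \<bar>corr v (LP_kernel \<phi> p N) x - corr v (LP_kernel \<phi> p (N / 2)) x\<bar>)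
      \<le> (LINT x|lborel. (2 * pi) ^ DIM('a) / (norm c0)\<^sup>2 * norm (corr f (fourier (P (2 * N))) x))"
  proof (rule integral_mono)
    show "integrable lborel (\<lambda>x. \<bar>corr v (LP_kernel \<phi> p N) x - corr v (LP_kernel \<phi> p (N / 2)) x\<bar>)"
      using N by (intro integrable_abs Bochner_Integration.integrable_diff corr_integrable v LP_kernel_integrable \<phi> p) auto
    show "integrable lborel (\<lambda>x. (2 * pi) ^ DIM('a) / (norm c0)\<^sup>2 * norm (corr f (fourier (P (2 * N))) x))"
      by (intro integrable_mult_right integrable_norm corr_integrable f Fi)
  qed (rule bound)
  also have "\<dots> = (2 * pi) ^ DIM('a) / (norm c0)\<^sup>2 * (LINT x|lborel. norm (corr f (fourier (P (2 * N))) x))"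
    by simp
  also have "\<dots> \<le> (2 * pi) ^ DIM('a) / (norm c0)\<^sup>2 * ((LINT x|lborel. norm (f x)) * (LINT x|lborel. norm (fourier (P (2 * N)) x)))"
    by (intro mult_left_mono corr_L1_bound f Fi) auto
  finally show ?thesis
    unfolding FL1 c0_def by (simp add: mult_ac)
qed

section \<open>Rates of approximation at frequency \<open>2\<^sup>l\<close>\<close>

text \<open>Merges constants found separately for each basis direction or component; monotonicity
  allows adding them up.\<close>

lemma uniform_constant:
  assumes "finite S" and "\<And>b. b \<in> S \<Longrightarrow> \<exists>K\<ge>0. Q b K"
    and mono: "\<And>b K K'. Q b K \<Longrightarrow> K \<le> K' \<Longrightarrow> Q b K'"
  shows "\<exists>K\<ge>0::real. \<forall>b\<in>S. Q b K"
  using assms(1,2)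
proof (induction S rule: finite_induct)
  case empty
  show ?case by (intro exI[of _ 0]) auto
next
  case (insert b S)
  obtain K where K: "K \<ge> 0" "\<forall>b\<in>S. Q b K" using insert by blast
  obtain K' where K': "K' \<ge> 0" "Q b K'" using insert by blast
  have "\<forall>c\<in>insert b S. Q c (K + K')"
    using K K' mono[of _ K "K + K'"] mono[of b K' "K + K'"] by auto
  then show ?case using K K' by (intro exI[of _ "K + K'"]) auto
qed

lemma smooth_lipschitz:
  fixes f :: "'a::euclidean_space \<Rightarrow> real"
  assumes "smooth f" "\<And>b x. b \<in> Basis \<Longrightarrow> \<bar>pd b f x\<bar> \<le> B"
  shows "\<bar>f x - f y\<bar> \<le> real DIM('a) * B * norm (x - y)"
proof -
  have "norm (f x - f y) \<le> real DIM('a) * B * norm (x - y)"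
  proof (rule differentiable_bound[of UNIV])
    show "(f has_derivative (\<lambda>h. pd h f x)) (at x within UNIV)" for x
      using smooth_has_derivative[OF assms(1)] by simp
    show "onorm (\<lambda>h. pd h f x) \<le> real DIM('a) * B" for x
      by (rule onorm_le) (use smooth_pd_bound[OF assms(1), of x B] assms(2) in auto)
  qed auto
  then show ?thesis by simp
qed

text \<open>The factor of \<open>pd_LP_kernel\<close>. Correlation adds another minus sign, so
  differentiating a correlation multiplies its symbol by i (k . h).\<close>

abbreviation D_mult :: "'a::euclidean_space \<Rightarrow> ('a \<Rightarrow> complex) \<Rightarrow> 'a \<Rightarrow> complex" where
  "D_mult h p \<equiv> \<lambda>k. - \<i> * of_real (k \<bullet> h) * p k"

lemma smooth_D_mult: "smooth p \<Longrightarrow> smooth (D_mult h p)"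
  by (intro smooth_mult smooth_const smooth_of_real_inner)

text \<open>These kernels are not test functions, so \<open>corr_test_has_derivative\<close> is out
  of reach; bounds on their derivatives come from \<open>LP_kernel_bounded\<close> for the
  multiplied symbol.\<close>

lemma corr_LP_kernel_has_derivative:
  fixes \<phi> f :: "'a::euclidean_space \<Rightarrow> real"
  assumes \<phi>: "LP_bump \<phi>" and p: "smooth p" and N: "N > 0" and f: "integrable lborel f"
  shows "(corr f (LP_kernel \<phi> p N) has_derivative (\<lambda>h. - corr f (LP_kernel \<phi> (D_mult h p) N) x)) (at x)"
proof -
  obtain B where B: "\<And>y. norm (LP_kernel \<phi> p N y) \<le> B"
    using LP_kernel_bounded[OF \<phi> p N] by blast
  have "\<exists>B'\<ge>0. \<forall>b\<in>Basis. \<forall>y. norm (pd b (LP_kernel \<phi> p N) y) \<le> B'"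
  proof (rule uniform_constant[OF finite_Basis])
    fix b :: 'a
    obtain B' where "\<And>y. norm (LP_kernel \<phi> (D_mult b p) N y) \<le> B'"
      using LP_kernel_bounded[OF \<phi> smooth_D_mult[OF p] N] by blast
    then have "\<forall>y. norm (pd b (LP_kernel \<phi> p N) y) \<le> B'"
      unfolding pd_LP_kernel[OF \<phi> p N] by blast
    moreover from this have "B' \<ge> 0" using norm_ge_zero order_trans by blast
    ultimately show "\<exists>B'\<ge>0. \<forall>y. norm (pd b (LP_kernel \<phi> p N) y) \<le> B'" by blast
  qed (auto intro: order_trans)
  then obtain B' where B': "\<And>b y. b \<in> Basis \<Longrightarrow> norm (pd b (LP_kernel \<phi> p N) y) \<le> B'" by blast
  from corr_has_derivative[OF f smooth_LP_kernel[OF \<phi> p N] B B', of x]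
  show ?thesis
    by (simp only: pd_LP_kernel[OF \<phi> p N])
qed

lemma pd_corr_LP_kernel:
  fixes \<phi> f :: "'a::euclidean_space \<Rightarrow> real"
  assumes "LP_bump \<phi>" "smooth p" "N > 0" "integrable lborel f"
  shows "pd h (corr f (LP_kernel \<phi> p N)) x = - corr f (LP_kernel \<phi> (D_mult h p) N) x"
  by (rule pd_eq[OF corr_LP_kernel_has_derivative[OF assms]])

lemma smooth_corr_LP_kernel:
  fixes \<phi> f :: "'a::euclidean_space \<Rightarrow> real"
  assumes \<phi>: "LP_bump \<phi>" and p: "smooth p" and N: "N > 0" and f: "integrable lborel f"
  shows "smooth (corr f (LP_kernel \<phi> p N))"
proof (rule smooth_coinduct[where P = "\<lambda>h. \<exists>c p. smooth p \<and> h = (\<lambda>x. c * corr f (LP_kernel \<phi> p N) x)"])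
  show "\<exists>c p'. smooth p' \<and> corr f (LP_kernel \<phi> p N) = (\<lambda>x. c * corr f (LP_kernel \<phi> p' N) x)"
    using p by (intro exI[of _ 1] exI[of _ p]) auto
  have der: "((\<lambda>x. c * corr f (LP_kernel \<phi> p N) x) has_derivative
      (\<lambda>h. c * (- corr f (LP_kernel \<phi> (D_mult h p) N) x))) (at x)" if "smooth p" for c p x
    by (rule has_derivative_mult_right[OF corr_LP_kernel_has_derivative[OF \<phi> that N f]])
  show "h differentiable (at x)"
    if "\<exists>c p. smooth p \<and> h = (\<lambda>x. c * corr f (LP_kernel \<phi> p N) x)" for h x
    using that der unfolding differentiable_def by blast
  show "\<exists>c p. smooth p \<and> pd e h = (\<lambda>x. c * corr f (LP_kernel \<phi> p N) x)"
    if h: "\<exists>c p. smooth p \<and> h = (\<lambda>x. c * corr f (LP_kernel \<phi> p N) x)" for h e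
  proof -
    obtain c p where p: "smooth p" "h = (\<lambda>x. c * corr f (LP_kernel \<phi> p N) x)"
      using h by blast
    have "pd e h = (\<lambda>x. (- c) * corr f (LP_kernel \<phi> (D_mult e p) N) x)"
      using pd_eq[OF der[OF p(1)]] by (auto simp: p(2))
    with smooth_D_mult[OF p(1)] show ?thesis by blast
  qed
qed

text \<open>One scalar component with its weak partial derivatives \<open>G\<close>, in Borel
  representatives. With q = 2^(-\<sigma>), the bound A (q / 2)^l is the Besov decay 2^(-(1 +
  \<sigma>) l) of the block at frequency 2^l, and 1/2 < q < 1 says that 0 < \<sigma> < 1. Of the
  distribution only the integrals of \<open>LP_projector_pairing\<close> are kept, so that inside
  the locale there are only functions.\<close>

locale besov_data =
  fixes \<phi> v :: "'a::euclidean_space \<Rightarrow> real" and G :: "'a \<Rightarrow> 'a \<Rightarrow> real" and \<Omega> :: "'a set" and B A q :: real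
  assumes \<phi>: "LP_bump \<phi>" and \<Omega>: "bounded_C11_domain \<Omega>"
    and v: "integrable lborel v" and v_supp: "AE x in lborel. x \<notin> closure \<Omega> \<longrightarrow> v x = 0"
    and G_meas: "\<And>b. b \<in> Basis \<Longrightarrow> G b \<in> borel_measurable borel"
    and G_bound: "\<And>b. b \<in> Basis \<Longrightarrow> AE x in lborel. \<bar>G b x\<bar> \<le> B"
    and G_supp: "\<And>b. b \<in> Basis \<Longrightarrow> AE x in lborel. x \<notin> closure \<Omega> \<longrightarrow> G b x = 0"
    and weak: "\<And>b \<zeta>. b \<in> Basis \<Longrightarrow> test_function UNIV \<zeta> \<Longrightarrow>
      (LINT x|lborel. v x * pd b \<zeta> x) = - (LINT x|lborel. G b x * \<zeta> x)"
    and q: "1 / 2 < q" "q < 1" and A: "A \<ge> 0"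
    and LP: "\<And>l::nat. \<exists>f. integrable lborel f \<and> (LINT x|lborel. norm (f x)) \<le> A * (q / 2) ^ l \<and>
      (\<forall>g. test_function UNIV g \<longrightarrow> (LINT x|lborel. f x * fourier g x) =
        LP_const \<phi> / of_real ((2 * pi) ^ DIM('a)) *
        (LINT x|lborel. of_real (v x) * fourier (\<lambda>k. of_real (\<phi> (k /\<^sub>R 2 ^ l) - \<phi> ((2 / 2 ^ l) *\<^sub>R k)) * g k) x))"
begin

lemma B_nonneg: "B \<ge> 0"
proof (rule ccontr)
  assume "\<not> B \<ge> 0"
  obtain b :: 'a where b: "b \<in> Basis" using nonempty_Basis by blast
  have "AE x in lborel. x \<notin> (UNIV :: 'a set)"
    using G_bound[OF b] by (rule AE_mp) (use \<open>\<not> B \<ge> 0\<close> in auto)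
  then have "UNIV \<in> null_sets (lborel :: 'a measure)"
    by (subst AE_iff_null_sets) auto
  then show False by (simp add: null_sets_def)
qed

lemma compact_closure_\<Omega>: "compact (closure \<Omega>)"
  using \<Omega> by (simp add: bounded_C11_domain_def compact_closure)

lemma G_integrable:
  assumes b: "b \<in> Basis"
  shows "integrable lborel (G b)"
proof (rule Bochner_Integration.integrable_bound)
  show "integrable lborel (\<lambda>x. B * indicator (closure \<Omega>) x)"
    using emeasure_bounded_finite[OF compact_imp_bounded[OF compact_closure_\<Omega>]]
    by (intro integrable_mult_right integrable_real_indicator) auto
  show "AE x in lborel. norm (G b x) \<le> norm (B * indicator (closure \<Omega>) x)"
    using G_bound[OF b] G_supp[OF b] by eventually_elim (auto simp: indicator_def)
qed (use G_meas[OF b] in simp)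

text \<open>\<open>\<kappa>\<close> need not have compact support. It is multiplied by a dilated
  bump that is 1 on a ball around the closure of \<open>\<Omega>\<close>; as \<open>v\<close> and
  \<open>G b\<close> vanish a.e. outside that closure, the integrals do not change.\<close>

lemma weak_kernel:
  assumes b: "b \<in> Basis" and \<kappa>: "smooth \<kappa>"
  shows "corr v (pd b \<kappa>) x = - corr (G b) \<kappa> x"
proof -
  obtain R where R: "R > 0" "closure \<Omega> \<subseteq> ball 0 R"
    using compact_imp_bounded[OF compact_closure_\<Omega>] bounded_subset_ballD by blast
  define \<zeta> where "\<zeta> y = \<kappa> (y - x) * \<phi> (y /\<^sub>R R)" for y
  have sm: "smooth (\<lambda>y. \<kappa> (y - x))"
    using smooth_affine[OF \<kappa>, of 1 "- x"] by simp
  have "smooth (\<lambda>y. \<phi> (y /\<^sub>R R))"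
    using smooth_affine[OF LP_bump_smooth[OF \<phi>], of "inverse R" 0] by simp
  then have "test_function UNIV (\<lambda>y. \<phi> (y /\<^sub>R R))"
    by (rule test_functionI[of _ "cball 0 (2 * R)"])
      (use R in \<open>auto intro!: LP_bump_eq_0[OF \<phi>] simp: field_simps\<close>)
  then have \<zeta>: "test_function UNIV \<zeta>"
    unfolding \<zeta>_def by (rule test_function_mult_left[OF sm])
  have \<zeta>_in: "\<zeta> y = \<kappa> (y - x)" if "y \<in> ball 0 R" for y
  proof -
    have "\<phi> (y /\<^sub>R R) = 1" using that R by (intro LP_bump_eq_1[OF \<phi>]) (simp add: field_simps)
    then show ?thesis by (simp add: \<zeta>_def)
  qed
  have pd_in: "pd b \<zeta> y = pd b \<kappa> (y - x)" if y: "y \<in> ball 0 R" for y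
  proof -
    have "((\<lambda>y. \<kappa> (y - x)) has_derivative (\<lambda>h. pd h \<kappa> (y - x))) (at y)"
      by (rule has_derivative_compose[OF _ smooth_has_derivative[OF \<kappa>]]) (auto intro!: derivative_eq_intros)
    then have "(\<zeta> has_derivative (\<lambda>h. pd h \<kappa> (y - x))) (at y)"
      by (rule has_derivative_transform_within_open[OF _ open_ball y]) (simp add: \<zeta>_in)
    then show ?thesis by (rule pd_eq)
  qed
  have [measurable]: "v \<in> borel_measurable borel" "G b \<in> borel_measurable borel" "\<kappa> \<in> borel_measurable borel"
    "pd b \<kappa> \<in> borel_measurable borel" "\<zeta> \<in> borel_measurable borel" "pd b \<zeta> \<in> borel_measurable borel"
    using v G_meas[OF b] smooth_continuous[OF \<kappa>] smooth_pd_continuous[OF \<kappa>]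
      test_function_measurable[OF \<zeta>] test_function_measurable[OF test_function_pd[OF \<zeta> b]]
    by (auto intro: borel_measurable_continuous_onI)
  have "corr v (pd b \<kappa>) x = (LINT y|lborel. v y * pd b \<zeta> y)"
    unfolding corr_def
  proof (rule integral_cong_AE)
    show "AE y in lborel. v y * pd b \<kappa> (y - x) = v y * pd b \<zeta> y"
      using v_supp
    proof eventually_elim
      case (elim y)
      then show ?case using R(2) pd_in[of y] by (cases "y \<in> closure \<Omega>") auto
    qed
  qed measurable
  also have "\<dots> = - (LINT y|lborel. G b y * \<zeta> y)" by (rule weak[OF b \<zeta>])
  also have "(LINT y|lborel. G b y * \<zeta> y) = corr (G b) \<kappa> x"
    unfolding corr_def
  proof (rule integral_cong_AE)
    show "AE y in lborel. G b y * \<zeta> y = G b y * \<kappa> (y - x)"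
      using G_supp[OF b]
    proof eventually_elim
      case (elim y)
      then show ?case using R(2) \<zeta>_in[of y] by (cases "y \<in> closure \<Omega>") auto
    qed
  qed measurable
  finally show ?thesis .
qed

text \<open>The low-frequency part of \<open>v\<close> up to frequency \<open>N\<close>, called v_N
  in the overview.\<close>

definition V :: "real \<Rightarrow> 'a \<Rightarrow> real" where
  "V N = corr v (LP_kernel \<phi> (\<lambda>k. 1) N)"

lemma smooth_V: "N > 0 \<Longrightarrow> smooth (V N)"
  unfolding V_def by (rule smooth_corr_LP_kernel[OF \<phi> smooth_const _ v])

lemma pd_V: "N > 0 \<Longrightarrow> pd h (V N) x = - corr v (LP_kernel \<phi> (D_mult h (\<lambda>k. 1)) N) x"
  unfolding V_def by (rule pd_corr_LP_kernel[OF \<phi> smooth_const _ v])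

text \<open>In \<open>pd_V\<close> the derivative is on the kernel, which suits the L1 block
  estimates; here it is on \<open>v\<close>, where boundedness of \<open>G\<close> gives sup
  bounds.\<close>

lemma pd_V_G:
  assumes N: "N > 0" and b: "b \<in> Basis"
  shows "pd b (V N) x = corr (G b) (LP_kernel \<phi> (\<lambda>k. 1) N) x"
  unfolding pd_V[OF N] pd_LP_kernel[OF \<phi> smooth_const N, symmetric]
  using weak_kernel[OF b smooth_LP_kernel[OF \<phi> smooth_const N]] by simp

lemma pd_pd_V:
  assumes N: "N > 0"
  shows "pd h' (pd h (V N)) x = corr v (LP_kernel \<phi> (D_mult h' (D_mult h (\<lambda>k. 1))) N) x"
proof -
  have "((\<lambda>x. - corr v (LP_kernel \<phi> (D_mult h (\<lambda>k. 1)) N) x) has_derivative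
     (\<lambda>h'. - (- corr v (LP_kernel \<phi> (D_mult h' (D_mult h (\<lambda>k. 1))) N) x))) (at x)"
    by (intro has_derivative_minus corr_LP_kernel_has_derivative[OF \<phi> smooth_D_mult[OF smooth_const] N v])
  from pd_eq[OF this, of h'] show ?thesis unfolding pd_V[OF N] by simp
qed

lemma pd_pd_V_G:
  assumes N: "N > 0" and b: "b \<in> Basis"
  shows "pd h (pd b (V N)) x = - corr (G b) (LP_kernel \<phi> (D_mult h (\<lambda>k. 1)) N) x"
  unfolding pd_V_G[OF N b]
  by (rule pd_eq[OF corr_LP_kernel_has_derivative[OF \<phi> smooth_const N G_integrable[OF b], where x = x]])

lemma D_mult_hom: "a > 0 \<Longrightarrow> D_mult b (\<lambda>k. 1) (a *\<^sub>R k) = of_real (a ^ 1) * D_mult b (\<lambda>k. 1) k"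
  by simp

lemma D_mult2_hom: "a > 0 \<Longrightarrow> D_mult b' (D_mult b (\<lambda>k. 1)) (a *\<^sub>R k) = of_real (a ^ 2) * D_mult b' (D_mult b (\<lambda>k. 1)) k"
  by (simp add: power2_eq_square)

lemma pd_V_bound:
  "\<exists>K\<ge>0. \<forall>b\<in>Basis. \<forall>N>0. \<forall>x. \<bar>pd b (V N) x\<bar> \<le> K"
proof (intro exI[of _ "B * (LINT y|lborel. norm (LP_kernel \<phi> (\<lambda>k. 1) 1 y))"] conjI ballI allI impI)
  show "0 \<le> B * (LINT y|lborel. norm (LP_kernel \<phi> (\<lambda>k. 1) 1 y))"
    using B_nonneg by (intro mult_nonneg_nonneg integral_nonneg_AE) auto
  fix b :: 'a and N :: real and x assume b: "b \<in> Basis" and N: "N > 0"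
  have "norm (pd b (V N) x) \<le> B * (LINT y|lborel. norm (LP_kernel \<phi> (\<lambda>k. 1) N y))"
    unfolding pd_V_G[OF N b]
    using G_bound[OF b] by (intro corr_bounded G_meas b LP_kernel_integrable[OF \<phi> smooth_const N]) auto
  then show "\<bar>pd b (V N) x\<bar> \<le> B * (LINT y|lborel. norm (LP_kernel \<phi> (\<lambda>k. 1) 1 y))"
    using LP_kernel_integral_norm(1)[OF \<phi> smooth_const N, of 1 0] by simp
qed

text \<open>One derivative falls on \<open>v\<close> and gives the bounded \<open>G\<close>, the
  other on the kernel, whose L1 norm becomes a constant times \<open>N\<close>.\<close>

lemma pd_pd_V_bound:
  "\<exists>K\<ge>0. \<forall>b'\<in>Basis. \<forall>b\<in>Basis. \<forall>N>0. \<forall>x. \<bar>pd b' (pd b (V N)) x\<bar> \<le> K * N"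
proof (rule uniform_constant[OF finite_Basis])
  fix b' :: 'a
  let ?K = "B * (LINT y|lborel. norm (LP_kernel \<phi> (D_mult b' (\<lambda>k. 1)) 1 y))"
  have "\<bar>pd b' (pd b (V N)) x\<bar> \<le> ?K * N" if b: "b \<in> Basis" and N: "N > 0" for b N x
  proof -
    have "norm (pd b' (pd b (V N)) x) \<le> B * (LINT y|lborel. norm (LP_kernel \<phi> (D_mult b' (\<lambda>k. 1)) N y))"
      unfolding pd_pd_V_G[OF N b] norm_minus_cancel
      using G_bound[OF b]
      by (intro corr_bounded G_meas b LP_kernel_integrable[OF \<phi> smooth_D_mult[OF smooth_const] N]) auto
    also have "\<dots> = ?K * N"
      using LP_kernel_integral_norm(1)[OF \<phi> smooth_D_mult[OF smooth_const] N, of b' 1 1, OF D_mult_hom] by simp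
    finally show ?thesis by simp
  qed
  moreover have "?K \<ge> 0"
    using B_nonneg by (intro mult_nonneg_nonneg integral_nonneg_AE) auto
  ultimately show "\<exists>K\<ge>0. \<forall>b\<in>Basis. \<forall>N>0. \<forall>x. \<bar>pd b' (pd b (V N)) x\<bar> \<le> K * N" by blast
next
  fix b' K K'
  assume "\<forall>b\<in>Basis. \<forall>N>0. \<forall>x. \<bar>pd b' (pd b (V N)) x\<bar> \<le> K * N" and "K \<le> (K' :: real)"
  then show "\<forall>b\<in>Basis. \<forall>N>0. \<forall>x. \<bar>pd b' (pd b (V N)) x\<bar> \<le> K' * N"
    by (meson order_trans mult_right_mono less_imp_le)
qed

lemma pd_V_integrable: "N > 0 \<Longrightarrow> integrable lborel (pd b (V N))"
  unfolding pd_V by (intro integrable_minus corr_integrable v LP_kernel_integrable \<phi> smooth_D_mult smooth_const)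

lemma pd_pd_V_integrable: "N > 0 \<Longrightarrow> integrable lborel (pd b' (pd b (V N)))"
  unfolding pd_pd_V by (intro corr_integrable v LP_kernel_integrable \<phi> smooth_D_mult smooth_const)

text \<open>By \<open>LP_block_bound\<close> an operator of order \<open>d\<close> costs a factor
  2^(d l) on the block of frequency 2^l. The geometric bound has ratio q for first derivatives and 2
  q for second ones.\<close>

lemma LP_block:
  assumes p: "smooth p" and hom: "\<And>a k. a > 0 \<Longrightarrow> p (a *\<^sub>R k) = of_real (a ^ d) * p k"
  shows "\<exists>K\<ge>0. \<forall>l::nat. (LINT x|lborel. \<bar>corr v (LP_kernel \<phi> p (2 ^ Suc l)) x - corr v (LP_kernel \<phi> p (2 ^ l)) x\<bar>)
      \<le> K * (2 ^ d * q / 2) ^ Suc l"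
proof -
  define K0 where "K0 = (2 * pi) ^ DIM('a) / (norm (LP_const \<phi>))\<^sup>2 * (LINT x|lborel. norm (fourier (\<lambda>k. p k * of_real (\<phi> k)) x)) * 2 ^ d"
  have K0: "K0 \<ge> 0"
    unfolding K0_def by (intro mult_nonneg_nonneg integral_nonneg_AE divide_nonneg_nonneg) auto
  have "(LINT x|lborel. \<bar>corr v (LP_kernel \<phi> p (2 ^ Suc l)) x - corr v (LP_kernel \<phi> p (2 ^ l)) x\<bar>)
      \<le> K0 * A * (2 ^ d * q / 2) ^ Suc l" for l
  proof -
    obtain f where f: "integrable lborel f" "(LINT x|lborel. norm (f x)) \<le> A * (q / 2) ^ Suc l"
      and pair: "\<And>g. test_function UNIV g \<Longrightarrow> (LINT x|lborel. f x * fourier g x) =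
        LP_const \<phi> / of_real ((2 * pi) ^ DIM('a)) *
        (LINT x|lborel. of_real (v x) * fourier (\<lambda>k. of_real (\<phi> (k /\<^sub>R 2 ^ Suc l) - \<phi> ((2 / 2 ^ Suc l) *\<^sub>R k)) * g k) x)"
      using LP[of "Suc l"] by blast
    have "(LINT x|lborel. \<bar>corr v (LP_kernel \<phi> p (2 ^ Suc l)) x - corr v (LP_kernel \<phi> p (2 ^ Suc l / 2)) x\<bar>)
      \<le> (2 * pi) ^ DIM('a) / (norm (LP_const \<phi>))\<^sup>2 * (LINT x|lborel. norm (fourier (\<lambda>k. p k * of_real (\<phi> k)) x)) * (2 * 2 ^ Suc l) ^ d
        * (LINT x|lborel. norm (f x))"
      by (rule LP_block_bound[OF \<phi> p _ hom v f(1) pair]) auto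
    also have "\<dots> = K0 * (2 ^ d) ^ Suc l * (LINT x|lborel. norm (f x))"
      unfolding K0_def by (simp only: power_mult_distrib mult_ac flip: power_mult)
    also have "\<dots> \<le> K0 * (2 ^ d) ^ Suc l * (A * (q / 2) ^ Suc l)"
      using K0 by (intro mult_left_mono f mult_nonneg_nonneg) auto
    also have "\<dots> = K0 * A * (2 ^ d * q / 2) ^ Suc l"
      by (simp add: power_mult_distrib power_divide mult_ac)
    finally show ?thesis by simp
  qed
  then show ?thesis using K0 A by (intro exI[of _ "K0 * A"]) auto
qed

lemma pd_V_step:
  "\<exists>K\<ge>0. \<forall>b\<in>Basis. \<forall>l::nat. (LINT x|lborel. \<bar>pd b (V (2 ^ Suc l)) x - pd b (V (2 ^ l)) x\<bar>) \<le> K * q ^ Suc l"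
proof (rule uniform_constant[OF finite_Basis])
  fix b :: 'a
  obtain K where K: "K \<ge> 0" "\<And>l. (LINT x|lborel. \<bar>corr v (LP_kernel \<phi> (D_mult b (\<lambda>k. 1)) (2 ^ Suc l)) x
      - corr v (LP_kernel \<phi> (D_mult b (\<lambda>k. 1)) (2 ^ l)) x\<bar>) \<le> K * (2 ^ 1 * q / 2) ^ Suc l"
    using LP_block[OF smooth_D_mult[OF smooth_const] D_mult_hom, of b] by blast
  have "\<bar>pd b (V (2 ^ Suc l)) x - pd b (V (2 ^ l)) x\<bar> = \<bar>corr v (LP_kernel \<phi> (D_mult b (\<lambda>k. 1)) (2 ^ Suc l)) x
      - corr v (LP_kernel \<phi> (D_mult b (\<lambda>k. 1)) (2 ^ l)) x\<bar>" for l x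
    by (simp add: pd_V abs_minus_commute)
  with K show "\<exists>K\<ge>0. \<forall>l::nat. (LINT x|lborel. \<bar>pd b (V (2 ^ Suc l)) x - pd b (V (2 ^ l)) x\<bar>) \<le> K * q ^ Suc l"
    by (intro exI[of _ K]) simp
next
  fix b K K'
  assume "\<forall>l::nat. (LINT x|lborel. \<bar>pd b (V (2 ^ Suc l)) x - pd b (V (2 ^ l)) x\<bar>) \<le> K * q ^ Suc l" "K \<le> (K' :: real)"
  then show "\<forall>l::nat. (LINT x|lborel. \<bar>pd b (V (2 ^ Suc l)) x - pd b (V (2 ^ l)) x\<bar>) \<le> K' * q ^ Suc l"
    using q by (meson order_trans mult_right_mono zero_le_power less_imp_le less_trans half_gt_zero zero_less_one)
qed

lemma pd_pd_V_L1:
  "\<exists>K\<ge>0. \<forall>b'\<in>Basis. \<forall>b\<in>Basis. \<forall>l::nat. (LINT x|lborel. \<bar>pd b' (pd b (V (2 ^ l))) x\<bar>) \<le> K * (2 * q) ^ l"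
proof -
  have mono: "K * (2 * q) ^ l \<le> K' * (2 * q) ^ l" if "K \<le> K'" for K K' :: real and l
    using that q by (intro mult_right_mono) auto
  have "\<exists>K\<ge>0. \<forall>l::nat. (LINT x|lborel. \<bar>pd b' (pd b (V (2 ^ l))) x\<bar>) \<le> K * (2 * q) ^ l" for b b'
  proof -
    let ?D = "\<lambda>l x. pd b' (pd b (V (2 ^ l))) x"
    obtain K where K: "K \<ge> 0" "\<And>l. (LINT x|lborel. \<bar>corr v (LP_kernel \<phi> (D_mult b' (D_mult b (\<lambda>k. 1))) (2 ^ Suc l)) x
        - corr v (LP_kernel \<phi> (D_mult b' (D_mult b (\<lambda>k. 1))) (2 ^ l)) x\<bar>) \<le> K * (2\<^sup>2 * q / 2) ^ Suc l"
      using LP_block[OF smooth_D_mult[OF smooth_D_mult[OF smooth_const]] D_mult2_hom, of b' b] by blast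
    have step: "(LINT x|lborel. \<bar>?D (Suc l) x - ?D l x\<bar>) \<le> K * (2 * q) ^ Suc l" for l
      using K(2)[of l] by (simp add: pd_pd_V)
    \<comment> \<open>Chosen so that C + K (2 q) <= C (2 q), which closes the induction; the
      denominator is positive because q > 1/2.\<close>
    define C where "C = (LINT x|lborel. \<bar>?D 0 x\<bar>) + K * (2 * q) / (2 * q - 1)"
    have C: "C \<ge> 0" unfolding C_def using K q by (intro add_nonneg_nonneg) auto
    have "(LINT x|lborel. \<bar>?D l x\<bar>) \<le> C * (2 * q) ^ l" for l
    proof (induction l)
      case 0
      then show ?case using K q by (simp add: C_def)
    next
      case (Suc l)
      have int: "integrable lborel (?D l)" for l by (rule pd_pd_V_integrable) simp
      have "(LINT x|lborel. \<bar>?D (Suc l) x\<bar>) \<le> (LINT x|lborel. \<bar>?D l x\<bar> + \<bar>?D (Suc l) x - ?D l x\<bar>)"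
        by (intro integral_mono integrable_abs Bochner_Integration.integrable_add Bochner_Integration.integrable_diff int) auto
      also have "\<dots> = (LINT x|lborel. \<bar>?D l x\<bar>) + (LINT x|lborel. \<bar>?D (Suc l) x - ?D l x\<bar>)"
        by (intro Bochner_Integration.integral_add integrable_abs Bochner_Integration.integrable_diff int)
      also have "\<dots> \<le> C * (2 * q) ^ l + K * (2 * q) ^ Suc l"
        by (intro add_mono Suc step)
      also have "\<dots> = (C + K * (2 * q)) * (2 * q) ^ l" by (simp add: algebra_simps)
      also have "\<dots> \<le> (C * (2 * q)) * (2 * q) ^ l"
      proof (rule mult_right_mono)
        have "K * (2 * q) / (2 * q - 1) \<le> C" unfolding C_def by simp
        then have "K * (2 * q) \<le> C * (2 * q - 1)" using q by (simp add: field_simps)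
        then show "C + K * (2 * q) \<le> C * (2 * q)" by (simp add: algebra_simps)
      qed (use q in auto)
      finally show ?case by (simp add: mult_ac)
    qed
    with C show ?thesis by blast
  qed
  then show ?thesis
    by (intro uniform_constant[OF finite_Basis]) (blast, (meson mono order_trans)+)
qed

end

lemma pd_mult:
  fixes f g :: "'a::euclidean_space \<Rightarrow> real"
  assumes "smooth f" "smooth g"
  shows "pd h (\<lambda>x. f x * g x) x = f x * pd h g x + pd h f x * g x"
  by (rule pd_eq[OF has_derivative_mult[OF smooth_has_derivative[OF assms(1)] smooth_has_derivative[OF assms(2)]]])

lemma pd_add:
  assumes "smooth f" "smooth g"
  shows "pd h (\<lambda>x. f x + g x) x = pd h f x + pd h g x"
  by (rule pd_eq[OF has_derivative_add[OF smooth_has_derivative[OF assms(1)] smooth_has_derivative[OF assms(2)]]])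

lemma pd_locally_constant:
  assumes "open U" "x \<in> U" "\<And>y. y \<in> U \<Longrightarrow> f y = c"
  shows "pd h f x = 0"
proof (rule pd_eq)
  show "(f has_derivative (\<lambda>h. 0)) (at x)"
    by (rule has_derivative_transform_within_open[OF has_derivative_const[of c] assms(1,2)]) (simp add: assms(3))
qed

lemma test_function_lipschitz:
  fixes \<zeta> :: "'a::euclidean_space \<Rightarrow> real"
  assumes "test_function U \<zeta>"
  obtains L where "L \<ge> 0" "\<And>x y. \<bar>\<zeta> x - \<zeta> y\<bar> \<le> L * norm (x - y)"
proof -
  have "\<exists>B\<ge>0. \<forall>b\<in>Basis. \<forall>x. \<bar>pd b \<zeta> x\<bar> \<le> B"
  proof (rule uniform_constant[OF finite_Basis])
    fix b :: 'a assume "b \<in> Basis"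
    then show "\<exists>B\<ge>0. \<forall>x. \<bar>pd b \<zeta> x\<bar> \<le> B"
      using test_function_bounded[OF test_function_pd[OF assms]] by (metis real_norm_def)
  qed (auto intro: order_trans)
  then obtain B where B: "B \<ge> 0" "\<And>b x. b \<in> Basis \<Longrightarrow> \<bar>pd b \<zeta> x\<bar> \<le> B" by blast
  show ?thesis
    by (rule that[of "real DIM('a) * B"])
      (use B smooth_lipschitz[OF test_function_smooth[OF assms] B(2)] in auto)
qed

section \<open>Convergence of the low-frequency parts and their size near the boundary\<close>

context besov_data
begin

lemma kernel_moment:
  "N > 0 \<Longrightarrow> (LINT y|lborel. norm y * norm (LP_kernel \<phi> (\<lambda>k. 1) N y))
    = (LINT y|lborel. norm y * norm (LP_kernel \<phi> (\<lambda>k. 1) 1 y)) / N"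
  using LP_kernel_integral_norm(2)[OF \<phi> smooth_const, of N 1 0] by simp

text \<open>Fubini moves the kernel from \<open>G b\<close> to \<open>\<zeta>\<close>. With integral
  one and first moment of order 1 / N, it changes the Lipschitz function \<open>\<zeta>\<close> by
  at most a multiple of 1 / N.\<close>

lemma pd_V_weak_limit:
  assumes b: "b \<in> Basis" and \<zeta>: "test_function UNIV \<zeta>"
  shows "(\<lambda>m. LINT x|lborel. pd b (V (2 ^ m)) x * \<zeta> x) \<longlonglongrightarrow> (LINT x|lborel. G b x * \<zeta> x)"
proof -
  let ?k = "LP_kernel \<phi> (\<lambda>k. 1)"
  let ?M = "LINT y|lborel. norm y * norm (?k 1 y)"
  obtain L where L: "L \<ge> 0" "\<And>x y. \<bar>\<zeta> x - \<zeta> y\<bar> \<le> L * norm (x - y)"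
    using test_function_lipschitz[OF \<zeta>] by blast
  obtain Bz where Bz: "\<And>x. norm (\<zeta> x) \<le> Bz" using test_function_bounded[OF \<zeta>] by blast
  have \<zeta>m [measurable]: "\<zeta> \<in> borel_measurable borel" by (rule test_function_measurable[OF \<zeta>])
  have Gi: "integrable lborel (G b)" by (rule G_integrable[OF b])
  have est: "\<bar>(LINT x|lborel. pd b (V N) x * \<zeta> x) - (LINT x|lborel. G b x * \<zeta> x)\<bar> \<le> (LINT x|lborel. \<bar>G b x\<bar>) * (L * ?M) / N"
    if N: "N > 0" for N
  proof -
    define H where "H y = (LINT x|lborel. ?k N (y - x) * \<zeta> x)" for y
    have ki: "integrable lborel (?k N)" by (rule LP_kernel_integrable[OF \<phi> smooth_const N])
    have [measurable]: "?k N \<in> borel_measurable borel" using ki by auto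
    have H: "\<bar>H y - \<zeta> y\<bar> \<le> L * ?M / N" for y
    proof -
      have "integrable lborel (\<lambda>x. ?k N (y - x) * \<zeta> x)"
        using Bz by (intro integrable_mult_bounded[OF lborel_integrable_reflect[OF ki], where B = Bz]) auto
      from lborel_integral_reflect[OF this, of y] have "H y = (LINT z|lborel. ?k N z * \<zeta> (y - z))"
        by (simp add: H_def)
      moreover have "norm ((LINT z|lborel. ?k N z * \<zeta> (y - z)) - (LINT z|lborel. ?k N z) * \<zeta> y)
          \<le> L * (LINT z|lborel. norm z * norm (?k N z))"
        using L(2)[of "y - z" y for z]
        by (intro kernel_approximation ki LP_kernel_moment_integrable[OF \<phi> smooth_const N]) auto
      ultimately show ?thesis
        by (simp add: LP_kernel_one_integral[OF \<phi> N] kernel_moment[OF N, unfolded real_norm_def])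
    qed
    have "(LINT x|lborel. pd b (V N) x * \<zeta> x) = (LINT y|lborel. G b y * H y)"
      unfolding pd_V_G[OF N b] H_def by (rule corr_pairing[OF Gi ki \<zeta>m Bz])
    moreover have Hm: "H \<in> borel_measurable borel" unfolding H_def by measurable
    have i1: "integrable lborel (\<lambda>y. G b y * (H y - \<zeta> y))"
      using H Hm by (intro integrable_mult_bounded[OF Gi, where B = "L * ?M / N"]) auto
    have i2: "integrable lborel (\<lambda>y. G b y * \<zeta> y)"
      using Bz by (intro integrable_mult_bounded[OF Gi, where B = Bz]) auto
    have "(LINT y|lborel. G b y * H y) = (LINT y|lborel. G b y * (H y - \<zeta> y) + G b y * \<zeta> y)"
      by (simp add: algebra_simps)
    also have "\<dots> = (LINT y|lborel. G b y * (H y - \<zeta> y)) + (LINT y|lborel. G b y * \<zeta> y)"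
      by (rule Bochner_Integration.integral_add[OF i1 i2])
    ultimately have "\<bar>(LINT x|lborel. pd b (V N) x * \<zeta> x) - (LINT x|lborel. G b x * \<zeta> x)\<bar> = norm (LINT y|lborel. G b y * (H y - \<zeta> y))"
      by simp
    also have "\<dots> \<le> (LINT y|lborel. \<bar>G b y\<bar> * (L * ?M / N))"
    proof (rule Bochner_Integration.integral_norm_bound_integral[OF i1])
      show "norm (G b y * (H y - \<zeta> y)) \<le> \<bar>G b y\<bar> * (L * ?M / N)" for y
      proof -
        have "\<bar>G b y\<bar> * \<bar>H y - \<zeta> y\<bar> \<le> \<bar>G b y\<bar> * (L * ?M / N)"
          using H[of y] by (rule mult_left_mono) simp
        then show ?thesis by (simp only: real_norm_def abs_mult)
      qed
    qed (use Gi in auto)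
    finally show ?thesis by simp
  qed
  show ?thesis
  proof (rule LIM_zero_cancel, rule tendsto_norm_zero_cancel, rule tendsto_sandwich[of "\<lambda>_. 0"])
    show "\<forall>\<^sub>F m in sequentially. norm ((LINT x|lborel. pd b (V (2 ^ m)) x * \<zeta> x) - (LINT x|lborel. G b x * \<zeta> x))
        \<le> (LINT x|lborel. \<bar>G b x\<bar>) * (L * ?M) * (1 / 2) ^ m"
      using est[of "2 ^ m" for m] by (intro always_eventually) (simp add: power_divide)
    show "(\<lambda>m. (LINT x|lborel. \<bar>G b x\<bar>) * (L * ?M) * (1 / 2) ^ m) \<longlonglongrightarrow> 0"
      by (intro tendsto_mult_right_zero LIMSEQ_power_zero) auto
  qed auto
qed

text \<open>Differences between consecutive frequencies have L1 norms of geometric decay with ratio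
  q, so they sum in L1. The sum and the difference of \<open>G b\<close> and
  \<open>pd b (V (2 ^ l))\<close> have the same integrals against test functions by
  \<open>pd_V_weak_limit\<close>, hence agree a.e.; its norm is bounded by the tail of the geometric
  series.\<close>

lemma pd_V_L1:
  "\<exists>K\<ge>0. \<forall>b\<in>Basis. \<forall>l::nat. (LINT x|lborel. \<bar>pd b (V (2 ^ l)) x - G b x\<bar>) \<le> K * q ^ l"
proof -
  obtain K where K: "K \<ge> 0" "\<And>b l. b \<in> Basis \<Longrightarrow> (LINT x|lborel. \<bar>pd b (V (2 ^ Suc l)) x - pd b (V (2 ^ l)) x\<bar>) \<le> K * q ^ Suc l"
    using pd_V_step by blast
  have "(LINT x|lborel. \<bar>pd b (V (2 ^ l)) x - G b x\<bar>) \<le> K / (1 - q) * q ^ l" if b: "b \<in> Basis" for b l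
  proof -
    define D where "D j = pd b (V (2 ^ (l + j)))" for j
    define e where "e j x = D (Suc j) x - D j x" for j x
    have Di: "integrable lborel (D j)" for j unfolding D_def by (rule pd_V_integrable) simp
    have ei: "integrable lborel (e j)" for j unfolding e_def by (intro Bochner_Integration.integrable_diff Di)
    have eL1: "(LINT x|lborel. \<bar>e j x\<bar>) \<le> K * q ^ l * q ^ j" for j
    proof -
      have "(LINT x|lborel. \<bar>e j x\<bar>) \<le> K * q ^ Suc (l + j)"
        using K(2)[OF b, of "l + j"] by (simp add: e_def D_def)
      also have "\<dots> = K * q ^ l * q ^ j * q" by (simp add: power_add mult_ac)
      also have "\<dots> \<le> K * q ^ l * q ^ j * 1"
        using K q by (intro mult_left_mono) auto
      finally show ?thesis by simp
    qed
    have geo: "summable (\<lambda>j. K * q ^ l * q ^ j)"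
      using q by (intro summable_mult summable_geometric) auto
    have sum: "summable (\<lambda>j. LINT x|lborel. \<bar>e j x\<bar>)"
      by (rule summable_comparison_test'[OF geo]) (use eL1 in auto)
    obtain S where S: "integrable lborel S" "(LINT x|lborel. \<bar>S x\<bar>) \<le> (\<Sum>j. LINT x|lborel. \<bar>e j x\<bar>)"
      and Ssums: "\<And>(\<zeta> :: 'a \<Rightarrow> real) B. \<zeta> \<in> borel_measurable lborel \<Longrightarrow> (\<And>x. \<bar>\<zeta> x\<bar> \<le> B) \<Longrightarrow>
        (\<lambda>j. LINT x|lborel. e j x * \<zeta> x) sums (LINT x|lborel. S x * \<zeta> x)"
      by (rule integral_series_L1[OF ei sum]) blast
    define F where "F x = S x - (G b x - D 0 x)" for x
    have Fi: "integrable lborel F"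
      unfolding F_def by (intro Bochner_Integration.integrable_diff S G_integrable[OF b] Di)
    have "AE x in lborel. F x = 0"
    proof (rule AE_zero_of_test_pairings[OF \<phi>])
      show "F \<in> borel_measurable borel" using Fi by auto
      show "set_integrable lborel S F" if "compact S" for S
        unfolding set_integrable_def using that Fi
        by (intro integrable_mult_indicator) (auto simp: borel_compact)
      fix \<zeta> :: "'a \<Rightarrow> real" assume \<zeta>: "test_function UNIV \<zeta>"
      obtain Bz where Bz: "\<And>x. norm (\<zeta> x) \<le> Bz" using test_function_bounded[OF \<zeta>] by blast
      have \<zeta>m: "\<zeta> \<in> borel_measurable lborel" using test_function_measurable[OF \<zeta>] by simp
      have pi: "integrable lborel (\<lambda>x. f x * \<zeta> x)" if "integrable lborel f" for f
        using that \<zeta>m Bz by (intro integrable_mult_bounded[where B = Bz]) auto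
      have part: "(\<Sum>j<n. LINT x|lborel. e j x * \<zeta> x) = (LINT x|lborel. D n x * \<zeta> x) - (LINT x|lborel. D 0 x * \<zeta> x)" for n
      proof -
        have "(LINT x|lborel. e j x * \<zeta> x) = (LINT x|lborel. D (Suc j) x * \<zeta> x) - (LINT x|lborel. D j x * \<zeta> x)" for j
          unfolding e_def left_diff_distrib by (rule Bochner_Integration.integral_diff[OF pi[OF Di] pi[OF Di]])
        then show ?thesis using sum_lessThan_telescope[of "\<lambda>j. LINT x|lborel. D j x * \<zeta> x" n] by simp
      qed
      have "(\<lambda>n. LINT x|lborel. D n x * \<zeta> x) \<longlonglongrightarrow> (LINT x|lborel. G b x * \<zeta> x)"
        using LIMSEQ_ignore_initial_segment[OF pd_V_weak_limit[OF b \<zeta>], of l]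
        unfolding D_def by (simp add: add.commute)
      then have "(\<lambda>n. (LINT x|lborel. D n x * \<zeta> x) - (LINT x|lborel. D 0 x * \<zeta> x)) \<longlonglongrightarrow>
          (LINT x|lborel. G b x * \<zeta> x) - (LINT x|lborel. D 0 x * \<zeta> x)"
        by (intro tendsto_intros)
      moreover have "(\<lambda>n. \<Sum>j<n. LINT x|lborel. e j x * \<zeta> x) \<longlonglongrightarrow> (LINT x|lborel. S x * \<zeta> x)"
        using Ssums[OF \<zeta>m, of Bz] Bz by (simp add: sums_def)
      ultimately have "(LINT x|lborel. S x * \<zeta> x) = (LINT x|lborel. G b x * \<zeta> x) - (LINT x|lborel. D 0 x * \<zeta> x)"
        unfolding part by (rule LIMSEQ_unique[rotated])
      then show "(LINT x|lborel. F x * \<zeta> x) = 0"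
        unfolding F_def left_diff_distrib
        by (simp add: pi S Di G_integrable[OF b])
    qed
    then have "(LINT x|lborel. \<bar>pd b (V (2 ^ l)) x - G b x\<bar>) = (LINT x|lborel. \<bar>S x\<bar>)"
      using S(1) Di[of 0] G_integrable[OF b]
      by (intro integral_cong_AE) (auto simp: F_def D_def elim!: eventually_mono)
    also have "\<dots> \<le> (\<Sum>j. LINT x|lborel. \<bar>e j x\<bar>)" by (rule S)
    also have "\<dots> \<le> (\<Sum>j. K * q ^ l * q ^ j)" by (rule suminf_le[OF eL1 sum geo])
    also have "\<dots> = K * q ^ l * (\<Sum>j. q ^ j)"
      using q by (intro suminf_mult summable_geometric) auto
    also have "\<dots> = K / (1 - q) * q ^ l"
      using q by (subst suminf_geometric) auto
    finally show ?thesis .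
  qed
  moreover have "K / (1 - q) \<ge> 0" using K q by auto
  ultimately show ?thesis by blast
qed

text \<open>Mollifying with a compactly supported kernel gives a Lipschitz function vanishing at \<open>x0\<close>,
  and the two mollifications commute.\<close>

lemma V_exterior_bound:
  "\<exists>K\<ge>0. \<forall>x0 N. x0 \<notin> closure \<Omega> \<longrightarrow> N > 0 \<longrightarrow> \<bar>V N x0\<bar> \<le> K / N"
proof -
  let ?k = "LP_kernel \<phi> (\<lambda>k. 1)"
  let ?M = "LINT y|lborel. norm y * norm (?k 1 y)"
  obtain K1 where K1: "K1 \<ge> 0" "\<And>b N x. b \<in> Basis \<Longrightarrow> N > 0 \<Longrightarrow> \<bar>pd b (V N) x\<bar> \<le> K1"
    using pd_V_bound by blast
  define K where "K = real DIM('a) * B * ?M"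
  have K0: "K \<ge> 0" unfolding K_def using B_nonneg by (intro mult_nonneg_nonneg integral_nonneg_AE) auto
  have "\<bar>V N x0\<bar> \<le> K / N" if x0: "x0 \<notin> closure \<Omega>" and N: "N > 0" for x0 N
  proof -
    have ki: "integrable lborel (?k N)" by (rule LP_kernel_integrable[OF \<phi> smooth_const N])
    obtain Bk where Bk: "\<And>x. norm (?k N x) \<le> Bk" using LP_kernel_bounded[OF \<phi> smooth_const N] by blast
    have "open (- closure \<Omega>)" by auto
    then obtain r where r: "r > 0" "ball x0 r \<inter> closure \<Omega> = {}"
      using x0 by (metis ComplI disjoint_eq_subset_Compl open_contains_ball)
    \<comment> \<open>The auxiliary scale \<open>d\<close> tends to 0 in the end. It is there
      because \<open>v\<close> is an a.e. class with a bounded weak gradient, whereas its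
      mollification \<open>W\<close> is smooth with a pointwise gradient bound.\<close>
    have est: "\<bar>V N x0\<bar> \<le> K / N + real DIM('a) * K1 * (2 * d)" if d: "0 < d" "2 * d < r" for d
    proof -
      let ?m = "mollifier \<phi> d"
      note mt = mollifier_test[OF \<phi> d(1)]
      have mi: "integrable lborel ?m" by (rule test_function_integrable[OF mt])
      obtain Bm where Bm: "\<And>x. norm (?m x) \<le> Bm" using test_function_bounded[OF mt] by blast
      have [measurable]: "?m \<in> borel_measurable borel" "v \<in> borel_measurable borel"
        using test_function_measurable[OF mt] v by auto
      define W where "W = corr v ?m"
      have W_smooth: "smooth W" unfolding W_def by (rule smooth_corr[OF v mt])
      have W_pd: "\<bar>pd b W x\<bar> \<le> B" if b: "b \<in> Basis" for b x
      proof -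
        have "pd b W x = corr (G b) ?m x"
          unfolding W_def using fun_cong[OF pd_corr[OF v mt, of b], of x] weak_kernel[OF b test_function_smooth[OF mt]] by simp
        moreover have "norm (corr (G b) ?m x) \<le> B * (LINT y|lborel. norm (?m y))"
          using G_bound[OF b] by (intro corr_bounded G_meas b mi) auto
        ultimately show ?thesis using mollifier_integral_norm[OF \<phi> d(1)] by simp
      qed
      \<comment> \<open>The mollifier centred at \<open>x0\<close> lives in a ball of radius 2 d <
        r, which misses the closure of \<open>\<Omega>\<close>.\<close>
      have W0: "W x0 = 0"
      proof -
        have "W x0 = integral\<^sup>L lborel (\<lambda>y::'a. 0)"
          unfolding W_def corr_def
        proof (rule integral_cong_AE)
          show "AE y in lborel. v y * ?m (y - x0) = 0"
            using v_supp
          proof eventually_elim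
            case (elim y)
            show ?case
            proof (cases "y \<in> closure \<Omega>")
              case True
              then have "norm (y - x0) > 2 * d"
                using r(2) d(2) by (force simp: dist_norm norm_minus_commute)
              then show ?thesis using mollifier_eq_0[OF \<phi> d(1)] by simp
            qed (use elim in simp)
          qed
        qed measurable
        then show ?thesis by simp
      qed
      have Wm: "W \<in> borel_measurable borel"
        by (intro borel_measurable_continuous_onI smooth_continuous W_smooth)
      have "norm ((LINT z|lborel. ?k N z * W (x0 + z)) - (LINT z|lborel. ?k N z) * W x0)
          \<le> real DIM('a) * B * (LINT z|lborel. norm z * norm (?k N z))"
        using smooth_lipschitz[OF W_smooth W_pd, of "x0 + z" x0 for z] Wm
        by (intro kernel_approximation ki LP_kernel_moment_integrable[OF \<phi> smooth_const N]) auto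
      then have 1: "\<bar>LINT z|lborel. ?k N z * W (x0 + z)\<bar> \<le> K / N"
        by (simp add: W0 kernel_moment[OF N, unfolded real_norm_def] K_def)
      have "integrable lborel W" unfolding W_def by (rule corr_integrable[OF v mi])
      then have "integrable lborel (\<lambda>y. W y * ?k N (y - x0))"
        using Bk ki by (intro corr_integrand_integrable[where B = Bk]) auto
      from lborel_integral_translate[OF this, of x0]
      have 2: "corr W (?k N) x0 = (LINT z|lborel. ?k N z * W (x0 + z))"
        by (simp add: corr_def mult.commute add.commute)
      \<comment> \<open>The left side is of order 1 / N since \<open>W\<close> vanishes at
        \<open>x0\<close>; the right side differs from \<open>V N x0\<close> by at most a multiple
        of \<open>d\<close>.\<close>
      have 3: "corr W (?k N) x0 = corr (V N) ?m x0"
        unfolding W_def V_def by (rule corr_commute[OF v mi Bm ki Bk])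
      have Vm: "V N \<in> borel_measurable borel"
        by (intro borel_measurable_continuous_onI smooth_continuous smooth_V N)
      have "integrable lborel (V N)" unfolding V_def by (rule corr_integrable[OF v ki])
      then have "integrable lborel (\<lambda>y. V N y * ?m (y - x0))"
        using Bm by (intro corr_integrand_integrable[where B = Bm]) auto
      from lborel_integral_translate[OF this, of x0]
      have 4: "corr (V N) ?m x0 = (LINT z|lborel. ?m z * V N (x0 + z))"
        by (simp add: corr_def mult.commute add.commute)
      have mom: "norm z * norm (?m z) \<le> 2 * d * norm (?m z)" for z
        using mollifier_eq_0[OF \<phi> d(1), of z] by (cases "norm z > 2 * d") (auto intro: mult_right_mono)
      have momi: "integrable lborel (\<lambda>z. norm z * norm (?m z))"
        by (rule Bochner_Integration.integrable_bound[OF integrable_mult_right[OF integrable_norm[OF mi], of "2 * d"]])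
          (use mom d in \<open>auto simp: abs_mult\<close>)
      have V_approx: "norm ((LINT z|lborel. ?m z * V N (x0 + z)) - (LINT z|lborel. ?m z) * V N x0)
          \<le> real DIM('a) * K1 * (LINT z|lborel. norm z * norm (?m z))"
        using smooth_lipschitz[OF smooth_V[OF N] K1(2)[OF _ N], of "x0 + z" x0 for z] Vm
        by (intro kernel_approximation mi momi) auto
      have "(LINT z|lborel. norm z * norm (?m z)) \<le> (LINT z|lborel. 2 * d * norm (?m z))"
        using mom mi by (intro integral_mono momi) auto
      then have "(LINT z|lborel. norm z * norm (?m z)) \<le> 2 * d"
        using mollifier_integral_norm[OF \<phi> d(1)] by simp
      then have "real DIM('a) * K1 * (LINT z|lborel. norm z * norm (?m z)) \<le> real DIM('a) * K1 * (2 * d)"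
        using K1(1) by (intro mult_left_mono) auto
      from order_trans[OF V_approx this]
      have "\<bar>corr (V N) ?m x0 - V N x0\<bar> \<le> real DIM('a) * K1 * (2 * d)"
        unfolding 4 by (simp add: mollifier_integral[OF \<phi> d(1)])
      with 1 2 3 show ?thesis by linarith
    qed
    show ?thesis
    proof (rule field_le_epsilon)
      fix e :: real assume e: "e > 0"
      \<comment> \<open>Small enough for 2 d < r and for an error of at most \<open>e\<close>; the +
        1 keeps the denominator positive.\<close>
      define d where "d = min (r / 4) (e / (2 * (real DIM('a) * K1 + 1)))"
      have pos: "real DIM('a) * K1 + 1 > 0" using K1(1) by (simp add: add_nonneg_pos)
      have "d \<le> r / 4" unfolding d_def by (rule min.cobounded1)
      moreover have "0 < d" using r(1) e pos by (simp add: d_def)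
      ultimately have d: "0 < d" "2 * d < r" by auto
      have "d \<le> e / (2 * (real DIM('a) * K1 + 1))" unfolding d_def by (rule min.cobounded2)
      then have "(real DIM('a) * K1 + 1) * (2 * d) \<le> e" using pos by (simp add: field_simps)
      then have "real DIM('a) * K1 * (2 * d) \<le> e" using d by (simp add: algebra_simps)
      with est[OF d] show "\<bar>V N x0\<bar> \<le> K / N + e" by linarith
    qed
  qed
  with K0 show ?thesis by blast
qed

text \<open>A point of the layer has a point outside the closure within distance \<open>d\<close>,
  and the uniform gradient bound carries \<open>V_exterior_bound\<close> over to it.\<close>

lemma V_layer_bound:
  "\<exists>K\<ge>0. \<forall>x d N. x \<in> \<Omega> \<longrightarrow> infdist x (- \<Omega>) < d \<longrightarrow> N > 0 \<longrightarrow> \<bar>V N x\<bar> \<le> K * (1 / N + d)"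
proof -
  obtain K0 where K0: "K0 \<ge> 0" "\<And>x0 N. x0 \<notin> closure \<Omega> \<Longrightarrow> N > 0 \<Longrightarrow> \<bar>V N x0\<bar> \<le> K0 / N"
    using V_exterior_bound by blast
  obtain K1 where K1: "K1 \<ge> 0" "\<And>b N x. b \<in> Basis \<Longrightarrow> N > 0 \<Longrightarrow> \<bar>pd b (V N) x\<bar> \<le> K1"
    using pd_V_bound by blast
  let ?K = "K0 + real DIM('a) * K1"
  have "\<bar>V N x\<bar> \<le> ?K * (1 / N + d)" if x: "x \<in> \<Omega>" "infdist x (- \<Omega>) < d" and N: "N > 0" for x d N
  proof -
    obtain x0 where x0: "x0 \<notin> closure \<Omega>" "dist x x0 < d"
      using exterior_point_near_layer[OF \<Omega> x] by blast
    have "\<bar>V N x - V N x0\<bar> \<le> real DIM('a) * K1 * norm (x - x0)"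
      by (rule smooth_lipschitz[OF smooth_V[OF N] K1(2)[OF _ N]])
    also have "\<dots> \<le> real DIM('a) * K1 * d"
      using x0 K1 by (intro mult_left_mono) (auto simp: dist_norm)
    finally have le: "\<bar>V N x\<bar> \<le> K0 * (1 / N) + real DIM('a) * K1 * d"
      using K0(2)[OF x0(1) N] by simp
    have "d \<ge> 0" using x0(2) zero_le_dist[of x x0] by linarith
    then have "K0 * (1 / N) + real DIM('a) * K1 * d \<le> ?K * (1 / N) + ?K * d"
      using K0(1) K1(1) N by (intro add_mono mult_right_mono) auto
    with le show ?thesis unfolding distrib_left by linarith
  qed
  moreover have "?K \<ge> 0" using K0 K1 by simp
  ultimately show ?thesis by blast
qed

end

section \<open>The truncated approximation\<close>

context besov_data
begin

text \<open>The three estimates have separate uses: the sup bound reduces the squared distance to a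
  first power, the L1 bound then controls the elastic energy, and the last one controls the total
  variation.\<close>

lemma competitor:
  "\<exists>C\<ge>0. \<exists>l0. \<forall>l\<ge>l0. \<exists>w. test_function \<Omega> w \<and>
     (\<forall>b\<in>Basis. AE x in lborel. x \<in> \<Omega> \<longrightarrow> \<bar>pd b w x - G b x\<bar> \<le> C) \<and>
     (\<forall>b\<in>Basis. (LINT x|lborel. indicator \<Omega> x * \<bar>pd b w x - G b x\<bar>) \<le> C * q ^ l) \<and>
     (\<forall>b\<in>Basis. \<forall>b'\<in>Basis. (LINT x|lborel. \<bar>pd b' (pd b w) x\<bar>) \<le> C * (2 * q) ^ l)"
proof -
  have op: "open \<Omega>" and bd: "bounded \<Omega>"
    using \<Omega> by (auto simp: bounded_C11_domain_def)
  have ne: "- \<Omega> \<noteq> {}" using bd not_bounded_UNIV by (metis Compl_UNIV_eq double_compl)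
  obtain CL \<delta>0 where CL: "CL \<ge> 0" and \<delta>0: "\<delta>0 > 0"
    and layer: "\<And>\<delta>. 0 < \<delta> \<Longrightarrow> \<delta> < \<delta>0 \<Longrightarrow> emeasure lborel {x \<in> \<Omega>. infdist x (- \<Omega>) < \<delta>} \<le> ennreal (CL * \<delta>)"
    using boundary_layer_emeasure[OF \<Omega>] by blast
  obtain C\<eta> where C\<eta>: "C\<eta> \<ge> 0" and cutoff: "\<And>A d. bounded A \<Longrightarrow> A \<in> sets borel \<Longrightarrow> d > 0 \<Longrightarrow> \<exists>\<eta>::'a \<Rightarrow> real. is_cutoff C\<eta> A d \<eta>"
    using cutoff_exists[OF \<phi>] by blast
  obtain K1 where K1: "K1 \<ge> 0" "\<And>b N x. b \<in> Basis \<Longrightarrow> N > 0 \<Longrightarrow> \<bar>pd b (V N) x\<bar> \<le> K1"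
    using pd_V_bound by blast
  obtain K2 where K2: "K2 \<ge> 0" "\<And>b b' N x. b' \<in> Basis \<Longrightarrow> b \<in> Basis \<Longrightarrow> N > 0 \<Longrightarrow> \<bar>pd b' (pd b (V N)) x\<bar> \<le> K2 * N"
    using pd_pd_V_bound by blast
  obtain K3 where K3: "K3 \<ge> 0" "\<And>x d N. x \<in> \<Omega> \<Longrightarrow> infdist x (- \<Omega>) < d \<Longrightarrow> N > 0 \<Longrightarrow> \<bar>V N x\<bar> \<le> K3 * (1 / N + d)"
    using V_layer_bound by blast
  obtain K4 where K4: "K4 \<ge> 0" "\<And>b l. b \<in> Basis \<Longrightarrow> (LINT x|lborel. \<bar>pd b (V (2 ^ l)) x - G b x\<bar>) \<le> K4 * q ^ l"
    using pd_V_L1 by blast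
  obtain K5 where K5: "K5 \<ge> 0" "\<And>b b' l. b' \<in> Basis \<Longrightarrow> b \<in> Basis \<Longrightarrow> (LINT x|lborel. \<bar>pd b' (pd b (V (2 ^ l))) x\<bar>) \<le> K5 * (2 * q) ^ l"
    using pd_pd_V_L1 by blast
  \<comment> \<open>\<open>C1\<close> bounds the gradient of \<open>w\<close> in
    \<open>\<Omega>\<close>, and C2 N its second derivatives in the layer, with one summand for each
    kind of term in the Leibniz rule. The 7 is 1 + 6: in the layer of width 6 / N,
    \<open>V N\<close> is at most K3 (1 / N + 6 / N).\<close>
  define C1 where "C1 = K1 + C\<eta> * (7 * K3)"
  define C2 where "C2 = K2 + 2 * C\<eta> * K1 + C\<eta> * (7 * K3)"
  have C12: "C1 \<ge> K1" "C2 \<ge> 0" "C1 \<ge> 0"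
    unfolding C1_def C2_def using K1 K2 K3 C\<eta> by auto
  define C where "C = (C1 + B) + (K4 + (C1 + K1) * (6 * CL)) + (K5 + C2 * (6 * CL))"
  have parts: "C1 + B \<ge> 0" "K4 + (C1 + K1) * (6 * CL) \<ge> 0" "K5 + C2 * (6 * CL) \<ge> 0"
    using C12 B_nonneg K4 K5 K1 CL by auto
  have C0: "C \<ge> 0" using parts by (simp add: C_def)
  have "(\<lambda>l. 6 * (1 / 2) ^ l :: real) \<longlonglongrightarrow> 0"
    by (intro tendsto_mult_right_zero LIMSEQ_power_zero) auto
  then obtain l0 where l0: "\<And>l. l \<ge> l0 \<Longrightarrow> 6 * (1 / 2) ^ l < \<delta>0"
    using order_tendstoD(2)[OF _ \<delta>0] by (metis eventually_sequentially)
  have main: "\<exists>w. test_function \<Omega> w \<and>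
     (\<forall>b\<in>Basis. AE x in lborel. x \<in> \<Omega> \<longrightarrow> \<bar>pd b w x - G b x\<bar> \<le> C) \<and>
     (\<forall>b\<in>Basis. (LINT x|lborel. indicator \<Omega> x * \<bar>pd b w x - G b x\<bar>) \<le> C * q ^ l) \<and>
     (\<forall>b\<in>Basis. \<forall>b'\<in>Basis. (LINT x|lborel. \<bar>pd b' (pd b w) x\<bar>) \<le> C * (2 * q) ^ l)"
    if l: "l \<ge> l0" for l
  proof -
    define N :: real where "N = 2 ^ l"
    have N: "N > 0" by (simp add: N_def)
    define d where "d = 1 / N"
    have d: "d > 0" using N by (simp add: d_def)
    have d_small: "6 * d < \<delta>0" using l0[OF l] by (simp add: d_def N_def power_divide)
    define dst where "dst x = infdist x (- \<Omega>)" for x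
    have dst_cont: "continuous_on UNIV dst" unfolding dst_def by (intro continuous_intros)
    have dst_tri: "dst x \<le> dst y + dist x y" for x y
      unfolding dst_def by (rule infdist_triangle)
    have dst_out: "dst x = 0" if "x \<notin> \<Omega>" for x using that by (simp add: dst_def)
    have cl: "closed {x. e \<le> dst x}" for e
      by (intro closed_Collect_le dst_cont continuous_on_const)
    have in_\<Omega>: "{x. e \<le> dst x} \<subseteq> \<Omega>" if "e > 0" for e
      using dst_out that by force
    \<comment> \<open>With margin 2 d the cutoff is 0 where dst < d and 1 where dst > 5 d, so
      \<open>w\<close> is supported in a compact subset of \<open>\<Omega>\<close>.\<close>
    define S where "S = {x. 3 * d \<le> dst x}"
    have S: "bounded S" "S \<in> sets borel"
      unfolding S_def using in_\<Omega>[of "3 * d"] d bd cl by (auto intro: bounded_subset)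
    obtain \<eta> :: "'a \<Rightarrow> real" where \<eta>: "is_cutoff C\<eta> S d \<eta>" using cutoff[OF S d] by blast
    have \<eta>_sm: "smooth \<eta>" and \<eta>_01: "0 \<le> \<eta> x" "\<eta> x \<le> 1"
      and \<eta>_pd: "b \<in> Basis \<Longrightarrow> \<bar>pd b \<eta> x\<bar> \<le> C\<eta> * N"
      and \<eta>_pd2: "b \<in> Basis \<Longrightarrow> b' \<in> Basis \<Longrightarrow> \<bar>pd b' (pd b \<eta>) x\<bar> \<le> C\<eta> * N\<^sup>2" for x b b'
      using \<eta> unfolding is_cutoff_def by (auto simp: d_def divide_inverse power_inverse)
    have \<eta>_1: "\<eta> x = 1" if "5 * d < dst x" for x
    proof -
      have "cball x (2 * d) \<subseteq> S"
      proof
        fix y assume "y \<in> cball x (2 * d)"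
        then show "y \<in> S" using dst_tri[of x y] that unfolding S_def by auto
      qed
      then show ?thesis using \<eta> unfolding is_cutoff_def by blast
    qed
    have \<eta>_0: "\<eta> x = 0" if "dst x < d" for x
    proof -
      have "cball x (2 * d) \<inter> S = {}"
      proof (rule equals0I)
        fix y assume "y \<in> cball x (2 * d) \<inter> S"
        then show False using dst_tri[of y x] that unfolding S_def by (auto simp: dist_commute)
      qed
      then show ?thesis using \<eta> unfolding is_cutoff_def by blast
    qed
    note V_sm = smooth_V[OF N]
    define w where "w x = \<eta> x * V N x" for x
    have w_sm: "smooth w" unfolding w_def by (rule smooth_mult[OF \<eta>_sm V_sm])
    have w_test: "test_function \<Omega> w"
    proof (rule test_functionI[OF w_sm])
      show "compact {x. d \<le> dst x}"
        using bounded_subset[OF bd in_\<Omega>[OF d]] cl by (simp add: compact_eq_bounded_closed)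
      show "{x. d \<le> dst x} \<subseteq> \<Omega>" by (rule in_\<Omega>[OF d])
      show "w x = 0" if "x \<notin> {x. d \<le> dst x}" for x
        using that \<eta>_0 by (simp add: w_def)
    qed
    have w1: "pd b w x = \<eta> x * pd b (V N) x + pd b \<eta> x * V N x" for b x
      unfolding w_def by (rule pd_mult[OF \<eta>_sm V_sm])
    have w2: "pd b' (pd b w) x = (\<eta> x * pd b' (pd b (V N)) x + pd b' \<eta> x * pd b (V N) x)
        + (pd b \<eta> x * pd b' (V N) x + pd b' (pd b \<eta>) x * V N x)" if b: "b \<in> Basis" for b b' x
      unfolding w1
      using pd_add[OF smooth_mult[OF \<eta>_sm smooth_pd[OF V_sm b]] smooth_mult[OF smooth_pd[OF \<eta>_sm b] V_sm], of x b']
        pd_mult[OF \<eta>_sm smooth_pd[OF V_sm b], of x b'] pd_mult[OF smooth_pd[OF \<eta>_sm b] V_sm, of x b']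
      by simp
    \<comment> \<open>The width is 6 d rather than 5 d so that every point of
      \<open>\<Omega>\<close> outside the layer has a neighbourhood where the cutoff is constantly
      1.\<close>
    define Lay where "Lay = {x \<in> \<Omega>. dst x < 6 * d}"
    have Lay_open: "open Lay"
    proof -
      have "Lay = \<Omega> \<inter> {x. dst x < 6 * d}" by (auto simp: Lay_def)
      then show ?thesis by (auto intro!: open_Int op open_Collect_less dst_cont continuous_on_const)
    qed
    have Lay_em: "emeasure lborel Lay \<le> ennreal (CL * (6 * d))"
      unfolding Lay_def dst_def using d d_small by (intro layer) auto
    have Lay_int: "integrable lborel (indicator Lay :: 'a \<Rightarrow> real)"
      using Lay_open Lay_em by (intro integrable_real_indicator) (auto intro: le_less_trans)
    have Lay_L1: "(LINT x|lborel. indicator Lay x) \<le> 6 * CL * d"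
      using Lay_open Lay_em CL d by (simp add: measure_def enn2real_leI mult_ac)
    have inner: "pd b \<eta> x = 0" "pd b' (pd b \<eta>) x = 0" "\<eta> x = 1" if x: "x \<in> \<Omega>" "x \<notin> Lay" for b b' x
    proof -
      have U: "open {x. 5 * d < dst x}" "x \<in> {x. 5 * d < dst x}"
        using x d by (auto simp: Lay_def intro!: open_Collect_less dst_cont continuous_on_const)
      have z: "pd b \<eta> y = 0" if "y \<in> {x. 5 * d < dst x}" for y
        by (rule pd_locally_constant[OF U(1) that, of _ 1]) (simp add: \<eta>_1)
      show "pd b \<eta> x = 0" by (rule z[OF U(2)])
      show "pd b' (pd b \<eta>) x = 0" by (rule pd_locally_constant[OF U z])
      show "\<eta> x = 1" using U(2) \<eta>_1 by simp
    qed
    have outer: "pd b' (pd b w) x = 0" if x: "x \<notin> \<Omega>" for b b' x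
    proof -
      have U: "open {x. dst x < d}" "x \<in> {x. dst x < d}"
        using dst_out[OF x] d by (auto intro!: open_Collect_less dst_cont continuous_on_const)
      have z: "pd b w y = 0" if "y \<in> {x. dst x < d}" for y
        by (rule pd_locally_constant[OF U(1) that, of _ 0]) (simp add: \<eta>_0 w_def)
      show ?thesis by (rule pd_locally_constant[OF U z])
    qed
    have V_Lay: "\<bar>V N x\<bar> * N \<le> 7 * K3" if "x \<in> Lay" for x
    proof -
      have "\<bar>V N x\<bar> \<le> K3 * (1 / N + 6 * d)"
        using that N unfolding Lay_def dst_def by (intro K3) auto
      also have "\<dots> = 7 * K3 / N" by (simp add: d_def)
      finally show ?thesis using N by (simp add: field_simps)
    qed
    have w1_bound: "\<bar>pd b w x\<bar> \<le> C1" if b: "b \<in> Basis" and x: "x \<in> \<Omega>" for b x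
    proof (cases "x \<in> Lay")
      case True
      have "\<bar>\<eta> x * pd b (V N) x\<bar> \<le> 1 * K1"
        unfolding abs_mult using \<eta>_01[of x] K1(2)[OF b N, of x] by (intro mult_mono) auto
      \<comment> \<open>The gradient of the cutoff is of order N, compensated by \<open>V N\<close>
        being of order 1 / N in the layer.\<close>
      moreover have "\<bar>pd b \<eta> x * V N x\<bar> \<le> C\<eta> * (7 * K3)"
      proof -
        have "\<bar>pd b \<eta> x * V N x\<bar> \<le> C\<eta> * N * \<bar>V N x\<bar>"
          unfolding abs_mult by (intro mult_right_mono \<eta>_pd b) auto
        also have "\<dots> = C\<eta> * (\<bar>V N x\<bar> * N)" by simp
        also have "\<dots> \<le> C\<eta> * (7 * K3)" by (intro mult_left_mono V_Lay True C\<eta>)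
        finally show ?thesis .
      qed
      ultimately show ?thesis unfolding w1 C1_def by linarith
    next
      case False
      then have "pd b w x = pd b (V N) x" unfolding w1 using inner[OF x False] by simp
      then show ?thesis using K1(2)[OF b N, of x] C12(1) by simp
    qed
    have w1_diff: "indicator \<Omega> x * \<bar>pd b w x - G b x\<bar> \<le> \<bar>pd b (V N) x - G b x\<bar> + (C1 + K1) * indicator Lay x"
      if b: "b \<in> Basis" for b x
    proof (cases "x \<in> \<Omega>")
      case x: True
      show ?thesis
      proof (cases "x \<in> Lay")
        case True
        then show ?thesis using w1_bound[OF b x] K1(2)[OF b N, of x] x by simp
      next
        case False
        then show ?thesis unfolding w1 using inner[OF x False] x by simp
      qed
    next
      case False
      then show ?thesis using C12 K1 by simp
    qed
    have w2_bound: "\<bar>pd b' (pd b w) x\<bar> \<le> \<bar>pd b' (pd b (V N)) x\<bar> + C2 * N * indicator Lay x"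
      if b: "b \<in> Basis" "b' \<in> Basis" for b b' x
    proof (cases "x \<in> \<Omega>")
      case x: True
      show ?thesis
      proof (cases "x \<in> Lay")
        case True
        have 1: "\<bar>\<eta> x * pd b' (pd b (V N)) x\<bar> \<le> 1 * (K2 * N)"
          unfolding abs_mult using \<eta>_01[of x] K2(2)[OF b(2) b(1) N, of x] by (intro mult_mono) auto
        have 2: "\<bar>pd b' \<eta> x * pd b (V N) x\<bar> \<le> C\<eta> * N * K1" "\<bar>pd b \<eta> x * pd b' (V N) x\<bar> \<le> C\<eta> * N * K1"
          unfolding abs_mult using C\<eta> N by (intro mult_mono \<eta>_pd K1 b; simp)+
        have 3: "\<bar>pd b' (pd b \<eta>) x * V N x\<bar> \<le> C\<eta> * N * (7 * K3)"
        proof -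
          have "\<bar>pd b' (pd b \<eta>) x * V N x\<bar> \<le> C\<eta> * N\<^sup>2 * \<bar>V N x\<bar>"
            unfolding abs_mult by (intro mult_right_mono \<eta>_pd2 b) auto
          also have "\<dots> = C\<eta> * N * (\<bar>V N x\<bar> * N)" by (simp add: power2_eq_square)
          also have "\<dots> \<le> C\<eta> * N * (7 * K3)" using C\<eta> N by (intro mult_left_mono V_Lay True) auto
          finally show ?thesis .
        qed
        have "\<bar>pd b' (pd b w) x\<bar> \<le> 1 * (K2 * N) + C\<eta> * N * K1 + (C\<eta> * N * K1 + C\<eta> * N * (7 * K3))"
          unfolding w2[OF b(1)] using 1 2 3 by linarith
        also have "\<dots> = C2 * N" by (simp add: C2_def algebra_simps)
        finally show ?thesis using True by simp
      next
        case False
        then show ?thesis unfolding w2[OF b(1)] using inner[OF x False] by simp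
      qed
    next
      case False
      then show ?thesis using outer[OF False] C12 N by simp
    qed
    \<comment> \<open>This is where q > 1/2 lets the L1 rate absorb the volume of the layer.\<close>
    have d_le: "d \<le> q ^ l"
    proof -
      have "d = (1 / 2) ^ l" by (simp add: d_def N_def power_divide)
      also have "\<dots> \<le> q ^ l" using q by (intro power_mono) auto
      finally show ?thesis .
    qed
    have qq: "1 \<le> (2 * q) ^ l" using q by (intro one_le_power) auto
    have w_int: "integrable lborel (pd b w)" if "b \<in> Basis" for b
      by (rule test_function_integrable[OF test_function_pd[OF w_test that]])
    have w2_int: "integrable lborel (pd b' (pd b w))" if "b \<in> Basis" "b' \<in> Basis" for b b'
      by (rule test_function_integrable[OF test_function_pd[OF test_function_pd[OF w_test that(1)] that(2)]])
    have Vint: "integrable lborel (\<lambda>x. \<bar>pd b (V N) x - G b x\<bar>)" if "b \<in> Basis" for b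
      by (intro integrable_abs Bochner_Integration.integrable_diff pd_V_integrable N G_integrable that)
    show ?thesis
    proof (intro exI[of _ w] conjI ballI)
      show "test_function \<Omega> w" by (rule w_test)
    next
      fix b :: 'a assume b: "b \<in> Basis"
      show "AE x in lborel. x \<in> \<Omega> \<longrightarrow> \<bar>pd b w x - G b x\<bar> \<le> C"
        using G_bound[OF b]
      proof eventually_elim
        case (elim x)
        show ?case
        proof
          assume "x \<in> \<Omega>"
          then have "\<bar>pd b w x - G b x\<bar> \<le> C1 + B" using w1_bound[OF b, of x] elim by linarith
          then show "\<bar>pd b w x - G b x\<bar> \<le> C" using parts by (simp add: C_def)
        qed
      qed
    next
      fix b :: 'a assume b: "b \<in> Basis"
      have "(LINT x|lborel. indicator \<Omega> x * \<bar>pd b w x - G b x\<bar>)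
          \<le> (LINT x|lborel. \<bar>pd b (V N) x - G b x\<bar> + (C1 + K1) * indicator Lay x)"
      proof (rule integral_mono)
        show "integrable lborel (\<lambda>x. indicator \<Omega> x * \<bar>pd b w x - G b x\<bar>)"
          using integrable_mult_indicator[of \<Omega> lborel "\<lambda>x. \<bar>pd b w x - G b x\<bar>"] op w_int[OF b] G_integrable[OF b]
          by simp
        show "integrable lborel (\<lambda>x. \<bar>pd b (V N) x - G b x\<bar> + (C1 + K1) * indicator Lay x)"
          by (intro Bochner_Integration.integrable_add integrable_mult_right Vint b Lay_int)
      qed (rule w1_diff[OF b])
      also have "\<dots> = (LINT x|lborel. \<bar>pd b (V N) x - G b x\<bar>) + (C1 + K1) * (LINT x|lborel. indicator Lay x)"
        using Vint[OF b] Lay_int by simp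
      also have "\<dots> \<le> K4 * q ^ l + (C1 + K1) * (6 * CL * q ^ l)"
      proof (intro add_mono mult_left_mono)
        show "(LINT x|lborel. \<bar>pd b (V N) x - G b x\<bar>) \<le> K4 * q ^ l"
          unfolding N_def by (rule K4(2)[OF b])
        show "(LINT x|lborel. indicator Lay x) \<le> 6 * CL * q ^ l"
          using Lay_L1 mult_left_mono[OF d_le, of "6 * CL"] CL by linarith
      qed (use C12 K1 in auto)
      also have "\<dots> = (K4 + (C1 + K1) * (6 * CL)) * q ^ l" by (simp add: algebra_simps)
      also have "\<dots> \<le> C * q ^ l"
        using parts q by (intro mult_right_mono) (auto simp: C_def)
      finally show "(LINT x|lborel. indicator \<Omega> x * \<bar>pd b w x - G b x\<bar>) \<le> C * q ^ l" .
    next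
      fix b b' :: 'a assume b: "b \<in> Basis" "b' \<in> Basis"
      have Vi: "integrable lborel (\<lambda>x. \<bar>pd b' (pd b (V N)) x\<bar>)"
        by (intro integrable_abs pd_pd_V_integrable N)
      have "(LINT x|lborel. \<bar>pd b' (pd b w) x\<bar>)
          \<le> (LINT x|lborel. \<bar>pd b' (pd b (V N)) x\<bar> + C2 * N * indicator Lay x)"
      proof (rule integral_mono)
        show "integrable lborel (\<lambda>x. \<bar>pd b' (pd b w) x\<bar>)" by (intro integrable_abs w2_int b)
        show "integrable lborel (\<lambda>x. \<bar>pd b' (pd b (V N)) x\<bar> + C2 * N * indicator Lay x)"
          by (intro Bochner_Integration.integrable_add integrable_mult_right Vi Lay_int)
      qed (rule w2_bound[OF b])
      also have "\<dots> = (LINT x|lborel. \<bar>pd b' (pd b (V N)) x\<bar>) + C2 * N * (LINT x|lborel. indicator Lay x)"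
        using Vi Lay_int by simp
      also have "\<dots> \<le> K5 * (2 * q) ^ l + C2 * (6 * CL) * (2 * q) ^ l"
      proof (rule add_mono)
        show "(LINT x|lborel. \<bar>pd b' (pd b (V N)) x\<bar>) \<le> K5 * (2 * q) ^ l"
          unfolding N_def by (rule K5(2)[OF b(2,1)])
        \<comment> \<open>Second derivatives of order N on a set of volume of order 1 / N contribute
          a constant, absorbed by (2 q)^l >= 1.\<close>
        have "C2 * N * (LINT x|lborel. indicator Lay x) \<le> C2 * N * (6 * CL * d)"
          using C12 N by (intro mult_left_mono Lay_L1) auto
        also have "\<dots> = C2 * (6 * CL) * 1" using N by (simp add: d_def)
        also have "\<dots> \<le> C2 * (6 * CL) * (2 * q) ^ l"
          using C12 CL by (intro mult_left_mono qq) auto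
        finally show "C2 * N * (LINT x|lborel. indicator Lay x) \<le> C2 * (6 * CL) * (2 * q) ^ l" .
      qed
      also have "\<dots> = (K5 + C2 * (6 * CL)) * (2 * q) ^ l" by (simp add: algebra_simps)
      also have "\<dots> \<le> C * (2 * q) ^ l"
        using parts q by (intro mult_right_mono) (auto simp: C_def)
      finally show "(LINT x|lborel. \<bar>pd b' (pd b w) x\<bar>) \<le> C * (2 * q) ^ l" .
    qed
  qed
  show ?thesis
    by (rule exI[of _ C], rule conjI[OF C0], rule exI[of _ l0]) (use main in blast)
qed

end

section \<open>Admissible competitors\<close>

text \<open>The union in \<open>ess_support\<close> may be uncountable; by Lindelof a countable
  subfamily has the same union, and countably many a.e. statements combine.\<close>

lemma AE_ess_support:
  fixes f :: "'a::euclidean_space \<Rightarrow> 'b::real_normed_vector"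
  shows "AE x in lebesgue. x \<notin> ess_support f \<longrightarrow> f x = 0"
proof -
  let ?F = "{W. open W \<and> (AE x in lebesgue. x \<in> W \<longrightarrow> f x = 0)}"
  obtain F' where F': "F' \<subseteq> ?F" "countable F'" "\<Union>F' = \<Union>?F"
    using Lindelof[of ?F] by blast
  have "AE x in lebesgue. \<forall>W\<in>F'. x \<in> W \<longrightarrow> f x = 0"
    using F' by (subst AE_ball_countable) auto
  moreover have "\<exists>W\<in>F'. x \<in> W" if "x \<notin> ess_support f" for x
  proof -
    have "x \<in> \<Union>F'" using that unfolding F'(3) ess_support_def by auto
    then show ?thesis by blast
  qed
  ultimately show ?thesis
    by (auto elim: eventually_mono)
qed

section \<open>From Lebesgue measurable functions to Borel representatives\<close>

lemma integrable_lebesgue_Borel: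
  fixes f g :: "'a::euclidean_space \<Rightarrow> 'b::{banach,second_countable_topology}"
  assumes "f \<in> borel_measurable lebesgue" "g \<in> borel_measurable borel" "AE x in lborel. f x = g x"
  shows integrable_lebesgue_cong: "integrable lebesgue f \<longleftrightarrow> integrable lborel g"
    and integral_lebesgue_cong: "(LINT x|lebesgue. f x) = (LINT x|lborel. g x)"
proof -
  have g: "g \<in> borel_measurable lborel" using assms(2) by simp
  have ae: "AE x in lebesgue. f x = g x" using assms(3) by (rule AE_completion)
  show "integrable lebesgue f \<longleftrightarrow> integrable lborel g"
    using integrable_cong_AE[OF assms(1) measurable_completion[OF g] ae] integrable_completion[OF g] by simp
  show "(LINT x|lebesgue. f x) = (LINT x|lborel. g x)"
    using integral_cong_AE[OF assms(1) measurable_completion[OF g] ae] integral_completion[OF g] by simp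
qed

lemma complex_Borel_representative:
  fixes f :: "'a::euclidean_space \<Rightarrow> complex"
  assumes "f \<in> borel_measurable lebesgue"
  shows "\<exists>g\<in>borel_measurable borel. AE x in lborel. f x = g x"
proof -
  have m: "(\<lambda>x. Re (f x)) \<in> borel_measurable lebesgue" "(\<lambda>x. Im (f x)) \<in> borel_measurable lebesgue"
    using assms by simp_all
  obtain g where g: "g \<in> borel_measurable lborel" "AE x in lborel. Re (f x) = g x"
    using completion_ex_borel_measurable_real[OF m(1)] by blast
  obtain h where h: "h \<in> borel_measurable lborel" "AE x in lborel. Im (f x) = h x"
    using completion_ex_borel_measurable_real[OF m(2)] by blast
  have [measurable]: "g \<in> borel_measurable borel" "h \<in> borel_measurable borel"
    using g(1) h(1) by simp_all
  have "(\<lambda>x. Complex (g x) (h x)) \<in> borel_measurable borel"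
    by (subst borel_measurable_complex_iff) simp
  moreover have "AE x in lborel. f x = Complex (g x) (h x)"
    using g(2) h(2) by eventually_elim (simp add: complex_eq_iff)
  ultimately show ?thesis by (intro bexI)
qed

lemma locally_integrable_pairing:
  fixes f :: "'a::euclidean_space \<Rightarrow> 'b::euclidean_space" and \<zeta> :: "'a \<Rightarrow> real"
  assumes f: "locally_integrable f" and L: "bounded_linear (L :: 'b \<Rightarrow> real)" and \<zeta>: "test_function UNIV \<zeta>"
  shows "integrable lebesgue (\<lambda>x. L (f x) * \<zeta> x)"
proof -
  obtain S where S: "compact S" "\<And>x. x \<notin> S \<Longrightarrow> \<zeta> x = 0"
    using test_functionD[OF \<zeta>] by metis
  obtain Bz where Bz: "\<And>x. norm (\<zeta> x) \<le> Bz" using test_function_bounded[OF \<zeta>] by blast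
  have "integrable lebesgue (\<lambda>x. indicator S x *\<^sub>R f x)"
    using f S(1) by (auto simp: locally_integrable_def set_integrable_def)
  then have "integrable lebesgue (\<lambda>x. L (indicator S x *\<^sub>R f x))"
    by (rule integrable_bounded_linear[OF L])
  then have "integrable lebesgue (\<lambda>x. L (indicator S x *\<^sub>R f x) * \<zeta> x)"
    using Bz test_function_measurable[OF \<zeta>]
    by (intro integrable_mult_bounded[where B = Bz]) (auto intro: measurable_completion)
  moreover have "L (indicator S x *\<^sub>R f x) * \<zeta> x = L (f x) * \<zeta> x" for x
    using S(2)[of x] by (cases "x \<in> S") auto
  ultimately show ?thesis by simp
qed

lemma set_integrable_continuous_compact:
  fixes f :: "'a::euclidean_space \<Rightarrow> 'b::euclidean_space"
  assumes "continuous_on UNIV f" "compact S"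
  shows "f absolutely_integrable_on S"
proof -
  have "integrable lborel (\<lambda>x. indicator S x *\<^sub>R f x)"
    using borel_integrable_compact[OF assms(2) continuous_on_subset[OF assms(1)]] by simp
  moreover from this have "(\<lambda>x. indicator S x *\<^sub>R f x) \<in> borel_measurable lborel" by simp
  ultimately show ?thesis
    unfolding set_integrable_def by (simp add: integrable_completion)
qed

lemma smooth_test_integrable:
  fixes f \<zeta> :: "'a::euclidean_space \<Rightarrow> real"
  assumes f: "smooth f" and \<zeta>: "test_function \<Omega> \<zeta>"
  shows "integrable lborel (\<lambda>x. f x * \<zeta> x)"
  by (rule test_function_integrable[OF test_function_mult_left[OF f \<zeta>]])

lemma smooth_test_by_parts:
  fixes f \<zeta> :: "'a::euclidean_space \<Rightarrow> real"
  assumes f: "smooth f" and \<zeta>: "test_function \<Omega> \<zeta>" and e: "e \<in> Basis"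
  shows "(LINT x|lborel. f x * pd e \<zeta> x) = - (LINT x|lborel. pd e f x * \<zeta> x)"
proof -
  obtain S where S: "compact S" "\<And>x. x \<notin> S \<Longrightarrow> \<zeta> x = 0" and sm: "smooth \<zeta>"
    using test_functionD[OF \<zeta>] by metis
  have "(LINT x|lborel. f x * pd e \<zeta> x + pd e f x * \<zeta> x) = 0"
  proof (rule integral_derivative_compact_support)
    show "((\<lambda>x. f x * \<zeta> x) has_derivative (\<lambda>h. f x * pd h \<zeta> x + pd h f x * \<zeta> x)) (at x)" for x
      by (rule has_derivative_mult[OF smooth_has_derivative[OF f] smooth_has_derivative[OF sm]])
    show "continuous_on UNIV (\<lambda>x. f x * pd e \<zeta> x + pd e f x * \<zeta> x)"
      by (intro continuous_on_add continuous_on_mult smooth_continuous smooth_pd f sm e)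
    show "compact S" by (rule S)
  qed (simp add: S)
  moreover have "(LINT x|lborel. f x * pd e \<zeta> x + pd e f x * \<zeta> x)
      = (LINT x|lborel. f x * pd e \<zeta> x) + (LINT x|lborel. pd e f x * \<zeta> x)"
    by (intro Bochner_Integration.integral_add smooth_test_integrable[OF f test_function_pd[OF \<zeta> e]]
        smooth_test_integrable[OF smooth_pd[OF f e] \<zeta>])
  ultimately show ?thesis by simp
qed

text \<open>A sum of nonnegative terms dominates each of them, so each block norm is at most a
  constant times N^(-\<sigma>). Only the frequencies 2^l with l >= 0 are recorded, which later
  permits a smaller exponent.\<close>

lemma besov_dyadic_blocks:
  fixes \<phi> :: "'a::euclidean_space \<Rightarrow> real"
  assumes T: "T \<in> besov_space \<phi> \<sigma> 1"
  shows "\<exists>A\<ge>0. \<forall>l::nat. \<exists>f. represents f (LP_projector \<phi> (2 ^ l) T) \<and> integrable lebesgue f \<and>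
    (LINT x|lebesgue. norm (f x)) \<le> A * (2 ^ l) powr (- \<sigma>)"
proof -
  define I where "I = range (\<lambda>j::int. (2::real) powi j)"
  define t where "t N = ennreal (N powr (\<sigma> * 1)) * epowr (dist_Lp_norm 1 (LP_projector \<phi> N T)) 1" for N
  have epowr1: "epowr x 1 = x" for x
    unfolding epowr_def by (cases x) auto
  have "epowr (\<Sum>\<^sub>\<infinity>N\<in>I. t N) (1 / 1) < \<infinity>"
    using T unfolding besov_space_def besov_norm_def I_def t_def by simp
  then have fin: "(\<Sum>\<^sub>\<infinity>N\<in>I. t N) < \<infinity>" by (simp add: epowr1)
  define X where "X = enn2real (\<Sum>\<^sub>\<infinity>N\<in>I. t N)"
  have X: "X \<ge> 0" "(\<Sum>\<^sub>\<infinity>N\<in>I. t N) = ennreal X"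
    using fin by (auto simp: X_def less_top)
  have "\<exists>f. represents f (LP_projector \<phi> (2 ^ l) T) \<and> integrable lebesgue f \<and>
    (LINT x|lebesgue. norm (f x)) \<le> (X + 1) * (2 ^ l) powr (- \<sigma>)" for l :: nat
  proof -
    define N :: real where "N = 2 ^ l"
    have N: "N > 0" by (simp add: N_def)
    have "N \<in> I"
      unfolding I_def N_def by (rule range_eqI[of _ _ "int l"]) simp
    then have "sum t {N} \<le> (SUP F\<in>{F. finite F \<and> F \<subseteq> I}. sum t F)"
      by (intro SUP_upper) auto
    also have "\<dots> = (\<Sum>\<^sub>\<infinity>N\<in>I. t N)"
      by (rule nonneg_infsum_complete[symmetric]) simp
    finally have "t N \<le> ennreal X" by (simp add: X)
    define D where "D = dist_Lp_norm 1 (LP_projector \<phi> N T)"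
    have "ennreal (N powr \<sigma>) * D \<le> ennreal X"
      using \<open>t N \<le> ennreal X\<close> by (simp add: t_def D_def epowr1)
    then have "ennreal (N powr (- \<sigma>)) * (ennreal (N powr \<sigma>) * D) \<le> ennreal (N powr (- \<sigma>)) * ennreal X"
      by (rule mult_left_mono) simp
    also have "ennreal (N powr (- \<sigma>)) * (ennreal (N powr \<sigma>) * D) = D"
    proof -
      have "ennreal (N powr (- \<sigma>)) * ennreal (N powr \<sigma>) = 1"
        using N by (simp flip: ennreal_mult powr_add)
      then show ?thesis by (simp flip: mult.assoc)
    qed
    \<comment> \<open>\<open>dist_Lp_norm\<close> is an infimum; the + 1 creates the strict
      inequality that yields a representing function, also when X = 0.\<close>
    also have "ennreal (N powr (- \<sigma>)) * ennreal X < ennreal ((X + 1) * N powr (- \<sigma>))"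
      using N X(1) by (simp add: ennreal_lessI flip: ennreal_mult)
    finally have "D < ennreal ((X + 1) * N powr (- \<sigma>))" .
    then obtain f where f: "represents f (LP_projector \<phi> N T)" "Lp_norm 1 f < ennreal ((X + 1) * N powr (- \<sigma>))"
      unfolding D_def dist_Lp_norm_def INF_less_iff by blast
    have fm: "f \<in> borel_measurable lebesgue" using f(1) by (simp add: represents_def)
    have nn: "(\<integral>\<^sup>+x. ennreal (norm (f x)) \<partial>lebesgue) \<le> ennreal ((X + 1) * N powr (- \<sigma>))"
      using f(2) by (simp add: Lp_norm_def epowr1)
    have fi: "integrable lebesgue f"
      using nn fm by (intro integrableI_bounded) (auto intro: le_less_trans)
    have "ennreal (LINT x|lebesgue. norm (f x)) \<le> ennreal ((X + 1) * N powr (- \<sigma>))"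
      using nn nn_integral_eq_integral[OF integrable_norm[OF fi]] by simp
    then have "(LINT x|lebesgue. norm (f x)) \<le> (X + 1) * N powr (- \<sigma>)"
      using X(1) by (subst (asm) ennreal_le_iff) auto
    with f fi show ?thesis unfolding N_def by blast
  qed
  with X show ?thesis by (intro exI[of _ "X + 1"]) auto
qed

section \<open>Affine maps perturbed by test functions\<close>

lemma axis_Basis: "axis j (1::real) \<in> Basis"
  by (simp add: axis_in_Basis_iff)

lemma bounded_linear_vec_nth2: "bounded_linear (\<lambda>x::real^'n^'m. x $ i $ j)"
  by (intro bounded_linear_compose[OF bounded_linear_vec_nth] bounded_linear_vec_nth)

lemma norm_matrix_le_sum: "norm (A :: real^'n^'m) \<le> (\<Sum>i\<in>UNIV. \<Sum>j\<in>UNIV. \<bar>A $ i $ j\<bar>)"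
proof -
  have "norm A \<le> (\<Sum>i\<in>UNIV. norm (A $ i))" unfolding norm_vec_def[of A] by (rule L2_set_le_sum) simp
  also have "\<dots> \<le> (\<Sum>i\<in>UNIV. \<Sum>j\<in>UNIV. \<bar>A $ i $ j\<bar>)"
    by (intro sum_mono norm_le_l1_cart)
  finally show ?thesis .
qed

definition competitor_map :: "real^'n^'n \<Rightarrow> ('n \<Rightarrow> real^'n \<Rightarrow> real) \<Rightarrow> real^'n \<Rightarrow> real^'n" where
  "competitor_map M w = (\<lambda>x. M *v x + (\<chi> i. w i x))"

definition competitor_grad :: "real^'n^'n \<Rightarrow> ('n \<Rightarrow> real^'n \<Rightarrow> real) \<Rightarrow> real^'n \<Rightarrow> real^'n^'n" where
  "competitor_grad M w = (\<lambda>x. \<chi> i j. M $ i $ j + pd (axis j 1) (w i) x)"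

lemma smooth_matrix_component: "smooth (\<lambda>x. (M *v x) $ (i::'n))" for M :: "real^'m^'n"
  by (intro smooth_bounded_linear bounded_linear_compose[OF bounded_linear_vec_nth]) (simp add: matrix_vector_mul_bounded_linear)

lemma pd_matrix_component: "pd (axis j 1) (\<lambda>x. (M *v x) $ i) x = M $ i $ j" for M :: "real^'m^'n"
proof -
  have "bounded_linear (\<lambda>x. (M *v x) $ i)"
    by (intro bounded_linear_compose[OF bounded_linear_vec_nth]) (simp add: matrix_vector_mul_bounded_linear)
  from pd_eq[OF bounded_linear_imp_has_derivative[OF this]] show ?thesis
    by (simp add: matrix_vector_mult_basis column_def)
qed

lemma affine_weak_gradient:
  fixes M :: "real^'n^'n" and \<zeta> :: "real^'n \<Rightarrow> real"
  assumes \<zeta>: "test_function UNIV \<zeta>"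
  shows "(LINT x|lborel. ((M *v x) $ i + c) * pd (axis j 1) \<zeta> x) = - (LINT x|lborel. M $ i $ j * \<zeta> x)"
proof -
  have "pd (axis j 1) (\<lambda>x. (M *v x) $ i + c) x = M $ i $ j" for x
    using pd_add[OF smooth_matrix_component smooth_const, of M i c x "axis j 1"]
    by (simp add: pd_matrix_component pd_eq[OF has_derivative_const])
  then show ?thesis
    using smooth_test_by_parts[OF smooth_add[OF smooth_matrix_component smooth_const] \<zeta> axis_Basis, of M i c j] by simp
qed

context
  fixes \<Omega> :: "(real^'n) set" and M :: "real^'n^'n" and w :: "'n \<Rightarrow> real^'n \<Rightarrow> real"
  assumes \<Omega>: "open \<Omega>" "bounded \<Omega>" and w: "\<And>i. test_function \<Omega> (w i)"
begin

lemma competitor_component_smooth: "smooth (\<lambda>x. competitor_map M w x $ i)"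
  using smooth_add[OF smooth_matrix_component test_function_smooth[OF w]] by (simp add: competitor_map_def)

lemma competitor_component_pd: "pd (axis j 1) (\<lambda>x. competitor_map M w x $ i) x = competitor_grad M w x $ i $ j"
  using pd_add[OF smooth_matrix_component test_function_smooth[OF w], of M i i x "axis j 1"]
  by (simp add: competitor_map_def competitor_grad_def pd_matrix_component)

lemma competitor_grad_smooth: "smooth (\<lambda>x. competitor_grad M w x $ i $ j)"
  unfolding competitor_component_pd[symmetric] by (intro smooth_pd competitor_component_smooth axis_Basis)

lemma competitor_grad_pd:
  "pd (axis k 1) (\<lambda>x. competitor_grad M w x $ i $ j) x = pd (axis k 1) (pd (axis j 1) (w i)) x"
  using pd_add[OF smooth_const smooth_pd[OF test_function_smooth[OF w] axis_Basis], of "M $ i $ j" i j x "axis k 1"]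
  by (simp add: competitor_grad_def pd_eq[OF has_derivative_const])

lemma competitor_continuous: "continuous_on S (competitor_map M w)"
proof -
  have "continuous_on S (\<lambda>x. \<chi> i. competitor_map M w x $ i)"
    by (intro continuous_on_vec_lambda smooth_continuous competitor_component_smooth)
  then show ?thesis by simp
qed

lemma competitor_grad_continuous: "continuous_on S (competitor_grad M w)"
proof -
  have "continuous_on S (\<lambda>x. \<chi> i j. competitor_grad M w x $ i $ j)"
    by (intro continuous_on_vec_lambda smooth_continuous competitor_grad_smooth)
  then show ?thesis by simp
qed

lemma competitor_weak_gradient: "has_weak_gradient (competitor_map M w) (competitor_grad M w)"
  unfolding has_weak_gradient_def locally_integrable_def
proof (intro conjI allI impI)
  fix \<zeta> :: "real^'n \<Rightarrow> real" and i j assume \<zeta>: "test_function UNIV \<zeta>"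
  have "(LINT x|lborel. competitor_map M w x $ i * pd (axis j 1) \<zeta> x) = - (LINT x|lborel. competitor_grad M w x $ i $ j * \<zeta> x)"
    using smooth_test_by_parts[OF competitor_component_smooth \<zeta> axis_Basis, of i j]
    by (simp add: competitor_component_pd)
  moreover have "(\<lambda>x. competitor_map M w x $ i * pd (axis j 1) \<zeta> x) \<in> borel_measurable lborel"
    using smooth_test_integrable[OF competitor_component_smooth test_function_pd[OF \<zeta> axis_Basis]] by (rule borel_measurable_integrable)
  moreover have "(\<lambda>x. competitor_grad M w x $ i $ j * \<zeta> x) \<in> borel_measurable lborel"
    using smooth_test_integrable[OF competitor_grad_smooth \<zeta>] by (rule borel_measurable_integrable)
  ultimately show "(LINT x|lebesgue. competitor_map M w x $ i * pd (axis j 1) \<zeta> x)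
      = - (LINT x|lebesgue. competitor_grad M w x $ i $ j * \<zeta> x)"
    by (simp add: integral_completion)
qed (intro set_integrable_continuous_compact competitor_continuous competitor_grad_continuous; assumption)+

text \<open>Integration by parts moves the divergence from \<open>\<Phi>\<close> to the gradient
  without a boundary term, since \<open>\<Phi>\<close> has compact support in
  \<open>\<Omega>\<close>; each entry of \<open>\<Phi>\<close> is at most 1 in absolute
  value.\<close>

lemma competitor_total_variation:
  "total_variation \<Omega> (competitor_grad M w) \<le>
     ennreal (\<Sum>i\<in>UNIV. \<Sum>j\<in>UNIV. \<Sum>k\<in>UNIV. LINT x|lborel. \<bar>pd (axis k 1) (pd (axis j 1) (w i)) x\<bar>)"
  unfolding total_variation_def
proof (rule SUP_least)
  fix \<Phi> :: "real^'n \<Rightarrow> real^'n^'n^'n"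
  assume "\<Phi> \<in> {\<Phi>. test_function \<Omega> \<Phi> \<and> (\<forall>x. norm (\<Phi> x) \<le> 1)}"
  then have \<Phi>: "test_function \<Omega> \<Phi>" and \<Phi>1: "\<And>x. norm (\<Phi> x) \<le> 1" by auto
  let ?G = "competitor_grad M w"
  define \<zeta> where "\<zeta> i j k x = \<Phi> x $ i $ j $ k" for i j k x
  have bl: "bounded_linear (\<lambda>y::real^'n^'n^'n. y $ i $ j $ k)" for i j k
    by (intro bounded_linear_compose[OF bounded_linear_vec_nth] bounded_linear_vec_nth)
  have \<zeta>: "test_function \<Omega> (\<zeta> i j k)" for i j k
    unfolding \<zeta>_def by (rule test_function_linear[OF \<Phi> bl])
  have \<zeta>1: "\<bar>\<zeta> i j k x\<bar> \<le> 1" for i j k x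
  proof -
    have "\<bar>\<zeta> i j k x\<bar> \<le> norm (\<Phi> x $ i $ j)" unfolding \<zeta>_def by (rule component_le_norm_cart)
    also have "\<dots> \<le> norm (\<Phi> x $ i)" by (rule Finite_Cartesian_Product.norm_nth_le)
    also have "\<dots> \<le> norm (\<Phi> x)" by (rule Finite_Cartesian_Product.norm_nth_le)
    finally show ?thesis using \<Phi>1[of x] by simp
  qed
  have pd\<zeta>: "pd e \<Phi> x $ i $ j $ k = pd e (\<zeta> i j k) x" for e i j k x
    using pd_eq[OF bounded_linear.has_derivative[OF bl smooth_has_derivative[OF test_function_smooth[OF \<Phi>]]]]
    by (simp add: \<zeta>_def[abs_def])
  define F where "F x = (\<Sum>i\<in>UNIV. \<Sum>j\<in>UNIV. \<Sum>k\<in>UNIV. ?G x $ i $ j * pd (axis k 1) (\<zeta> i j k) x)" for x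
  have F_eq: "(\<Sum>i\<in>UNIV. \<Sum>j\<in>UNIV. ?G x $ i $ j * (\<Sum>k\<in>UNIV. pd (axis k 1) \<Phi> x $ i $ j $ k)) = F x" for x
    by (simp add: F_def pd\<zeta> sum_distrib_left)
  have int: "integrable lborel (\<lambda>x. ?G x $ i $ j * pd (axis k 1) (\<zeta> i j k) x)" for i j k
    by (rule smooth_test_integrable[OF competitor_grad_smooth test_function_pd[OF \<zeta> axis_Basis]])
  have term_le: "(LINT x|lborel. ?G x $ i $ j * pd (axis k 1) (\<zeta> i j k) x)
      \<le> (LINT x|lborel. \<bar>pd (axis k 1) (pd (axis j 1) (w i)) x\<bar>)" for i j k
  proof -
    have t2: "test_function \<Omega> (pd (axis k 1) (pd (axis j 1) (w i)))"
      by (intro test_function_pd w axis_Basis)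
    have "(LINT x|lborel. ?G x $ i $ j * pd (axis k 1) (\<zeta> i j k) x)
        = (LINT x|lborel. - (pd (axis k 1) (pd (axis j 1) (w i)) x * \<zeta> i j k x))"
      using smooth_test_by_parts[OF competitor_grad_smooth \<zeta> axis_Basis, of i j i j k k]
      by (simp add: competitor_grad_pd)
    also have "\<dots> \<le> (LINT x|lborel. \<bar>pd (axis k 1) (pd (axis j 1) (w i)) x\<bar>)"
    proof (rule integral_mono)
      show "integrable lborel (\<lambda>x. - (pd (axis k 1) (pd (axis j 1) (w i)) x * \<zeta> i j k x))"
        by (intro integrable_minus smooth_test_integrable[OF test_function_smooth[OF t2] \<zeta>])
      show "integrable lborel (\<lambda>x. \<bar>pd (axis k 1) (pd (axis j 1) (w i)) x\<bar>)"
        by (intro integrable_abs test_function_integrable[OF t2])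
      show "- (pd (axis k 1) (pd (axis j 1) (w i)) x * \<zeta> i j k x) \<le> \<bar>pd (axis k 1) (pd (axis j 1) (w i)) x\<bar>" for x
        using mult_left_mono[OF \<zeta>1[of i j k x], of "\<bar>pd (axis k 1) (pd (axis j 1) (w i)) x\<bar>"]
        by (simp flip: abs_mult)
    qed
    finally show ?thesis .
  qed
  have Fint: "integrable lborel F" unfolding F_def by (intro Bochner_Integration.integrable_sum int)
  have F0: "F x = 0" if "x \<notin> \<Omega>" for x
  proof -
    obtain S where "S \<subseteq> \<Omega>" "\<And>x e. x \<notin> S \<Longrightarrow> pd e \<Phi> x = 0"
      using test_functionD[OF \<Phi>] by metis
    with that have "pd e \<Phi> x = 0" for e by blast
    then show ?thesis unfolding F_eq[symmetric] by simp
  qed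
  have "(LINT x:\<Omega>|lebesgue. F x) = (LINT x|lebesgue. F x)"
    unfolding set_lebesgue_integral_def using F0 by (intro Bochner_Integration.integral_cong) (auto simp: indicator_def)
  also have "\<dots> = (LINT x|lborel. F x)"
    using Fint by (intro integral_completion) simp
  also have "\<dots> = (\<Sum>i\<in>UNIV. \<Sum>j\<in>UNIV. \<Sum>k\<in>UNIV. LINT x|lborel. ?G x $ i $ j * pd (axis k 1) (\<zeta> i j k) x)"
    unfolding F_def by (simp add: int)
  also have "\<dots> \<le> (\<Sum>i\<in>UNIV. \<Sum>j\<in>UNIV. \<Sum>k\<in>UNIV. LINT x|lborel. \<bar>pd (axis k 1) (pd (axis j 1) (w i)) x\<bar>)"
    by (intro sum_mono term_le)
  finally show "ennreal (LINT x:\<Omega>|lebesgue. (\<Sum>i\<in>UNIV. \<Sum>j\<in>UNIV. ?G x $ i $ j * (\<Sum>k\<in>UNIV. pd (axis k 1) \<Phi> x $ i $ j $ k)))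
      \<le> ennreal (\<Sum>i\<in>UNIV. \<Sum>j\<in>UNIV. \<Sum>k\<in>UNIV. LINT x|lborel. \<bar>pd (axis k 1) (pd (axis j 1) (w i)) x\<bar>)"
    unfolding F_eq by (rule ennreal_leI)
qed

lemma competitor_admissible: "(competitor_map M w, competitor_grad M w) \<in> admissible \<Omega> M"
proof -
  have L2: "locally_L2 f" if "continuous_on UNIV f" for f :: "real^'n \<Rightarrow> 'b::euclidean_space"
    unfolding locally_L2_def
  proof (intro conjI allI impI)
    show "f \<in> borel_measurable lebesgue"
      using borel_measurable_continuous_onI[OF that] by (intro measurable_completion) simp
    show "(\<lambda>x. (norm (f x))\<^sup>2) absolutely_integrable_on S" if "compact S" for S
      using \<open>continuous_on UNIV f\<close> by (intro set_integrable_continuous_compact that continuous_intros)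
  qed
  have "competitor_grad M w x = M" if "x \<notin> closure \<Omega>" for x
  proof -
    have "pd e (w i) x = 0" for e i
      using that test_functionD[OF w[of i]] closure_subset[of \<Omega>] by (metis subsetD)
    then show ?thesis by (simp add: competitor_grad_def vec_eq_iff)
  qed
  moreover have "competitor_grad M w absolutely_integrable_on \<Omega>"
  proof (rule set_integrable_subset)
    show "competitor_grad M w absolutely_integrable_on closure \<Omega>"
      using \<Omega> by (intro set_integrable_continuous_compact competitor_grad_continuous) (simp add: compact_closure)
    show "\<Omega> \<subseteq> closure \<Omega>" by (rule closure_subset)
  qed (use \<Omega> in auto)
  moreover have "total_variation \<Omega> (competitor_grad M w) < \<infinity>"
    using competitor_total_variation by (rule le_less_trans) simp
  ultimately show ?thesis
    using competitor_weak_gradient L2[OF competitor_continuous] L2[OF competitor_grad_continuous]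
    by (auto simp: admissible_def BV_on_def)
qed

end

section \<open>Energy scaling\<close>

lemma borel_measurable_lebesgue_times:
  fixes f g :: "'a::euclidean_space \<Rightarrow> 'b::{real_normed_algebra,second_countable_topology}"
  assumes "f \<in> borel_measurable lebesgue" "g \<in> borel_measurable borel"
  shows "(\<lambda>x. f x * g x) \<in> borel_measurable lebesgue"
proof -
  have "g \<in> borel_measurable lebesgue" using assms(2) by (intro measurable_completion) simp
  with assms(1) show ?thesis by (rule borel_measurable_times)
qed

text \<open>Local integrability gives measurability on closed balls; the truncations to balls of
  radius n converge pointwise.\<close>

lemma locally_integrable_measurable:
  fixes f :: "'a::euclidean_space \<Rightarrow> 'b::euclidean_space"
  assumes "locally_integrable f"
  shows "f \<in> borel_measurable lebesgue"
proof (rule borel_measurable_LIMSEQ_metric)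
  show "(\<lambda>x. indicator (cball 0 (real n)) x *\<^sub>R f x) \<in> borel_measurable lebesgue" for n :: nat
    using assms compact_cball[of "0::'a" "real n"]
    unfolding locally_integrable_def set_integrable_def by (blast intro: borel_measurable_integrable)
  fix x :: 'a
  obtain n0 :: nat where "norm x \<le> real n0" using real_arch_simple by blast
  then have "\<forall>n\<ge>n0. indicator (cball 0 (real n)) x *\<^sub>R f x = f x"
    by (auto simp: indicator_def)
  then show "(\<lambda>n. indicator (cball 0 (real n)) x *\<^sub>R f x) \<longlonglongrightarrow> f x"
    by (intro tendsto_eventually) (auto simp: eventually_sequentially)
qed

lemma AE_zero_of_test_pairings_lebesgue:
  fixes f :: "'a::euclidean_space \<Rightarrow> real"
  assumes \<phi>: "LP_bump (\<phi> :: 'a \<Rightarrow> real)" and f: "f \<in> borel_measurable lebesgue"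
    and loc: "\<And>S. compact S \<Longrightarrow> f absolutely_integrable_on S"
    and test: "\<And>\<zeta>. test_function UNIV \<zeta> \<Longrightarrow> (LINT x|lebesgue. f x * \<zeta> x) = 0"
  shows "AE x in lborel. f x = 0"
proof -
  obtain g where g: "g \<in> borel_measurable lborel" and ae: "AE x in lborel. f x = g x"
    using completion_ex_borel_measurable_real[OF f] by blast
  have gm [measurable]: "g \<in> borel_measurable borel" using g by simp
  have "AE x in lborel. g x = 0"
  proof (rule AE_zero_of_test_pairings[OF \<phi> gm])
    fix S :: "'a set" assume S: "compact S"
    have [measurable]: "S \<in> sets borel" using S by (rule borel_compact)
    have "AE x in lborel. indicator S x *\<^sub>R f x = indicator S x *\<^sub>R g x"
      using ae by eventually_elim simp
    moreover have i: "integrable lebesgue (\<lambda>x. indicator S x *\<^sub>R f x)"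
      using loc[OF S] by (simp add: set_integrable_def)
    moreover have "(\<lambda>x. indicator S x *\<^sub>R g x) \<in> borel_measurable borel" by measurable
    ultimately show "set_integrable lborel S g"
      unfolding set_integrable_def using integrable_lebesgue_cong[OF borel_measurable_integrable[OF i]] by blast
  next
    fix \<zeta> :: "'a \<Rightarrow> real" assume \<zeta>: "test_function UNIV \<zeta>"
    have \<zeta>m [measurable]: "\<zeta> \<in> borel_measurable borel" by (rule test_function_measurable[OF \<zeta>])
    have "(LINT x|lebesgue. f x * \<zeta> x) = (LINT x|lborel. g x * \<zeta> x)"
    proof (rule integral_lebesgue_cong)
      show "(\<lambda>x. f x * \<zeta> x) \<in> borel_measurable lebesgue"
        by (rule borel_measurable_lebesgue_times[OF f \<zeta>m])
      show "AE x in lborel. f x * \<zeta> x = g x * \<zeta> x" using ae by eventually_elim simp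
    qed measurable
    then show "(LINT x|lborel. g x * \<zeta> x) = 0" using test[OF \<zeta>] by simp
  qed
  with ae show ?thesis by eventually_elim simp
qed

text \<open>Brings one component of \<open>v\<close> into the form of \<open>besov_data\<close>. By
  uniqueness of weak gradients \<open>Gv\<close> and Gu - M agree a.e. in that component:
  boundedness comes from \<open>Gv\<close>, vanishing outside the closure from
  \<open>Gu\<close>.\<close>

lemma component_competitor:
  fixes \<Omega> :: "(real^'n) set" and M :: "real^'n^'n" and \<phi> :: "real^'n \<Rightarrow> real"
    and u v :: "real^'n \<Rightarrow> real^'n" and b :: "real^'n" and i :: 'n
  assumes \<phi>: "LP_bump \<phi>" and \<Omega>: "bounded_C11_domain \<Omega>"
    and Gu: "has_weak_gradient u Gu" and GuM: "AE x in lebesgue. x \<notin> closure \<Omega> \<longrightarrow> Gu x = M"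
    and vu: "\<And>x. v x = u x - M *v x - b"
    and supp: "ess_support v \<subseteq> closure \<Omega>"
    and Gv: "has_weak_gradient v Gv" and Gv_bound: "AE x in lebesgue. norm (Gv x) \<le> B"
    and T: "T \<in> besov_space \<phi> (1 + s) 1" "represents (\<lambda>x. of_real (v x $ i)) T"
    and \<sigma>: "0 < \<sigma>" "\<sigma> < 1" "\<sigma> \<le> s"
  defines "q \<equiv> 2 powr (- \<sigma>)"
  shows "\<exists>C\<ge>0. \<exists>l0. \<forall>l\<ge>l0. \<exists>w. test_function \<Omega> w \<and>
     (\<forall>j. AE x in lebesgue. x \<in> \<Omega> \<longrightarrow> \<bar>pd (axis j 1) w x - (Gu x - M) $ i $ j\<bar> \<le> C) \<and>
     (\<forall>j. (\<integral>\<^sup>+x\<in>\<Omega>. ennreal \<bar>pd (axis j 1) w x - (Gu x - M) $ i $ j\<bar> \<partial>lebesgue) \<le> ennreal (C * q ^ l)) \<and>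
     (\<forall>j k. (LINT x|lborel. \<bar>pd (axis k 1) (pd (axis j 1) w) x\<bar>) \<le> C * (2 * q) ^ l)"
proof -
  have q: "1 / 2 < q" "q < 1"
  proof -
    have "2 powr (-1) < (2 :: real) powr (- \<sigma>)" using \<sigma> by (intro powr_less_mono) auto
    moreover have "(2 :: real) powr (-1) = 1 / 2" by (subst powr_minus) simp
    ultimately show "1 / 2 < q" unfolding q_def by linarith
    have "(2 :: real) powr (- \<sigma>) < 2 powr 0" using \<sigma> by (intro powr_less_mono) auto
    then show "q < 1" unfolding q_def by simp
  qed
  have locu: "locally_integrable u" and locGu: "locally_integrable Gu"
    and weaku: "\<And>\<zeta> i j. test_function UNIV \<zeta> \<Longrightarrow> (LINT x|lebesgue. u x $ i * pd (axis j 1) \<zeta> x) = - (LINT x|lebesgue. Gu x $ i $ j * \<zeta> x)"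
    using Gu unfolding has_weak_gradient_def by blast+
  have locv: "locally_integrable v" and locGv: "locally_integrable Gv"
    and weakv: "\<And>\<zeta> i j. test_function UNIV \<zeta> \<Longrightarrow> (LINT x|lebesgue. v x $ i * pd (axis j 1) \<zeta> x) = - (LINT x|lebesgue. Gv x $ i $ j * \<zeta> x)"
    using Gv unfolding has_weak_gradient_def by blast+
  have comp: "compact (closure \<Omega>)" using \<Omega> by (simp add: bounded_C11_domain_def compact_closure)
  note bl1 = bounded_linear_vec_nth[of i] and bl2 = bounded_linear_vec_nth2[of i]
  have nth_meas: "(\<lambda>x. A x $ i $ j) \<in> borel_measurable lebesgue" if "locally_integrable A" for A :: "real^'n \<Rightarrow> real^'n^'n" and j
    by (rule borel_measurable_continuous_on[OF linear_continuous_on[OF bl2] locally_integrable_measurable[OF that]])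
  have Gv_eq: "AE x in lborel. Gv x $ i $ j - (Gu x $ i $ j - M $ i $ j) = 0" for j
  proof (rule AE_zero_of_test_pairings_lebesgue[OF \<phi>])
    show "(\<lambda>x. Gv x $ i $ j - (Gu x $ i $ j - M $ i $ j)) \<in> borel_measurable lebesgue"
      using nth_meas[OF locGv] nth_meas[OF locGu] by (intro borel_measurable_diff borel_measurable_const)
  next
    fix S :: "(real^'n) set" assume S: "compact S"
    have "(\<lambda>x. A x $ i $ j) absolutely_integrable_on S" if "locally_integrable A" for A :: "real^'n \<Rightarrow> real^'n^'n"
      using absolutely_integrable_linear[OF _ bl2[of j]] that S
      unfolding locally_integrable_def o_def by blast
    then have "(\<lambda>x. Gv x $ i $ j) absolutely_integrable_on S" "(\<lambda>x. Gu x $ i $ j) absolutely_integrable_on S"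
      using locGv locGu by blast+
    moreover have "(\<lambda>x. M $ i $ j) absolutely_integrable_on S"
      using S by (intro set_integrable_continuous_compact continuous_on_const)
    ultimately show "(\<lambda>x. Gv x $ i $ j - (Gu x $ i $ j - M $ i $ j)) absolutely_integrable_on S"
      by (intro set_integral_diff)
  next
    fix \<zeta> :: "real^'n \<Rightarrow> real" assume \<zeta>: "test_function UNIV \<zeta>"
    note pd\<zeta> = test_function_pd[OF \<zeta> axis_Basis, of j]
    have i1: "integrable lebesgue (\<lambda>x. u x $ i * pd (axis j 1) \<zeta> x)"
      by (rule locally_integrable_pairing[OF locu bl1 pd\<zeta>])
    have i2: "integrable lebesgue (\<lambda>x. Gu x $ i $ j * \<zeta> x)" "integrable lebesgue (\<lambda>x. Gv x $ i $ j * \<zeta> x)"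
      by (rule locally_integrable_pairing[OF _ bl2 \<zeta>]; fact)+
    have b3: "integrable lborel (\<lambda>x. ((M *v x) $ i + b $ i) * pd (axis j 1) \<zeta> x)"
      by (rule smooth_test_integrable[OF smooth_add[OF smooth_matrix_component smooth_const] pd\<zeta>])
    have b4: "integrable lborel (\<lambda>x. M $ i $ j * \<zeta> x)"
      by (rule smooth_test_integrable[OF smooth_const \<zeta>])
    have i3: "integrable lebesgue (\<lambda>x. ((M *v x) $ i + b $ i) * pd (axis j 1) \<zeta> x)"
      using b3 by (subst integrable_completion) (auto dest: borel_measurable_integrable)
    have i4: "integrable lebesgue (\<lambda>x. M $ i $ j * \<zeta> x)"
      using b4 by (subst integrable_completion) (auto dest: borel_measurable_integrable)
    have aff: "(LINT x|lebesgue. ((M *v x) $ i + b $ i) * pd (axis j 1) \<zeta> x) = - (LINT x|lebesgue. M $ i $ j * \<zeta> x)"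
      using affine_weak_gradient[OF \<zeta>, of M i "b $ i" j]
        integral_completion[OF borel_measurable_integrable[OF b3]] integral_completion[OF borel_measurable_integrable[OF b4]]
      by (simp only:)
    have "(LINT x|lebesgue. v x $ i * pd (axis j 1) \<zeta> x)
        = (LINT x|lebesgue. u x $ i * pd (axis j 1) \<zeta> x - ((M *v x) $ i + b $ i) * pd (axis j 1) \<zeta> x)"
      by (simp add: vu algebra_simps)
    also have "\<dots> = (LINT x|lebesgue. u x $ i * pd (axis j 1) \<zeta> x) - (LINT x|lebesgue. ((M *v x) $ i + b $ i) * pd (axis j 1) \<zeta> x)"
      by (rule Bochner_Integration.integral_diff[OF i1 i3])
    finally have "(LINT x|lebesgue. Gv x $ i $ j * \<zeta> x) - ((LINT x|lebesgue. Gu x $ i $ j * \<zeta> x) - (LINT x|lebesgue. M $ i $ j * \<zeta> x)) = 0"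
      unfolding weaku[OF \<zeta>] weakv[OF \<zeta>] aff by simp
    moreover have "(LINT x|lebesgue. (Gv x $ i $ j - (Gu x $ i $ j - M $ i $ j)) * \<zeta> x)
        = (LINT x|lebesgue. Gv x $ i $ j * \<zeta> x - (Gu x $ i $ j * \<zeta> x - M $ i $ j * \<zeta> x))"
      by (simp add: left_diff_distrib)
    moreover have "\<dots> = (LINT x|lebesgue. Gv x $ i $ j * \<zeta> x) - (LINT x|lebesgue. Gu x $ i $ j * \<zeta> x - M $ i $ j * \<zeta> x)"
      by (intro Bochner_Integration.integral_diff Bochner_Integration.integrable_diff i2 i4)
    moreover have "(LINT x|lebesgue. Gu x $ i $ j * \<zeta> x - M $ i $ j * \<zeta> x) = (LINT x|lebesgue. Gu x $ i $ j * \<zeta> x) - (LINT x|lebesgue. M $ i $ j * \<zeta> x)"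
      by (intro Bochner_Integration.integral_diff i2 i4)
    ultimately show "(LINT x|lebesgue. (Gv x $ i $ j - (Gu x $ i $ j - M $ i $ j)) * \<zeta> x) = 0" by linarith
  qed
  define Rep where "Rep j h \<longleftrightarrow> h \<in> borel_measurable borel \<and> (AE x in lborel. Gv x $ i $ j = h x)"
    for j and h :: "real^'n \<Rightarrow> real"
  have "\<exists>h. Rep j h" for j
    using completion_ex_borel_measurable_real[OF nth_meas[OF locGv, of j]] by (auto simp: Rep_def)
  then obtain h where "\<And>j. Rep j (h j)" by metis
  then have h [measurable]: "\<And>j. h j \<in> borel_measurable borel" and h_eq: "\<And>j. AE x in lborel. Gv x $ i $ j = h j x"
    by (auto simp: Rep_def)
  \<comment> \<open>\<open>besov_data\<close> indexes partial derivatives by basis vectors, not by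
    coordinates; the choice recovers the coordinate.\<close>
  define H where "H e = h (SOME j. e = axis j 1)" for e :: "real^'n"
  have H_axis: "H (axis j 1) = h j" for j
    unfolding H_def by (simp add: axis_eq_axis)
  have Basis_axis: "\<exists>j. e = axis j 1" if "e \<in> Basis" for e :: "real^'n"
    using that by (auto simp: Basis_vec_def)
  have vm: "(\<lambda>x. v x $ i) \<in> borel_measurable lebesgue"
    by (rule borel_measurable_continuous_on[OF linear_continuous_on[OF bl1] locally_integrable_measurable[OF locv]])
  obtain v' where v'_meas: "v' \<in> borel_measurable lborel" and v'_eq: "AE x in lborel. v x $ i = v' x"
    using completion_ex_borel_measurable_real[OF vm] by blast
  have v'm [measurable]: "v' \<in> borel_measurable borel" using v'_meas by simp
  have v0: "AE x in lborel. x \<notin> closure \<Omega> \<longrightarrow> v x = 0"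
    using AE_ess_support[of v] supp unfolding AE_completion_iff by (auto elim!: eventually_mono)
  have v'_int: "integrable lborel v'"
  proof -
    have "integrable lebesgue (\<lambda>x. (indicator (closure \<Omega>) x *\<^sub>R v x) $ i)"
      using locv comp unfolding locally_integrable_def set_integrable_def
      by (intro integrable_bounded_linear[OF bl1]) auto
    moreover have "AE x in lborel. (indicator (closure \<Omega>) x *\<^sub>R v x) $ i = v' x"
      using v'_eq v0 by eventually_elim (auto simp: indicator_def)
    ultimately show ?thesis
      using integrable_lebesgue_cong[OF borel_measurable_integrable v'm] by blast
  qed
  obtain A where A: "A \<ge> 0" and blocks: "\<And>l::nat. \<exists>f. represents f (LP_projector \<phi> (2 ^ l) T) \<and> integrable lebesgue f \<and>
    (LINT x|lebesgue. norm (f x)) \<le> A * (2 ^ l) powr (- (1 + s))"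
    using besov_dyadic_blocks[OF T(1)] by blast
  have pairing_conv: "(LINT x|lebesgue. f x * fourier g x) = (LINT x|lborel. f' x * fourier g x)"
    if "f \<in> borel_measurable lebesgue" "f' \<in> borel_measurable borel" "AE x in lborel. f x = f' x" "test_function UNIV g"
    for f f' :: "real^'n \<Rightarrow> complex" and g
  proof (rule integral_lebesgue_cong)
    have F: "fourier g \<in> borel_measurable borel" using fourier_integrable[OF that(4)] by auto
    show "(\<lambda>x. f x * fourier g x) \<in> borel_measurable lebesgue"
      by (rule borel_measurable_lebesgue_times[OF that(1) F])
    show "(\<lambda>x. f' x * fourier g x) \<in> borel_measurable borel" using that(2) F by simp
    show "AE x in lborel. f x * fourier g x = f' x * fourier g x" using that(3) by eventually_elim simp
  qed
  interpret besov_data \<phi> v' H \<Omega> B A q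
  proof
    show "LP_bump \<phi>" "bounded_C11_domain \<Omega>" "integrable lborel v'" "1 / 2 < q" "q < 1" "A \<ge> 0" by fact+
    show "AE x in lborel. x \<notin> closure \<Omega> \<longrightarrow> v' x = 0"
      using v'_eq v0 by eventually_elim (metis zero_index)
  next
    fix e :: "real^'n" assume "e \<in> Basis"
    then obtain j where e: "e = axis j 1" using Basis_axis by blast
    show "H e \<in> borel_measurable borel" by (simp add: e H_axis)
    show "AE x in lborel. \<bar>H e x\<bar> \<le> B"
      using h_eq[of j] Gv_bound[unfolded AE_completion_iff]
    proof eventually_elim
      case (elim x)
      have "\<bar>Gv x $ i $ j\<bar> \<le> norm (Gv x)"
        using component_le_norm_cart[of "Gv x $ i" j] Finite_Cartesian_Product.norm_nth_le[of "Gv x" i] by linarith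
      with elim show ?case by (simp add: e H_axis)
    qed
    show "AE x in lborel. x \<notin> closure \<Omega> \<longrightarrow> H e x = 0"
      using h_eq[of j] Gv_eq[of j] GuM[unfolded AE_completion_iff]
      by eventually_elim (auto simp: e H_axis)
    fix \<zeta> :: "real^'n \<Rightarrow> real" assume \<zeta>: "test_function UNIV \<zeta>"
    have [measurable]: "\<zeta> \<in> borel_measurable borel" "pd e \<zeta> \<in> borel_measurable borel"
      using test_function_measurable[OF \<zeta>] test_function_measurable[OF test_function_pd[OF \<zeta> \<open>e \<in> Basis\<close>]] .
    have "(LINT x|lebesgue. v x $ i * pd e \<zeta> x) = (LINT x|lborel. v' x * pd e \<zeta> x)"
    proof (rule integral_lebesgue_cong)
      show "(\<lambda>x. v x $ i * pd e \<zeta> x) \<in> borel_measurable lebesgue"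
        by (rule borel_measurable_lebesgue_times[OF vm]) measurable
      show "AE x in lborel. v x $ i * pd e \<zeta> x = v' x * pd e \<zeta> x" using v'_eq by eventually_elim simp
    qed measurable
    moreover have "(LINT x|lebesgue. Gv x $ i $ j * \<zeta> x) = (LINT x|lborel. H e x * \<zeta> x)"
    proof (rule integral_lebesgue_cong)
      show "(\<lambda>x. Gv x $ i $ j * \<zeta> x) \<in> borel_measurable lebesgue"
        by (rule borel_measurable_lebesgue_times[OF nth_meas[OF locGv]]) measurable
      show "(\<lambda>x. H e x * \<zeta> x) \<in> borel_measurable borel" unfolding e H_axis by measurable
      show "AE x in lborel. Gv x $ i $ j * \<zeta> x = H e x * \<zeta> x" using h_eq[of j] by eventually_elim (simp add: e H_axis)
    qed
    ultimately show "(LINT x|lborel. v' x * pd e \<zeta> x) = - (LINT x|lborel. H e x * \<zeta> x)"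
      using weakv[OF \<zeta>, of i j] by (simp add: e)
  next
    fix l :: nat
    obtain f where f: "represents f (LP_projector \<phi> (2 ^ l) T)" "integrable lebesgue f"
      "(LINT x|lebesgue. norm (f x)) \<le> A * (2 ^ l) powr (- (1 + s))"
      using blocks by blast
    have fm: "f \<in> borel_measurable lebesgue" using f(2) by auto
    obtain f' where f'm: "f' \<in> borel_measurable borel" and f'_eq: "AE x in lborel. f x = f' x"
      using complex_Borel_representative[OF fm] by blast
    have "integrable lborel f'" using f(2) integrable_lebesgue_cong[OF fm f'm f'_eq] by simp
    moreover have "(LINT x|lborel. norm (f' x)) \<le> A * (q / 2) ^ l"
    proof -
      have "(LINT x|lebesgue. norm (f x)) = (LINT x|lborel. norm (f' x))"
      proof (rule integral_lebesgue_cong)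
        show "AE x in lborel. norm (f x) = norm (f' x)" using f'_eq by eventually_elim simp
      qed (use fm f'm in auto)
      \<comment> \<open>Passing from s to the smaller \<sigma> weakens the bound because 2^l >=
        1.\<close>
      moreover have "(2 ^ l :: real) powr (- (1 + s)) \<le> (2 ^ l) powr (- (1 + \<sigma>))"
        using \<sigma> by (intro powr_mono) auto
      moreover have "(2 ^ l :: real) powr (- (1 + \<sigma>)) = (q / 2) ^ l"
      proof -
        have "q / 2 = 2 powr (- (1 + \<sigma>))"
        proof -
          have "2 powr (- \<sigma> - 1) = 2 powr (- \<sigma>) / (2 :: real) powr 1" by (rule powr_diff)
          moreover have "- (1 + \<sigma>) = - \<sigma> - 1" by simp
          ultimately show ?thesis by (simp only: q_def) simp
        qed
        then have "(q / 2) ^ l = 2 powr (- (1 + \<sigma>) * real l)"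
          by (simp add: powr_realpow[symmetric] powr_powr)
        also have "\<dots> = (2 ^ l) powr (- (1 + \<sigma>))"
          by (simp add: powr_realpow[symmetric] powr_powr mult.commute)
        finally show ?thesis by simp
      qed
      ultimately show ?thesis
        using f(3) A by (smt (verit) mult_left_mono)
    qed
    moreover have "(LINT x|lborel. f' x * fourier g x) = LP_const \<phi> / of_real ((2 * pi) ^ DIM(real^'n)) *
        (LINT x|lborel. of_real (v' x) * fourier (\<lambda>k. of_real (\<phi> (k /\<^sub>R 2 ^ l) - \<phi> ((2 / 2 ^ l) *\<^sub>R k)) * g k) x)"
      if g: "test_function UNIV g" for g
    proof -
      have "smooth (\<lambda>k. complex_of_real (\<phi> (k /\<^sub>R 2 ^ l) - \<phi> ((2 / 2 ^ l) *\<^sub>R k)))"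
        using smooth_affine[OF LP_bump_smooth[OF \<phi>], of "inverse (2 ^ l)" 0] smooth_affine[OF LP_bump_smooth[OF \<phi>], of "2 / 2 ^ l" 0]
        by (intro smooth_linear[OF _ bounded_linear_of_real] smooth_diff) simp_all
      from test_function_mult_left[OF this g]
      have wg: "test_function UNIV (\<lambda>k. complex_of_real (\<phi> (k /\<^sub>R 2 ^ l) - \<phi> ((2 / 2 ^ l) *\<^sub>R k)) * g k)" .
      have "AE x in lborel. complex_of_real (v x $ i) = complex_of_real (v' x)"
        using v'_eq by eventually_elim simp
      from pairing_conv[OF _ _ this wg] vm v'm pairing_conv[OF fm f'm f'_eq g] LP_projector_pairing[OF \<phi> T(2) f(1) g]
      show ?thesis by simp
    qed
    ultimately show "\<exists>f. integrable lborel f \<and> (LINT x|lborel. norm (f x)) \<le> A * (q / 2) ^ l \<and>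
      (\<forall>g. test_function UNIV g \<longrightarrow> (LINT x|lborel. f x * fourier g x) =
        LP_const \<phi> / of_real ((2 * pi) ^ DIM(real^'n)) *
        (LINT x|lborel. of_real (v' x) * fourier (\<lambda>k. of_real (\<phi> (k /\<^sub>R 2 ^ l) - \<phi> ((2 / 2 ^ l) *\<^sub>R k)) * g k) x))"
      by blast
  qed
  obtain C l0 where C: "C \<ge> 0" and comp: "\<And>l. l \<ge> l0 \<Longrightarrow> \<exists>w. test_function \<Omega> w \<and>
     (\<forall>b\<in>Basis. AE x in lborel. x \<in> \<Omega> \<longrightarrow> \<bar>pd b w x - H b x\<bar> \<le> C) \<and>
     (\<forall>b\<in>Basis. (LINT x|lborel. indicator \<Omega> x * \<bar>pd b w x - H b x\<bar>) \<le> C * q ^ l) \<and>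
     (\<forall>b\<in>Basis. \<forall>b'\<in>Basis. (LINT x|lborel. \<bar>pd b' (pd b w) x\<bar>) \<le> C * (2 * q) ^ l)"
    using competitor by blast
  have H_eq: "AE x in lborel. H (axis j 1) x = (Gu x - M) $ i $ j" for j
    using h_eq[of j] Gv_eq[of j] by eventually_elim (simp add: H_axis)
  have "\<exists>w. test_function \<Omega> w \<and>
     (\<forall>j. AE x in lebesgue. x \<in> \<Omega> \<longrightarrow> \<bar>pd (axis j 1) w x - (Gu x - M) $ i $ j\<bar> \<le> C) \<and>
     (\<forall>j. (\<integral>\<^sup>+x\<in>\<Omega>. ennreal \<bar>pd (axis j 1) w x - (Gu x - M) $ i $ j\<bar> \<partial>lebesgue) \<le> ennreal (C * q ^ l)) \<and>
     (\<forall>j k. (LINT x|lborel. \<bar>pd (axis k 1) (pd (axis j 1) w) x\<bar>) \<le> C * (2 * q) ^ l)" if l: "l \<ge> l0" for l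
  proof -
    obtain w where w: "test_function \<Omega> w"
     and w1: "\<And>j. AE x in lborel. x \<in> \<Omega> \<longrightarrow> \<bar>pd (axis j 1) w x - H (axis j 1) x\<bar> \<le> C"
     and w2: "\<And>j. (LINT x|lborel. indicator \<Omega> x * \<bar>pd (axis j 1) w x - H (axis j 1) x\<bar>) \<le> C * q ^ l"
     and w3: "\<And>j k. (LINT x|lborel. \<bar>pd (axis k 1) (pd (axis j 1) w) x\<bar>) \<le> C * (2 * q) ^ l"
      using comp[OF l] axis_Basis by blast
    show ?thesis
    proof (intro exI[of _ w] conjI allI w w3)
      fix j
      show "AE x in lebesgue. x \<in> \<Omega> \<longrightarrow> \<bar>pd (axis j 1) w x - (Gu x - M) $ i $ j\<bar> \<le> C"
        unfolding AE_completion_iff using w1[of j] H_eq[of j] by eventually_elim simp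
      let ?D = "\<lambda>x. indicator \<Omega> x * \<bar>pd (axis j 1) w x - H (axis j 1) x\<bar>"
      have op: "\<Omega> \<in> sets borel" using \<Omega> by (simp add: bounded_C11_domain_def)
      have Di: "integrable lborel ?D"
        using integrable_mult_indicator[of \<Omega> lborel "\<lambda>x. \<bar>pd (axis j 1) w x - H (axis j 1) x\<bar>"] op
          test_function_integrable[OF test_function_pd[OF w axis_Basis]] G_integrable[OF axis_Basis]
        by simp
      have "(\<integral>\<^sup>+x\<in>\<Omega>. ennreal \<bar>pd (axis j 1) w x - (Gu x - M) $ i $ j\<bar> \<partial>lebesgue)
          = (\<integral>\<^sup>+x. ennreal (?D x) \<partial>lborel)"
        unfolding nn_integral_completion
      proof (rule nn_integral_cong_AE)
        show "AE x in lborel. ennreal \<bar>pd (axis j 1) w x - (Gu x - M) $ i $ j\<bar> * indicator \<Omega> x = ennreal (?D x)"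
          using H_eq[of j] by eventually_elim (auto simp: indicator_def)
      qed
      also have "\<dots> = ennreal (LINT x|lborel. ?D x)"
        by (rule nn_integral_eq_integral[OF Di]) simp
      also have "\<dots> \<le> ennreal (C * q ^ l)" by (rule ennreal_leI[OF w2])
      finally show "(\<integral>\<^sup>+x\<in>\<Omega>. ennreal \<bar>pd (axis j 1) w x - (Gu x - M) $ i $ j\<bar> \<partial>lebesgue) \<le> ennreal (C * q ^ l)" .
    qed
  qed
  with C show ?thesis by blast
qed

text \<open>On \<open>\<Omega>\<close> the matrix Gu x lies in \<open>K\<close> a.e., so the
  distance of the competitor's gradient to \<open>K\<close> is at most the sum S of the entrywise
  errors. As S <= n^2 C, S^2 is at most n^2 C S, whose integral is at most n^4 C a. The n^3 counts
  the entries of the tensor of second derivatives.\<close>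

lemma min_energy_competitor_bound:
  fixes \<Omega> :: "(real^'n) set" and M :: "real^'n^'n" and w :: "'n \<Rightarrow> real^'n \<Rightarrow> real" and Gu :: "real^'n \<Rightarrow> real^'n^'n"
  assumes \<Omega>: "open \<Omega>" "bounded \<Omega>" and w: "\<And>i. test_function \<Omega> (w i)"
    and Gu: "locally_integrable Gu" and GuK: "AE x in lebesgue. x \<in> \<Omega> \<longrightarrow> Gu x \<in> K"
    and sup: "\<And>i j. AE x in lebesgue. x \<in> \<Omega> \<longrightarrow> \<bar>pd (axis j 1) (w i) x - (Gu x - M) $ i $ j\<bar> \<le> C"
    and L1: "\<And>i j. (\<integral>\<^sup>+x\<in>\<Omega>. ennreal \<bar>pd (axis j 1) (w i) x - (Gu x - M) $ i $ j\<bar> \<partial>lebesgue) \<le> ennreal a"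
    and TV: "\<And>i j k. (LINT x|lborel. \<bar>pd (axis k 1) (pd (axis j 1) (w i)) x\<bar>) \<le> t"
    and C: "C \<ge> 0" and a: "a \<ge> 0" and t: "t \<ge> 0" and \<epsilon>: "\<epsilon> \<ge> 0"
  shows "min_energy \<Omega> M K \<epsilon> \<le> ennreal (real CARD('n) ^ 4 * C * a + real CARD('n) ^ 3 * (\<epsilon> * t))"
proof -
  let ?n = "real CARD('n)"
  define D where "D i j x = \<bar>pd (axis j 1) (w i) x - (Gu x - M) $ i $ j\<bar>" for i j x
  have Dm: "D i j \<in> borel_measurable lebesgue" for i j
  proof -
    have "(\<lambda>x. Gu x $ i $ j) \<in> borel_measurable lebesgue"
      by (rule borel_measurable_continuous_on[OF linear_continuous_on[OF bounded_linear_vec_nth2] locally_integrable_measurable[OF Gu]])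
    moreover have "pd (axis j 1) (w i) \<in> borel_measurable lebesgue"
      using test_function_measurable[OF test_function_pd[OF w axis_Basis]] by (intro measurable_completion) simp
    ultimately show ?thesis unfolding D_def by simp
  qed
  have ind: "(indicator \<Omega> :: real^'n \<Rightarrow> ennreal) \<in> borel_measurable lebesgue"
    using \<Omega>(1) by (intro borel_measurable_indicator) auto
  have "AE x in lebesgue. \<forall>i\<in>UNIV. \<forall>j\<in>UNIV. x \<in> \<Omega> \<longrightarrow> D i j x \<le> C"
    unfolding D_def by (intro AE_finite_allI finite_class.finite_UNIV sup)
  then have "AE x in lebesgue. ennreal ((infdist (competitor_grad M w x) K)\<^sup>2) * indicator \<Omega> x
      \<le> ennreal (?n\<^sup>2 * C) * (\<Sum>i\<in>UNIV. \<Sum>j\<in>UNIV. ennreal (D i j x) * indicator \<Omega> x)"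
    using GuK
  proof eventually_elim
    case (elim x)
    show ?case
    proof (cases "x \<in> \<Omega>")
      case True
      define S where "S = (\<Sum>i\<in>UNIV. \<Sum>j\<in>UNIV. D i j x)"
      have D0: "D i j x \<ge> 0" for i j by (simp add: D_def)
      have S0: "S \<ge> 0" unfolding S_def by (intro sum_nonneg D0)
      have SC: "S \<le> ?n\<^sup>2 * C"
      proof -
        have "S \<le> (\<Sum>i\<in>(UNIV::'n set). \<Sum>j\<in>(UNIV::'n set). C)"
          unfolding S_def using elim(1) True by (intro sum_mono) auto
        then show ?thesis by (simp add: power2_eq_square)
      qed
      have "infdist (competitor_grad M w x) K \<le> dist (competitor_grad M w x) (Gu x)"
        using elim(2) True by (intro infdist_le) auto
      also have "\<dots> \<le> (\<Sum>i\<in>UNIV. \<Sum>j\<in>UNIV. \<bar>(competitor_grad M w x - Gu x) $ i $ j\<bar>)"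
        unfolding dist_norm by (rule norm_matrix_le_sum)
      also have "\<dots> = S"
        unfolding S_def D_def by (intro sum.cong refl) (simp add: competitor_grad_def algebra_simps)
      finally have "(infdist (competitor_grad M w x) K)\<^sup>2 \<le> S\<^sup>2"
        by (intro power_mono infdist_nonneg)
      also have "\<dots> \<le> (?n\<^sup>2 * C) * S"
        unfolding power2_eq_square[of S] using SC S0 by (rule mult_right_mono)
      finally have "ennreal ((infdist (competitor_grad M w x) K)\<^sup>2) \<le> ennreal (?n\<^sup>2 * C) * ennreal S"
        using C S0 by (simp add: ennreal_leI flip: ennreal_mult)
      also have "ennreal S = (\<Sum>i\<in>UNIV. \<Sum>j\<in>UNIV. ennreal (D i j x))"
        unfolding S_def by (simp add: sum_ennreal D0 sum_nonneg)
      finally show ?thesis using True by simp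
    qed simp
  qed
  then have "(\<integral>\<^sup>+x\<in>\<Omega>. ennreal ((infdist (competitor_grad M w x) K)\<^sup>2) \<partial>lebesgue)
      \<le> (\<integral>\<^sup>+x. ennreal (?n\<^sup>2 * C) * (\<Sum>i\<in>UNIV. \<Sum>j\<in>UNIV. ennreal (D i j x) * indicator \<Omega> x) \<partial>lebesgue)"
    by (rule nn_integral_mono_AE)
  also have "\<dots> = ennreal (?n\<^sup>2 * C) * (\<Sum>i\<in>UNIV. \<Sum>j\<in>UNIV. \<integral>\<^sup>+x\<in>\<Omega>. ennreal (D i j x) \<partial>lebesgue)"
  proof -
    define F where "F i j x = ennreal (D i j x) * indicator \<Omega> x" for i j x
    have "F i j \<in> borel_measurable lebesgue" for i j
      unfolding F_def by (intro borel_measurable_times_ennreal measurable_compose[OF Dm measurable_ennreal] ind)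
    then have "(\<integral>\<^sup>+x. ennreal (?n\<^sup>2 * C) * (\<Sum>i\<in>UNIV. \<Sum>j\<in>UNIV. F i j x) \<partial>lebesgue)
        = ennreal (?n\<^sup>2 * C) * (\<Sum>i\<in>UNIV. \<Sum>j\<in>UNIV. \<integral>\<^sup>+x. F i j x \<partial>lebesgue)"
      by (simp add: nn_integral_cmult nn_integral_sum borel_measurable_sum)
    then show ?thesis unfolding F_def .
  qed
  also have "\<dots> \<le> ennreal (?n\<^sup>2 * C) * (\<Sum>i\<in>(UNIV::'n set). \<Sum>j\<in>(UNIV::'n set). ennreal a)"
    unfolding D_def by (intro mult_left_mono sum_mono L1) auto
  also have "(\<Sum>i\<in>(UNIV::'n set). \<Sum>j\<in>(UNIV::'n set). ennreal a) = ennreal (?n\<^sup>2 * a)"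
  proof -
    have "(\<Sum>i\<in>(UNIV::'n set). \<Sum>j\<in>(UNIV::'n set). ennreal a) = ennreal (\<Sum>i\<in>(UNIV::'n set). \<Sum>j\<in>(UNIV::'n set). a)"
      using a by (simp add: sum_ennreal sum_nonneg del: sum_constant)
    then show ?thesis by (simp add: power2_eq_square mult.assoc)
  qed
  also have "ennreal (?n\<^sup>2 * C) * ennreal (?n\<^sup>2 * a) = ennreal (?n ^ 4 * C * a)"
    using C a by (simp add: algebra_simps flip: ennreal_mult power_add)
  finally have elastic: "(\<integral>\<^sup>+x\<in>\<Omega>. ennreal ((infdist (competitor_grad M w x) K)\<^sup>2) \<partial>lebesgue) \<le> ennreal (?n ^ 4 * C * a)" .
  have "total_variation \<Omega> (competitor_grad M w) \<le>
     ennreal (\<Sum>i\<in>UNIV. \<Sum>j\<in>UNIV. \<Sum>k\<in>UNIV. LINT x|lborel. \<bar>pd (axis k 1) (pd (axis j 1) (w i)) x\<bar>)"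
    by (rule competitor_total_variation[OF \<Omega> w])
  also have "\<dots> \<le> ennreal (\<Sum>i\<in>(UNIV::'n set). \<Sum>j\<in>(UNIV::'n set). \<Sum>k\<in>(UNIV::'n set). t)"
    by (intro ennreal_leI sum_mono TV)
  also have "(\<Sum>i\<in>(UNIV::'n set). \<Sum>j\<in>(UNIV::'n set). \<Sum>k\<in>(UNIV::'n set). t) = ?n ^ 3 * t"
    by (simp add: power3_eq_cube)
  finally have "ennreal \<epsilon> * total_variation \<Omega> (competitor_grad M w) \<le> ennreal \<epsilon> * ennreal (?n ^ 3 * t)"
    by (rule mult_left_mono) simp
  also have "\<dots> = ennreal (?n ^ 3 * (\<epsilon> * t))"
    using \<epsilon> t by (simp add: mult_ac flip: ennreal_mult)
  finally have surface: "ennreal \<epsilon> * total_variation \<Omega> (competitor_grad M w) \<le> ennreal (?n ^ 3 * (\<epsilon> * t))" .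
  have "min_energy \<Omega> M K \<epsilon> \<le> (\<integral>\<^sup>+x\<in>\<Omega>. ennreal ((infdist (competitor_grad M w x) K)\<^sup>2) \<partial>lebesgue)
      + ennreal \<epsilon> * total_variation \<Omega> (competitor_grad M w)"
    unfolding min_energy_def using INF_lower[OF competitor_admissible[OF \<Omega> w], of "\<lambda>(u, G).
      (\<integral>\<^sup>+x\<in>\<Omega>. ennreal ((infdist (G x) K)\<^sup>2) \<partial>lebesgue) + ennreal \<epsilon> * total_variation \<Omega> G" M] by simp
  also have "\<dots> \<le> ennreal (?n ^ 4 * C * a) + ennreal (?n ^ 3 * (\<epsilon> * t))"
    by (rule add_mono[OF elastic surface])
  also have "\<dots> = ennreal (?n ^ 4 * C * a + ?n ^ 3 * (\<epsilon> * t))"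
    using C a \<epsilon> t by (intro ennreal_plus[symmetric]) auto
  finally show ?thesis .
qed

theorem proposition2p2:
  fixes \<Omega> :: "(real^'n) set"
    and M :: "real^'n^'n"
    and \<theta> \<theta>c :: real and \<alpha> :: "real \<Rightarrow> real" and m :: nat
    and U :: "nat \<Rightarrow> real \<Rightarrow> real^'n^'n"
    and K :: "(real^'n^'n) set"
    and \<phi> :: "real^'n \<Rightarrow> real"
    and C \<epsilon>0 \<mu> s :: real
    and u v :: "real^'n \<Rightarrow> real^'n" and b :: "real^'n"
  assumes "bounded_C11_domain \<Omega>"
    and "\<theta> \<ge> 0" and "\<theta>c \<ge> 0" and "m \<ge> 1"
    and "\<forall>t\<ge>0. \<alpha> t \<ge> 0"
    and "\<forall>t\<ge>0. \<forall>j\<in>{1..m}. t \<le> \<theta>c \<longrightarrow> transpose (U j t) = U j t"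
    and "K = energy_wells \<theta>c \<alpha> m U \<theta>"
    and "LP_bump \<phi>"
    and "C > 1" and "\<epsilon>0 > 0" and "0 < \<mu>" and "\<mu> < 1/2"
    and "\<forall>\<epsilon>. 0 < \<epsilon> \<and> \<epsilon> < \<epsilon>0 \<longrightarrow> ennreal (\<epsilon> powr (2 * \<mu>)) \<le> ennreal C * min_energy \<Omega> M K \<epsilon>"
    and "solves_inclusion \<Omega> M K u"
    and "\<forall>x. v x = u x - M *v x - b"
    and "in_besov \<phi> (1 + s) 1 v"
    and "ess_support v \<subseteq> closure \<Omega>"
    and "weak_gradient_Linfty v"
  shows "s \<le> 2 * \<mu>"
proof (rule ccontr)
  assume "\<not> s \<le> 2 * \<mu>"
  \<comment> \<open>The midpoint of 2 \<mu> and 1 caps the exponent: it stays above 2 \<mu> and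
    falls below 1.\<close>
  define \<sigma> where "\<sigma> = min s ((2 * \<mu> + 1) / 2)"
  have \<sigma>: "2 * \<mu> < \<sigma>" "\<sigma> < 1" "\<sigma> \<le> s" "0 < \<sigma>"
    using \<open>\<not> s \<le> 2 * \<mu>\<close> assms(11,12) by (auto simp: \<sigma>_def min_def)
  define q :: real where "q = 2 powr (- \<sigma>)"
  have q0: "q > 0" by (simp add: q_def)
  have \<Omega>: "open \<Omega>" "bounded \<Omega>" using assms(1) by (auto simp: bounded_C11_domain_def)
  obtain Gu where Gu: "has_weak_gradient u Gu" "AE x in lebesgue. x \<in> \<Omega> \<longrightarrow> Gu x \<in> K"
    "AE x in lebesgue. x \<notin> closure \<Omega> \<longrightarrow> Gu x = M"
    using assms(14) unfolding solves_inclusion_def by blast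
  obtain Gv B where Gv: "has_weak_gradient v Gv" "AE x in lebesgue. norm (Gv x) \<le> B"
    using assms(18) unfolding weak_gradient_Linfty_def by blast
  have locGu: "locally_integrable Gu" using Gu(1) unfolding has_weak_gradient_def by blast
  \<comment> \<open>The competitor property of one component with constant \<open>A\<close>. It is
    monotone in \<open>A\<close>, so \<open>uniform_constant\<close> yields one constant for all
    components.\<close>
  define P where "P i A l w \<longleftrightarrow> test_function \<Omega> w \<and>
     (\<forall>j. AE x in lebesgue. x \<in> \<Omega> \<longrightarrow> \<bar>pd (axis j 1) w x - (Gu x - M) $ i $ j\<bar> \<le> A) \<and>
     (\<forall>j. (\<integral>\<^sup>+x\<in>\<Omega>. ennreal \<bar>pd (axis j 1) w x - (Gu x - M) $ i $ j\<bar> \<partial>lebesgue) \<le> ennreal (A * q ^ l)) \<and>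
     (\<forall>j k. (LINT x|lborel. \<bar>pd (axis k 1) (pd (axis j 1) w) x\<bar>) \<le> A * (2 * q) ^ l)" for i A l w
  have P_mono: "P i A' l w" if "P i A l w" "A \<le> A'" for i A A' l w
  proof -
    have le: "A * q ^ l \<le> A' * q ^ l" "A * (2 * q) ^ l \<le> A' * (2 * q) ^ l"
      using that(2) q0 by (auto intro!: mult_right_mono)
    show ?thesis
      unfolding P_def
    proof (intro conjI allI)
      fix j k
      show "test_function \<Omega> w" using that(1) by (simp add: P_def)
      have "AE x in lebesgue. x \<in> \<Omega> \<longrightarrow> \<bar>pd (axis j 1) w x - (Gu x - M) $ i $ j\<bar> \<le> A"
        using that(1) unfolding P_def by blast
      then show "AE x in lebesgue. x \<in> \<Omega> \<longrightarrow> \<bar>pd (axis j 1) w x - (Gu x - M) $ i $ j\<bar> \<le> A'"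
        by eventually_elim (use that(2) in auto)
      show "(\<integral>\<^sup>+x\<in>\<Omega>. ennreal \<bar>pd (axis j 1) w x - (Gu x - M) $ i $ j\<bar> \<partial>lebesgue) \<le> ennreal (A' * q ^ l)"
        using that(1) ennreal_leI[OF le(1)] unfolding P_def by (blast intro: order_trans)
      show "(LINT x|lborel. \<bar>pd (axis k 1) (pd (axis j 1) w) x\<bar>) \<le> A' * (2 * q) ^ l"
        using that(1) le(2) unfolding P_def by (blast intro: order_trans)
    qed
  qed
  have "\<exists>A\<ge>0. \<forall>i\<in>UNIV. \<exists>l0. \<forall>l\<ge>l0. \<exists>w. P i A l w"
  proof (rule uniform_constant[OF finite_class.finite_UNIV])
    fix i :: 'n
    obtain T where T: "T \<in> besov_space \<phi> (1 + s) 1" "represents (\<lambda>x. of_real (v x $ i)) T"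
      using assms(16) unfolding in_besov_def by blast
    show "\<exists>A\<ge>0. \<exists>l0. \<forall>l\<ge>l0. \<exists>w. P i A l w"
      unfolding P_def q_def
      by (rule component_competitor[OF assms(8,1) Gu(1,3) _ assms(17) Gv T \<sigma>(4,2,3)]) (use assms(15) in blast)
  qed (use P_mono in blast)
  then obtain A where A: "A \<ge> 0" and "\<forall>i. \<exists>l0. \<forall>l\<ge>l0. \<exists>w. P i A l w" by blast
  then obtain l0 where l0: "\<And>i l. l \<ge> l0 i \<Longrightarrow> \<exists>w. P i A l w" by metis
  \<comment> \<open>One threshold serves all components, which are finite in number.\<close>
  define L where "L = Max (range l0)"
  have L: "l0 i \<le> L" for i by (simp add: L_def)
  define R where "R = real CARD('n) ^ 4 * A * A + real CARD('n) ^ 3 * A"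
  have R: "R \<ge> 0" using A by (simp add: R_def)
  have bound: "(2 powr (\<sigma> - 2 * \<mu>)) ^ l \<le> C * R" if l: "l \<ge> L" and small: "(1 / 2) ^ l < \<epsilon>0" for l
  proof -
    \<comment> \<open>With this \<epsilon> the surface term \<epsilon> (2 q)^l equals q^l, the order
      of the elastic term.\<close>
    define \<epsilon> :: real where "\<epsilon> = (1 / 2) ^ l"
    have \<epsilon>: "0 < \<epsilon>" "\<epsilon> < \<epsilon>0" using small by (auto simp: \<epsilon>_def)
    have "\<forall>i. \<exists>w. P i A l w" using l0 L l order_trans by blast
    then obtain w where w: "\<And>i. P i A l (w i)" by metis
    have "min_energy \<Omega> M K \<epsilon> \<le> ennreal (real CARD('n) ^ 4 * A * (A * q ^ l) + real CARD('n) ^ 3 * (\<epsilon> * (A * (2 * q) ^ l)))"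
    proof (rule min_energy_competitor_bound[OF \<Omega> _ locGu Gu(2), of w])
      fix i j k
      note wi = w[of i, unfolded P_def]
      show "test_function \<Omega> (w i)" using wi by blast
      show "AE x in lebesgue. x \<in> \<Omega> \<longrightarrow> \<bar>pd (axis j 1) (w i) x - (Gu x - M) $ i $ j\<bar> \<le> A" using wi by blast
      show "(\<integral>\<^sup>+x\<in>\<Omega>. ennreal \<bar>pd (axis j 1) (w i) x - (Gu x - M) $ i $ j\<bar> \<partial>lebesgue) \<le> ennreal (A * q ^ l)" using wi by blast
      show "(LINT x|lborel. \<bar>pd (axis k 1) (pd (axis j 1) (w i)) x\<bar>) \<le> A * (2 * q) ^ l" using wi by blast
    qed (use A q0 \<epsilon> in auto)
    also have "real CARD('n) ^ 4 * A * (A * q ^ l) + real CARD('n) ^ 3 * (\<epsilon> * (A * (2 * q) ^ l)) = R * q ^ l"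
    proof -
      have "\<epsilon> * (2 * q) ^ l = (1 / 2 * (2 * q)) ^ l" by (simp only: \<epsilon>_def power_mult_distrib)
      then have "\<epsilon> * (2 * q) ^ l = q ^ l" by simp
      then have "\<epsilon> * (A * (2 * q) ^ l) = A * q ^ l" by (simp add: mult.left_commute)
      then show ?thesis by (simp add: R_def algebra_simps)
    qed
    finally have E: "min_energy \<Omega> M K \<epsilon> \<le> ennreal (R * q ^ l)" .
    have "ennreal (\<epsilon> powr (2 * \<mu>)) \<le> ennreal C * min_energy \<Omega> M K \<epsilon>" using assms(13) \<epsilon> by blast
    also have "\<dots> \<le> ennreal C * ennreal (R * q ^ l)" by (rule mult_left_mono[OF E]) simp
    also have "\<dots> = ennreal (C * (R * q ^ l))" using assms(9) R q0 by (intro ennreal_mult[symmetric]) auto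
    finally have le: "\<epsilon> powr (2 * \<mu>) \<le> C * R * q ^ l"
      using assms(9) R q0 by (subst (asm) ennreal_le_iff) (auto simp: mult.assoc)
    have "\<epsilon> powr (2 * \<mu>) = (2 powr (- 2 * \<mu>)) ^ l"
      by (simp add: \<epsilon>_def powr_realpow[symmetric] powr_powr powr_divide powr_minus_divide mult.commute)
    also have "2 powr (- 2 * \<mu>) = 2 powr (\<sigma> - 2 * \<mu>) * q"
      by (simp add: q_def flip: powr_add)
    \<comment> \<open>The lower bound 2^(-2 \<mu> l) is split into the l-th power of a base above 1
      and q^l, so that q^l cancels.\<close>
    finally have "(2 powr (\<sigma> - 2 * \<mu>)) ^ l * q ^ l \<le> C * R * q ^ l"
      using le by (simp add: power_mult_distrib)
    then show ?thesis using q0 by simp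
  qed
  \<comment> \<open>Powers of a base above 1 are unbounded, while \<open>bound\<close> caps them by
    C R for all large l.\<close>
  have X: "1 < 2 powr (\<sigma> - 2 * \<mu>)" using \<sigma>(1) powr_less_mono[of 0 "\<sigma> - 2 * \<mu>" 2] by simp
  obtain n1 where n1: "C * R < (2 powr (\<sigma> - 2 * \<mu>)) ^ n1" using real_arch_pow[OF X] by blast
  obtain n2 where n2: "(1 / 2) ^ n2 < \<epsilon>0" using real_arch_pow_inv[of \<epsilon>0 "1 / 2"] assms(10) by auto
  define l where "l = max L (max n1 n2)"
  have l: "l \<ge> L" "l \<ge> n1" "l \<ge> n2" by (auto simp: l_def)
  have "(1 / 2 :: real) ^ l \<le> (1 / 2) ^ n2" using l(3) by (intro power_decreasing) auto
  then have "(1 / 2) ^ l < \<epsilon>0" using n2 by (rule le_less_trans)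
  then have "(2 powr (\<sigma> - 2 * \<mu>)) ^ l \<le> C * R" by (rule bound[OF l(1)])
  moreover have "(2 powr (\<sigma> - 2 * \<mu>)) ^ n1 \<le> (2 powr (\<sigma> - 2 * \<mu>)) ^ l"
    using X l(2) by (intro power_increasing) auto
  ultimately show False using n1 by linarith
qed

end
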